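(* There exists a constant $\mathbf{c}=\mathbf{c}(n,r_0,\sigma,\vartheta)>0$ such that for all $m\in \mathbb{N}$, $\lambda \in \Lambda$, $q\in Q$, $u\in W^{2,p}(B)\cap O_m$ and $0<\eta < \frac{\rho}{4}$ we have \[ \mathbf{c}\|u\|_{L^2(B_{\rho/2})}\le \eta^{-\lambda}\|(\Delta+q) u\|_{L^p(B)} + 2^{-(\lambda+1)}\|(\Delta+q) (\phi u)\|_{L^{p}(B)}+3^m\eta^{m-(\lambda+3)}\varrho_m(u). \]
   Context: Let $n\ge 3$ be an integer, $p:=\frac{2n}{n+2}$, $p':=\frac{2n}{n-2}$. $B_r\subset\mathbb{R}^n$ is the open ball centered at $0$ with radius $r>0$, $B:=B_1$, $\dot B:=B\setminus\{0\}$; $\mathbb{N}$ is the set of positive integers. Let $\mathbf{B}_r$ be the closed ball of $L^{n/2}(B)$ centered at $0$ with radius $r>0$. $\Lambda:=\{\lambda>0:\ \mathrm{dist}(\lambda,\mathbb{N}+\frac{n-2}{2})=\frac12\}$. For $m\in\mathbb{N}$, $O_m$ is the set of $w\in L^2(B)$ with $\varrho_m(w):=\sup\{\eta^{-m}\|w\|_{L^2(B_\eta)}:\ 0<\eta<1\}<\infty$. $r_\ast=r_\ast(n)>0$ is a constant (such a constant exists) with the property that for every $0<r_0<r_\ast$ there is $\kappa_0=\kappa_0(n,r_0)>0$ such that $\||x|^{-\lambda}u\|_{L^{p'}(B)}\le \kappa_0\||x|^{-\lambda}(\Delta+q)u\|_{L^p(B)}$ for all $u\in C_0^\infty(\dot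 B)$, $q\in\mathbf{B}_{r_0}$, $\lambda\in\Lambda$. $\sigma:=\sup\{\|w\|_{L^{p'}(B)}:\ w\in H_0^1(B),\ \|\nabla w\|_{L^2(B)}=1\}$. Fix $0<r_0<r_\ast$ and $\vartheta>0$ with $2\vartheta\sigma^2<1$; set $\varsigma:=\inf(r_0,\vartheta)$ and $Q:=\mathbf{B}_\varsigma$. Fix arbitrarily $0<\rho<\frac12$ and $\phi\in C_0^\infty(B)$ with $\phi=1$ in $B_{1/2}$ and $0\le\phi\le1$. *)

theory Defs
  imports "HOL-Analysis.Analysis"
begin

text \<open>
  Functions on an open set U of R^n are represented by total functions on
  \<^typ>\<open>real^'n\<close> whose values outside U are irrelevant.  Their values lie in
  an abstract \<^typ>\<open>'a::{real_normed_field, euclidean_space}\<close>, so that real-valued and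
  complex-valued functions are both covered.  Test functions are the exception: they are
  smooth on the whole space, i.e. extended by zero.
\<close>

subsection \<open>Lebesgue spaces\<close>

text \<open>Real powers of extended nonnegative reals, for exponents r > 0.\<close>

definition ennpowr :: "ennreal \<Rightarrow> real \<Rightarrow> ennreal" where
  "ennpowr a r = (if a = \<infinity> then \<infinity> else ennreal (enn2real a powr r))"

text \<open>The norm takes the value \<open>\<infinity>\<close> on functions with divergent integral.\<close>

definition Lp_norm :: "real \<Rightarrow> (real^'n) set \<Rightarrow> (real^'n \<Rightarrow> 'a::euclidean_space) \<Rightarrow> ennreal" where
  "Lp_norm p U f = ennpowr (\<integral>\<^sup>+x. ennreal (norm (f x) powr p) \<partial>lebesgue_on U) (1 / p)"

definition Lp_space :: "real \<Rightarrow> (real^'n) set \<Rightarrow> (real^'n \<Rightarrow> 'a::euclidean_space) set" where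
  "Lp_space p U = {f. f \<in> borel_measurable (lebesgue_on U) \<and> Lp_norm p U f < \<infinity>}"

definition Lp_cball :: "real \<Rightarrow> (real^'n) set \<Rightarrow> real \<Rightarrow> (real^'n \<Rightarrow> 'a::euclidean_space) set" where
  "Lp_cball p U r = {f \<in> Lp_space p U. Lp_norm p U f \<le> ennreal r}"

subsection \<open>Smooth functions with compact support\<close>

text \<open>A multi-index is a list of coordinate directions; its order is the length of the list.\<close>

fun partials :: "'n list \<Rightarrow> (real^'n \<Rightarrow> 'a::real_normed_vector) \<Rightarrow> real^'n \<Rightarrow> 'a" where
  "partials [] f = f"
| "partials (i # is) f = (\<lambda>x. frechet_derivative (partials is f) (at x) (axis i 1))"

definition test_functions :: "(real^'n) set \<Rightarrow> (real^'n \<Rightarrow> 'a::real_normed_vector) set" where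
  "test_functions U = {f. (\<forall>is x. partials is f differentiable (at x)) \<and>
     compact (closure {x. f x \<noteq> 0}) \<and> closure {x. f x \<noteq> 0} \<subseteq> U}"

definition laplacian :: "(real^'n \<Rightarrow> 'a::real_normed_vector) \<Rightarrow> real^'n \<Rightarrow> 'a" where
  "laplacian f x = (\<Sum>i\<in>UNIV. partials [i, i] f x)"

subsection \<open>Weak derivatives and Sobolev spaces\<close>

definition locally_integrable :: "(real^'n) set \<Rightarrow> (real^'n \<Rightarrow> 'a::euclidean_space) \<Rightarrow> bool" where
  "locally_integrable U f \<longleftrightarrow> (\<forall>K. compact K \<and> K \<subseteq> U \<longrightarrow> f absolutely_integrable_on K)"

definition has_weak_deriv ::
  "(real^'n) set \<Rightarrow> 'n list \<Rightarrow> (real^'n \<Rightarrow> 'a::euclidean_space) \<Rightarrow> (real^'n \<Rightarrow> 'a) \<Rightarrow> bool" where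
  "has_weak_deriv U is u g \<longleftrightarrow> locally_integrable U u \<and> locally_integrable U g \<and>
     (\<forall>\<psi>\<in>test_functions U.
        (\<integral>x. partials is \<psi> x *\<^sub>R u x \<partial>lebesgue_on U) =
        (- 1) ^ length is *\<^sub>R (\<integral>x. \<psi> x *\<^sub>R g x \<partial>lebesgue_on U))"

text \<open>A representative of the weak derivative, which is determined up to null sets only.\<close>

definition weak_deriv ::
  "(real^'n) set \<Rightarrow> 'n list \<Rightarrow> (real^'n \<Rightarrow> 'a::euclidean_space) \<Rightarrow> real^'n \<Rightarrow> 'a" where
  "weak_deriv U is u = (SOME g. has_weak_deriv U is u g)"

definition weak_laplacian ::
  "(real^'n) set \<Rightarrow> (real^'n \<Rightarrow> 'a::euclidean_space) \<Rightarrow> real^'n \<Rightarrow> 'a" where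
  "weak_laplacian U u x = (\<Sum>i\<in>UNIV. weak_deriv U [i, i] u x)"

definition weak_grad_length ::
  "(real^'n) set \<Rightarrow> (real^'n \<Rightarrow> 'a::euclidean_space) \<Rightarrow> real^'n \<Rightarrow> real" where
  "weak_grad_length U u x = sqrt (\<Sum>i\<in>UNIV. (norm (weak_deriv U [i] u x))\<^sup>2)"

definition sobolev ::
  "nat \<Rightarrow> real \<Rightarrow> (real^'n) set \<Rightarrow> (real^'n \<Rightarrow> 'a::euclidean_space) set" where
  "sobolev k p U = {u \<in> Lp_space p U.
     \<forall>is. length is \<le> k \<longrightarrow> (\<exists>g\<in>Lp_space p U. has_weak_deriv U is u g)}"

text \<open>The closure of the test functions in \<^term>\<open>sobolev 1 2 U\<close>.\<close>

definition sobolev_H10 :: "(real^'n) set \<Rightarrow> (real^'n \<Rightarrow> 'a::euclidean_space) set" where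
  "sobolev_H10 U = {u \<in> sobolev 1 2 U. \<forall>\<epsilon>>0. \<exists>\<psi>\<in>test_functions U.
     Lp_norm 2 U (\<lambda>x. u x - \<psi> x) + Lp_norm 2 U (weak_grad_length U (\<lambda>x. u x - \<psi> x))
       < ennreal \<epsilon>}"

subsection \<open>Carleman exponents and functions vanishing at the origin\<close>

definition carleman_exponents :: "nat \<Rightarrow> real set" where
  "carleman_exponents n =
     {\<tau>. \<tau> > 0 \<and> infdist \<tau> {real k + (real n - 2) / 2 | k. k \<ge> 1} = 1 / 2}"

definition vanishing_const :: "nat \<Rightarrow> (real^'n \<Rightarrow> 'a::euclidean_space) \<Rightarrow> ennreal" where
  "vanishing_const m w =
     (SUP \<eta>\<in>{0<..<1}. ennreal (\<eta> powr (- real m)) * Lp_norm 2 (ball 0 \<eta>) w)"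

definition vanishing_space :: "nat \<Rightarrow> (real^'n \<Rightarrow> 'a::euclidean_space) set" where
  "vanishing_space m = {w \<in> Lp_space 2 (ball 0 1). vanishing_const m w < \<infinity>}"

end

theory Submission
  imports Defs
begin

text \<open>
  Everything is first proved for a test function \<open>V\<close>, with \<open>F = \<Delta>V + q V\<close>.  The Carleman inequality
  is applied to \<open>(1 - \<phi>\<^sub>0(x / \<eta>)) V\<close>, where \<open>\<phi>\<^sub>0\<close> is a fixed cut-off function.  On the right-hand side the weight
  \<open>|x| powr -\<tau>\<close> is of order \<open>(\<eta> / 2) powr -\<tau>\<close> on \<open>B\<^bsub>1/2\<^esub>\<close> and at most \<open>2 powr \<tau>\<close> outside; the commutator terms live on
  \<open>B\<^sub>\<eta>\<close> and involve \<open>\<nabla>V\<close>, which the Caccioppoli inequality (here \<open>2 \<theta> \<sigma>\<^sup>2 < 1\<close> absorbs the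
  potential) bounds by \<open>\<parallel>F\<parallel>\<^sub>p\<close> and \<open>\<eta>\<^sup>-\<^sup>1 \<parallel>V\<parallel>\<^sub>2\<close> on \<open>B\<^bsub>2\<eta>\<^esub>\<close>.

  For \<open>u\<close> in the Sobolev space, \<open>\<phi> u\<close> is mollified.  Its Laplacians converge in \<open>L\<^sup>p\<close>, and
  \<open>\<parallel>w\<parallel>\<^bsub>p'\<^esub> \<le> \<sigma>\<^sup>2 \<parallel>\<Delta>w\<parallel>\<^sub>p\<close> for test functions \<open>w\<close>, so the mollifications converge in the \<open>p'\<close>-norm, which is what
  the term \<open>q V\<close> needs.  All cut-off functions and mollifiers are obtained by dilating one \<open>\<phi>\<^sub>0\<close> that
  satisfies the requirements on \<open>\<phi>\<close> in the statement: if there is none, the statement is vacuous.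
\<close>

subsection \<open>Smooth functions and test functions\<close>

text \<open>The two terms with \<open>\<Delta> + q\<close> have a common origin. \<open>V\<close>
  approximates \<open>\<phi> u\<close>, so on the ball of radius 1/2, where \<phi> is 1, the
  residual is that of \<open>u\<close> and may carry the large weight. Beyond that ball only the
  residual of \<open>\<phi> u\<close> is available, with weight at most
  \<open>2 powr \<tau>\<close>. Multiplying by \<open>(\<rho> / 2) powr \<tau>\<close> turns this
  weight into \<open>\<rho> powr \<tau>\<close>, and \<rho> < 1/2 makes it at most twice
  \<open>2 powr (- (\<tau> + 1))\<close>.

  The exponents enter through four identities: 1/p = 2/n + 1/p' controls \<open>q V\<close>; 1/p +
  1/p' = 1 is the duality in the energy estimate; 1/p = 1/n + 1/2 and 1/2 = 1/n + 1/p' are Holder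
  against the constant 1, whose L^n norm on a ball is proportional to the radius. The radius \<eta>
  gained in this way compensates one factor 1/\<eta> of each commutator term.

  The constant is uniform in \<rho> and \<phi> because the derivative bound K belongs to the
  auxiliary cut-off, which is fixed beforehand. Norms are extended reals with 0 * \<infinity> = 0,
  so infinite norms and a vanishing Sobolev constant appear as separate cases.\<close>

declare partials.simps(2) [simp del]

definition smooth :: "(real^'n \<Rightarrow> 'b::real_normed_vector) \<Rightarrow> bool" where
  "smooth f \<longleftrightarrow> (\<forall>is x. partials is f differentiable (at x))"

text \<open>\<open>partials\<close> unfolds the outermost derivative; induction over the order of
  differentiability, as in the product rule, needs the innermost one instead.\<close>

fun Ck :: "nat \<Rightarrow> (real^'n \<Rightarrow> 'b::real_normed_vector) \<Rightarrow> bool" where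
  "Ck 0 f = True"
| "Ck (Suc k) f = ((\<forall>x. f differentiable (at x)) \<and> (\<forall>i. Ck k (partials [i] f)))"

lemma partials_append: "partials (is @ js) f = partials is (partials js f)"
  by (induction "is") (auto simp: partials.simps(2))

lemma partials_pair: "partials [i, j] f = partials [i] (partials [j] f)"
  by (simp add: partials.simps(2))

text \<open>\<open>Ck\<close> removes the direction that is differentiated first, which is the last
  entry of the list; hence the case split from the right end.\<close>

lemma Ck_iff: "Ck k f \<longleftrightarrow> (\<forall>is x. length is < k \<longrightarrow> partials is f differentiable (at x))"
proof (induction k arbitrary: f)
  case (Suc k)
  show ?case (is "_ \<longleftrightarrow> ?R")
  proof
    assume L: "Ck (Suc k) f"
    show ?R
    proof (intro allI impI)
      fix "is" :: "'a list" and x assume "length is < Suc k"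
      then show "partials is f differentiable at x"
        using L Suc.IH by (cases "is" rule: rev_cases) (auto simp: partials_append)
    qed
  next
    assume R: ?R
    have "partials (is @ [i]) f differentiable at x" if "length is < k" for "is" i x
      using R that by (metis Suc_mono length_append_singleton)
    then show "Ck (Suc k) f"
      using R Suc.IH by (auto simp: partials_append dest: spec[where x="[]"])
  qed
qed auto

lemma smooth_iff_Ck: "smooth f \<longleftrightarrow> (\<forall>k. Ck k f)"
  unfolding smooth_def Ck_iff by (meson lessI)

lemma smooth_partials: "smooth f \<Longrightarrow> smooth (partials is f)"
  unfolding smooth_def by (metis partials_append)

lemma smooth_differentiable: "smooth f \<Longrightarrow> f differentiable (at x)"
  unfolding smooth_def by (metis partials.simps(1))

lemma partials_single: "(f has_derivative D) (at x) \<Longrightarrow> partials [i] f x = D (axis i 1)"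
  by (simp add: partials.simps(2) flip: frechet_derivative_at)

lemma frechet_derivative_axis: "frechet_derivative f (at x) (axis i 1) = partials [i] f x"
  by (simp add: partials.simps(2))

lemma has_derivative_partials:
  fixes f :: "real^'n \<Rightarrow> 'b::real_normed_vector"
  assumes "f differentiable (at x)"
  shows "(f has_derivative (\<lambda>h. \<Sum>i\<in>UNIV. h $ i *\<^sub>R partials [i] f x)) (at x)"
proof -
  let ?D = "frechet_derivative f (at x)"
  have D: "(f has_derivative ?D) (at x)"
    using assms by (simp add: frechet_derivative_works)
  then have lin: "linear ?D" by (simp add: has_derivative_linear)
  have "?D h = (\<Sum>i\<in>UNIV. h $ i *\<^sub>R partials [i] f x)" for h
  proof -
    have "?D h = ?D (\<Sum>i\<in>UNIV. h $ i *\<^sub>R axis i 1)"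
      by (simp add: basis_expansion flip: scalar_mult_eq_scaleR)
    also have "\<dots> = (\<Sum>i\<in>UNIV. h $ i *\<^sub>R ?D (axis i 1))"
      by (simp only: linear_sum[OF lin] linear_scale[OF lin])
    finally show ?thesis by (simp add: frechet_derivative_axis)
  qed
  then have "?D = (\<lambda>h. \<Sum>i\<in>UNIV. h $ i *\<^sub>R partials [i] f x)"
    by (rule ext)
  then show ?thesis using D by simp
qed

lemma Ck_Suc_imp: "Ck (Suc k) f \<Longrightarrow> Ck k f"
  by (simp add: Ck_iff)

section \<open>Calculus rules for coordinate derivatives\<close>

lemma partials_add:
  assumes "\<And>x. f differentiable (at x)" "\<And>x. g differentiable (at x)"
  shows "partials [i] (\<lambda>x. f x + g x) = (\<lambda>x. partials [i] f x + partials [i] g x)"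
proof
  fix x
  show "partials [i] (\<lambda>x. f x + g x) x = partials [i] f x + partials [i] g x"
    using partials_single[OF has_derivative_add[OF assms[unfolded frechet_derivative_works]], of i x]
    by (simp add: frechet_derivative_axis)
qed

lemma Ck_add: "Ck k f \<Longrightarrow> Ck k g \<Longrightarrow> Ck k (\<lambda>x. f x + g x)"
  by (induction k arbitrary: f g) (auto simp: partials_add intro: differentiable_add)

lemma (in bounded_bilinear) partials_prod:
  assumes "\<And>x. f differentiable (at x)" "\<And>x. g differentiable (at x)"
  shows "partials [i] (\<lambda>x. prod (f x) (g x)) = (\<lambda>x. prod (f x) (partials [i] g x) + prod (partials [i] f x) (g x))"
proof
  fix x
  show "partials [i] (\<lambda>x. prod (f x) (g x)) x = prod (f x) (partials [i] g x) + prod (partials [i] f x) (g x)"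
    using partials_single[OF FDERIV[OF assms[unfolded frechet_derivative_works]], of i x]
    by (simp add: frechet_derivative_axis)
qed

lemma (in bounded_bilinear) differentiable_prod:
  "f differentiable (at x) \<Longrightarrow> g differentiable (at x) \<Longrightarrow> (\<lambda>x. prod (f x) (g x)) differentiable (at x)"
  unfolding differentiable_def using FDERIV by blast

text \<open>Proved for every bounded bilinear product, so that scalar multiplication and the inner
  product are both instances. The induction generalizes both factors, since the product rule
  differentiates one of them and \<open>Ck_Suc_imp\<close> lowers the order of the other.\<close>

lemma (in bounded_bilinear) Ck_prod: "Ck k f \<Longrightarrow> Ck k g \<Longrightarrow> Ck k (\<lambda>x. prod (f x) (g x))"
proof (induction k arbitrary: f g)
  case (Suc k)
  then show ?case
    using Ck_Suc_imp[OF Suc.prems(1)] Ck_Suc_imp[OF Suc.prems(2)]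
    by (auto simp: partials_prod intro!: differentiable_prod Ck_add)
qed auto

lemma Ck_const: "Ck k (\<lambda>x::real^'n. c::'b::real_normed_vector)"
proof (induction k arbitrary: c)
  case (Suc k)
  have "partials [i] (\<lambda>x. c::'b) = (\<lambda>x::real^'n. 0)" for i :: 'n
    by (rule ext) (rule partials_single[OF has_derivative_const])
  then show ?case using Suc by simp
qed auto

lemma (in bounded_linear) partials_linear:
  assumes "\<And>x. g differentiable (at x)"
  shows "partials [i] (\<lambda>x. f (g x)) = (\<lambda>x. f (partials [i] g x))"
proof
  fix x
  show "partials [i] (\<lambda>x. f (g x)) x = f (partials [i] g x)"
    using partials_single[OF has_derivative[OF assms[unfolded frechet_derivative_works]], of i x]
    by (simp add: frechet_derivative_axis)
qed

lemma (in bounded_linear) Ck_linear: "Ck k g \<Longrightarrow> Ck k (\<lambda>x. f (g x))"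
proof (induction k arbitrary: g)
  case (Suc k)
  have "(\<lambda>x. f (g x)) differentiable at x" for x
    using Suc.prems has_derivative unfolding Ck.simps differentiable_def by blast
  then show ?case
    using Suc by (auto simp: partials_linear)
qed auto

lemma affine_has_derivative:
  fixes f :: "real^'n \<Rightarrow> 'b::real_normed_vector"
  assumes "\<And>x. f differentiable (at x)"
  shows "((\<lambda>x. f (a + c *\<^sub>R x)) has_derivative (\<lambda>h. frechet_derivative f (at (a + c *\<^sub>R x)) (c *\<^sub>R h))) (at x)"
proof -
  have "(f has_derivative frechet_derivative f (at (a + c *\<^sub>R x))) (at (a + c *\<^sub>R x))"
    using assms frechet_derivative_works by blast
  moreover have "((\<lambda>x. a + c *\<^sub>R x) has_derivative (\<lambda>h. c *\<^sub>R h)) (at x)"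
    by (auto intro!: derivative_eq_intros)
  ultimately show ?thesis
    using has_derivative_compose[of "\<lambda>x. a + c *\<^sub>R x"] by blast
qed

lemma partials_affine:
  fixes f :: "real^'n \<Rightarrow> 'b::real_normed_vector"
  assumes "\<And>x. f differentiable (at x)"
  shows "partials [i] (\<lambda>x. f (a + c *\<^sub>R x)) = (\<lambda>x. c *\<^sub>R partials [i] f (a + c *\<^sub>R x))"
proof
  fix x
  have "linear (frechet_derivative f (at (a + c *\<^sub>R x)))"
    using assms frechet_derivative_works has_derivative_linear by blast
  then show "partials [i] (\<lambda>x. f (a + c *\<^sub>R x)) x = c *\<^sub>R partials [i] f (a + c *\<^sub>R x)"
    using partials_single[OF affine_has_derivative[OF assms, of a c x], of i]
    by (simp add: linear_scale frechet_derivative_axis)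
qed

lemma Ck_affine:
  fixes f :: "real^'n \<Rightarrow> 'b::real_normed_vector"
  shows "Ck k f \<Longrightarrow> Ck k (\<lambda>x. f (a + c *\<^sub>R x))"
proof (induction k arbitrary: f)
  case (Suc k)
  then have d: "\<And>x. f differentiable at x" by simp
  interpret scl: bounded_linear "\<lambda>y::'b. c *\<^sub>R y" by (rule bounded_linear_scaleR_right)
  have "Ck k (\<lambda>x. c *\<^sub>R partials [i] f (a + c *\<^sub>R x))" for i
    using Suc by (intro scl.Ck_linear) auto
  then show ?case
    using affine_has_derivative[OF d] unfolding Ck.simps partials_affine[OF d] differentiable_def by blast
qed auto

lemma smooth_add: "smooth f \<Longrightarrow> smooth g \<Longrightarrow> smooth (\<lambda>x. f x + g x)"
  and smooth_const: "smooth (\<lambda>x. c)"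
  by (simp_all add: smooth_iff_Ck Ck_add Ck_const)

lemma smooth_affine:
  fixes f :: "real^'n \<Rightarrow> 'b::real_normed_vector"
  shows "smooth f \<Longrightarrow> smooth (\<lambda>x. f (a + c *\<^sub>R x))"
  by (simp add: smooth_iff_Ck Ck_affine)

lemma (in bounded_bilinear) smooth_prod: "smooth f \<Longrightarrow> smooth g \<Longrightarrow> smooth (\<lambda>x. prod (f x) (g x))"
  by (simp add: smooth_iff_Ck Ck_prod)

lemma (in bounded_linear) smooth_linear: "smooth g \<Longrightarrow> smooth (\<lambda>x. f (g x))"
  by (simp add: smooth_iff_Ck Ck_linear)

lemmas smooth_scaleR = bounded_bilinear.smooth_prod[OF bounded_bilinear_scaleR]
lemmas smooth_scaleR_const = bounded_linear.smooth_linear[OF bounded_linear_scaleR_right]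
lemmas partials_scaleR = bounded_bilinear.partials_prod[OF bounded_bilinear_scaleR smooth_differentiable smooth_differentiable]
lemmas partials_inner = bounded_bilinear.partials_prod[OF bounded_bilinear_inner smooth_differentiable smooth_differentiable]

lemma smooth_minus: "smooth f \<Longrightarrow> smooth (\<lambda>x. - f x)"
  using smooth_scaleR_const[of f "-1"] by simp

lemma smooth_diff: "smooth f \<Longrightarrow> smooth g \<Longrightarrow> smooth (\<lambda>x. f x - g x)"
  using smooth_add[OF _ smooth_minus] by fastforce

lemma smooth_continuous: "smooth f \<Longrightarrow> continuous_on S f"
  by (meson differentiable_imp_continuous_on differentiable_on_def differentiable_at_withinI smooth_differentiable)

section \<open>Supports and the algebra of test functions\<close>

lemma partials_eq_0_off_closed:
  assumes "closed K" "\<And>x. x \<notin> K \<Longrightarrow> f x = 0" "x \<notin> K"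
  shows "partials is f x = 0"
  using assms(3)
proof (induction "is" arbitrary: x)
  case (Cons i "is")
  have "open (- K)" using assms(1) by auto
  then have "(partials is f has_derivative (\<lambda>h. 0)) (at x)"
    using Cons by (intro has_derivative_transform_within_open[OF has_derivative_const[of 0]]) auto
  then have "partials [i] (partials is f) x = 0"
    by (rule partials_single)
  then show ?case by (simp add: partials.simps(2))
qed (use assms(2) in auto)

text \<open>Any compact K off which f vanishes contains the closure of the support. With such a K as
  a witness, products keep the set of one factor and sums take the union.\<close>

lemma test_functions_iff:
  "f \<in> test_functions U \<longleftrightarrow> smooth f \<and> (\<exists>K. compact K \<and> K \<subseteq> U \<and> (\<forall>x. x \<notin> K \<longrightarrow> f x = 0))"
proof
  assume "f \<in> test_functions U"
  then show "smooth f \<and> (\<exists>K. compact K \<and> K \<subseteq> U \<and> (\<forall>x. x \<notin> K \<longrightarrow> f x = 0))"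
    unfolding test_functions_def smooth_def using closure_subset[of "{x. f x \<noteq> 0}"] by blast
next
  assume "smooth f \<and> (\<exists>K. compact K \<and> K \<subseteq> U \<and> (\<forall>x. x \<notin> K \<longrightarrow> f x = 0))"
  then obtain K where K: "compact K" "K \<subseteq> U" "\<And>x. x \<notin> K \<Longrightarrow> f x = 0" and s: "smooth f" by blast
  have sub: "closure {x. f x \<noteq> 0} \<subseteq> K"
    using K compact_imp_closed by (intro closure_minimal) auto
  then have "compact (closure {x. f x \<noteq> 0})"
    using K(1) by (meson bounded_subset closed_closure compact_eq_bounded_closed)
  then show "f \<in> test_functions U"
    using sub K s unfolding test_functions_def smooth_def by blast
qed

lemma test_functions_smooth: "f \<in> test_functions U \<Longrightarrow> smooth f"
  by (simp add: test_functions_iff)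

lemma test_functions_outside: "f \<in> test_functions U \<Longrightarrow> x \<notin> U \<Longrightarrow> f x = 0"
  unfolding test_functions_iff by blast

lemma test_functions_partials: "f \<in> test_functions U \<Longrightarrow> partials is f \<in> test_functions U"
  unfolding test_functions_iff using partials_eq_0_off_closed compact_imp_closed smooth_partials by metis

lemma (in bounded_bilinear) test_functions_prod_left:
  assumes "f \<in> test_functions U" "smooth g"
  shows "(\<lambda>x. prod (f x) (g x)) \<in> test_functions U"
  using assms unfolding test_functions_iff by (metis smooth_prod zero_left)

lemma (in bounded_bilinear) test_functions_prod_right:
  assumes "smooth f" "g \<in> test_functions U"
  shows "(\<lambda>x. prod (f x) (g x)) \<in> test_functions U"
  using assms unfolding test_functions_iff by (metis smooth_prod zero_right)

lemma test_functions_add: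
  assumes "f \<in> test_functions U" "g \<in> test_functions U"
  shows "(\<lambda>x. f x + g x) \<in> test_functions U"
proof -
  obtain K L where "compact K" "K \<subseteq> U" "\<And>x. x \<notin> K \<Longrightarrow> f x = 0"
    "compact L" "L \<subseteq> U" "\<And>x. x \<notin> L \<Longrightarrow> g x = 0"
    using assms unfolding test_functions_iff by metis
  then have "compact (K \<union> L)" "K \<union> L \<subseteq> U" "\<And>x. x \<notin> K \<union> L \<Longrightarrow> f x + g x = 0" by auto
  then show ?thesis
    using assms smooth_add unfolding test_functions_iff by blast
qed

lemmas test_functions_scaleR_left = bounded_bilinear.test_functions_prod_left[OF bounded_bilinear_scaleR]
lemmas test_functions_scaleR_right = bounded_bilinear.test_functions_prod_right[OF bounded_bilinear_scaleR]
lemmas test_functions_inner_left = bounded_bilinear.test_functions_prod_left[OF bounded_bilinear_inner]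

lemma test_functions_diff:
  assumes "f \<in> test_functions U" "g \<in> test_functions U"
  shows "(\<lambda>x. f x - g x) \<in> test_functions U"
  using test_functions_add[OF assms(1) test_functions_scaleR_right[OF smooth_const[of "-1"] assms(2)]] by simp

lemma laplacian_scaleR:
  assumes "smooth f" "smooth g"
  shows "laplacian (\<lambda>x. f x *\<^sub>R g x) x =
    f x *\<^sub>R laplacian g x + 2 *\<^sub>R (\<Sum>i\<in>UNIV. partials [i] f x *\<^sub>R partials [i] g x) + laplacian f x *\<^sub>R g x"
proof -
  have "partials [i, i] (\<lambda>x. f x *\<^sub>R g x) x =
    f x *\<^sub>R partials [i, i] g x + 2 *\<^sub>R (partials [i] f x *\<^sub>R partials [i] g x) + partials [i, i] f x *\<^sub>R g x" for i
  proof -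
    note sp = smooth_partials[OF assms(1), of "[i]"] smooth_partials[OF assms(2), of "[i]"]
    have "partials [i] (\<lambda>x. f x *\<^sub>R partials [i] g x + partials [i] f x *\<^sub>R g x) x
        = partials [i] (\<lambda>x. f x *\<^sub>R partials [i] g x) x + partials [i] (\<lambda>x. partials [i] f x *\<^sub>R g x) x"
      by (rule fun_cong[OF partials_add]; rule smooth_differentiable, rule smooth_scaleR; fact)
    then show ?thesis
      unfolding partials_pair partials_scaleR[OF assms] partials_scaleR[OF assms(1) sp(2)] partials_scaleR[OF sp(1) assms(2)]
      by (simp only: scaleR_2 add.assoc)
  qed
  then show ?thesis
    unfolding laplacian_def by (simp add: sum.distrib scaleR_right.sum scaleR_left.sum)
qed

section \<open>Uniform bounds of orders zero, one and two\<close>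

lemma test_functions_bounded:
  fixes f :: "real^'n \<Rightarrow> 'b::real_normed_vector"
  assumes "f \<in> test_functions U"
  obtains C where "C > 0" "\<And>x. norm (f x) \<le> C"
proof -
  obtain K where K: "compact K" "\<And>x. x \<notin> K \<Longrightarrow> f x = 0"
    using assms unfolding test_functions_iff by metis
  have "compact (f ` K)"
    using K assms by (intro compact_continuous_image smooth_continuous) (auto dest: test_functions_smooth)
  then obtain C where "C > 0" "\<And>x. x \<in> K \<Longrightarrow> norm (f x) \<le> C"
    using compact_imp_bounded[of "f ` K"] unfolding bounded_pos by (meson imageI)
  then show thesis
    using K(2) by (metis less_imp_le norm_zero that)
qed

lemma test_functions_lipschitz:
  fixes f :: "real^'n \<Rightarrow> 'b::real_normed_vector"
  assumes f: "f \<in> test_functions U"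
  obtains C where "C > 0" "\<And>x y. norm (f x - f y) \<le> C * norm (x - y)"
proof -
  have "\<exists>C>0. \<forall>x. norm (partials [i] f x) \<le> C" for i
    using test_functions_bounded[OF test_functions_partials[OF f]] by metis
  then obtain C where C: "\<And>i. C i > 0" "\<And>i x. norm (partials [i] f x) \<le> C i" by metis
  let ?C = "\<Sum>i\<in>UNIV. C i"
  have "norm (f x - f y) \<le> ?C * norm (x - y)" for x y
  proof (rule differentiable_bound)
    show "(f has_derivative (\<lambda>h. \<Sum>i\<in>UNIV. h $ i *\<^sub>R partials [i] f x)) (at x within UNIV)" if "x \<in> UNIV" for x
      using f by (intro has_derivative_partials smooth_differentiable) (auto simp: test_functions_smooth)
    show "onorm (\<lambda>h. \<Sum>i\<in>UNIV. h $ i *\<^sub>R partials [i] f x) \<le> ?C" if "x \<in> UNIV" for x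
    proof (rule onorm_le)
      fix h :: "real^'n"
      have "norm (\<Sum>i\<in>UNIV. h $ i *\<^sub>R partials [i] f x) \<le> (\<Sum>i\<in>UNIV. norm h * C i)"
        by (rule sum_norm_le) (simp add: mult_mono C component_le_norm_cart)
      then show "norm (\<Sum>i\<in>UNIV. h $ i *\<^sub>R partials [i] f x) \<le> ?C * norm h"
        by (simp add: sum_distrib_left mult.commute)
    qed
  qed auto
  moreover have "?C > 0" by (simp add: C sum_pos)
  ultimately show thesis using that by blast
qed

text \<open>The remainder bound is uniform in the base point, so it can be integrated. Both the
  vanishing of integrals of derivatives and differentiation under a convolution integral rest on
  this.\<close>

lemma test_functions_taylor:
  fixes f :: "real^'n \<Rightarrow> 'b::real_normed_vector"
  assumes f: "f \<in> test_functions U"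
  obtains C where "C > 0"
    "\<And>x h. norm (f (x + h) - f x - (\<Sum>i\<in>UNIV. h $ i *\<^sub>R partials [i] f x)) \<le> C * (norm h)\<^sup>2"
proof -
  have "\<exists>C>0. \<forall>x y. norm (partials [i] f x - partials [i] f y) \<le> C * norm (x - y)" for i
    using test_functions_lipschitz[OF test_functions_partials[OF f]] by metis
  then obtain C where C: "\<And>i. C i > 0"
    "\<And>i x y. norm (partials [i] f x - partials [i] f y) \<le> C i * norm (x - y)" by metis
  let ?C = "\<Sum>i\<in>UNIV. C i"
  let ?D = "\<lambda>x h. \<Sum>i\<in>UNIV. h $ i *\<^sub>R partials [i] f x"
  have "norm (f (x + h) - f x - ?D x h) \<le> ?C * (norm h)\<^sup>2" for x h
  proof -
    \<comment> \<open>On the ball of radius \<open>norm h\<close> about x the derivative stays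
      within \<open>?C * norm h\<close> of its value at x, by the Lipschitz bounds of the partial
      derivatives.\<close>
    have "norm (f (x + h) - f x - ?D x (x + h - x)) \<le> norm (x + h - x) * (?C * norm h)"
    proof (rule differentiable_bound_linearization[where S="cball x (norm h)"])
      show "(f has_derivative ?D y) (at y within cball x (norm h))" for y
        by (rule has_derivative_at_withinI, rule has_derivative_partials, rule smooth_differentiable,
            rule test_functions_smooth[OF f])
      show "x + t *\<^sub>R (x + h - x) \<in> cball x (norm h)" if "t \<in> {0..1}" for t
        using that by (simp add: dist_norm mult_left_le_one_le)
      fix y assume y: "y \<in> cball x (norm h)"
      show "onorm (?D y - ?D x) \<le> ?C * norm h"
      proof (rule onorm_le)
        fix k :: "real^'n"
        have "norm ((?D y - ?D x) k) = norm (\<Sum>i\<in>UNIV. k $ i *\<^sub>R (partials [i] f y - partials [i] f x))"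
          by (simp add: sum_subtractf scaleR_diff_right)
        also have "\<dots> \<le> (\<Sum>i\<in>UNIV. norm k * (C i * norm h))"
        proof (rule sum_norm_le)
          fix i
          have "norm (partials [i] f y - partials [i] f x) \<le> C i * norm (y - x)"
            using C(2) .
          also have "\<dots> \<le> C i * norm h"
            using y C(1)[of i] by (intro mult_left_mono) (auto simp: dist_norm norm_minus_commute)
          finally show "norm (k $ i *\<^sub>R (partials [i] f y - partials [i] f x)) \<le> norm k * (C i * norm h)"
            by (simp add: mult_mono component_le_norm_cart)
        qed
        finally show "norm ((?D y - ?D x) k) \<le> ?C * norm h * norm k"
          by (simp add: sum_distrib_left sum_distrib_right mult_ac)
      qed
    qed auto
    then show ?thesis by (simp add: power2_eq_square mult_ac)
  qed
  moreover have "?C > 0" by (simp add: C sum_pos)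
  ultimately show thesis using that by blast
qed

section \<open>Integrals of smooth functions with compact support\<close>

lemma integrable_compact_support:
  fixes f :: "real^'n \<Rightarrow> 'b::euclidean_space"
  assumes "continuous_on UNIV f" "compact K" "\<And>x. x \<notin> K \<Longrightarrow> f x = 0"
  shows "integrable lborel f" "integrable lebesgue f"
proof -
  have "integrable lborel (\<lambda>x. indicator K x *\<^sub>R f x)"
    using assms by (intro borel_integrable_compact) (auto intro: continuous_on_subset)
  moreover have "(\<lambda>x. indicator K x *\<^sub>R f x) = f"
    using assms(3) by (auto simp: indicator_def)
  ultimately show "integrable lborel f" by simp
  then show "integrable lebesgue f"
    using borel_measurable_continuous_onI[OF assms(1)] by (simp add: integrable_completion)
qed

lemma smooth_borel: "smooth f \<Longrightarrow> f \<in> borel_measurable borel"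
  by (simp add: borel_measurable_continuous_onI smooth_continuous)

lemma smooth_measurable: "smooth f \<Longrightarrow> f \<in> borel_measurable lebesgue"
  using smooth_borel[of f] by (simp add: measurable_completion)

lemma test_functions_integrable:
  fixes f :: "real^'n \<Rightarrow> 'b::euclidean_space"
  assumes "f \<in> test_functions U"
  shows "integrable lborel f" "integrable lebesgue f"
  using assms integrable_compact_support smooth_continuous unfolding test_functions_iff by metis+

lemma lborel_integral_translation:
  fixes f :: "'a::euclidean_space \<Rightarrow> 'b::{banach, second_countable_topology}"
  assumes [measurable]: "f \<in> borel_measurable borel"
  shows "(\<integral>x. f (a + x) \<partial>lborel) = (\<integral>x. f x \<partial>lborel)"
  using integral_distr[of "(+) a" lborel borel f] by (simp add: lborel_distr_plus)

text \<open>Difference quotients have integral 0 by translation invariance, and they converge uniformly.\<close>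

lemma test_functions_integral_partials:
  fixes f :: "real^'n \<Rightarrow> 'b::euclidean_space"
  assumes f: "f \<in> test_functions U"
  shows "(\<integral>x. partials [i] f x \<partial>lebesgue) = 0"
proof -
  obtain C where C: "C > 0"
    "\<And>x h. norm (f (x + h) - f x - (\<Sum>i\<in>UNIV. h $ i *\<^sub>R partials [i] f x)) \<le> C * (norm h)\<^sup>2"
    by (rule test_functions_taylor[OF f, where thesis=thesis]) (rule that)
  have sm: "smooth f" and smi: "smooth (partials [i] f)"
    using f test_functions_smooth smooth_partials by blast+
  obtain K where K: "compact K" "\<And>x. x \<notin> K \<Longrightarrow> f x = 0"
    using f unfolding test_functions_iff by metis
  obtain b where b: "\<And>x. x \<in> K \<Longrightarrow> norm x \<le> b"
    using K(1) by (meson bounded_iff compact_imp_bounded)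
  have out: "f x = 0" "partials [i] f x = 0" if "norm x > b" for x
    using b K(2) that partials_eq_0_off_closed[OF compact_imp_closed[OF K(1)], of f x "[i]"] by force+
  let ?e = "axis i 1 :: real^'n"
  \<comment> \<open>For 0 < t < 1 both f and its translate by t along the axis vanish outside this
    ball of radius b + 1.\<close>
  let ?M = "measure lborel (cball 0 (b + 1) :: (real^'n) set)"
  have D: "(\<Sum>j\<in>UNIV. (t *\<^sub>R ?e) $ j *\<^sub>R partials [j] f x) = t *\<^sub>R partials [i] f x" for t x
  proof -
    have "(\<Sum>j\<in>UNIV. (t *\<^sub>R ?e) $ j *\<^sub>R partials [j] f x) = (\<Sum>j\<in>UNIV. if i = j then t *\<^sub>R partials [j] f x else 0)"
      by (rule sum.cong) (auto simp: axis_def)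
    then show ?thesis by simp
  qed
  have int: "integrable lborel (partials [i] f)" "integrable lborel f"
    using f test_functions_partials test_functions_integrable(1) by blast+
  have le: "norm (\<integral>x. partials [i] f x \<partial>lborel) \<le> t * (C * ?M)" if t: "0 < t" "t < 1" for t
  proof -
    have sh: "(\<integral>x. f (x + t *\<^sub>R ?e) \<partial>lborel) = (\<integral>x. f x \<partial>lborel)"
      using lborel_integral_translation[OF smooth_borel[OF sm], of "t *\<^sub>R ?e"] by (simp add: add.commute)
    have ints: "integrable lborel (\<lambda>x. f (x + t *\<^sub>R ?e))"
      using test_functions_integrable(1)[of "\<lambda>x. f (t *\<^sub>R ?e + 1 *\<^sub>R x)" UNIV]
        smooth_affine[OF sm, of "t *\<^sub>R ?e" 1] compact_translation[OF K(1), of "- (t *\<^sub>R ?e)"] K(2)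
      unfolding test_functions_iff by (force simp: add.commute image_iff algebra_simps)
    \<comment> \<open>The integrals of f and of its translate cancel, so that only the Taylor
      remainder is left, up to sign.\<close>
    have *: "t *\<^sub>R (\<integral>x. partials [i] f x \<partial>lborel)
        = - (\<integral>x. f (x + t *\<^sub>R ?e) - f x - t *\<^sub>R partials [i] f x \<partial>lborel)"
      using int ints sh by simp
    have "t * norm (\<integral>x. partials [i] f x \<partial>lborel)
        = norm (\<integral>x. f (x + t *\<^sub>R ?e) - f x - t *\<^sub>R partials [i] f x \<partial>lborel)"
      using arg_cong[OF *, of norm] t by (simp only: norm_scaleR norm_minus_cancel abs_of_pos)
    also have "\<dots> \<le> (\<integral>x. norm (f (x + t *\<^sub>R ?e) - f x - t *\<^sub>R partials [i] f x) \<partial>lborel)"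
      by simp
    also have "\<dots> \<le> (\<integral>x. indicator (cball 0 (b + 1) :: (real^'n) set) x *\<^sub>R (C * t\<^sup>2) \<partial>lborel)"
    proof (rule Bochner_Integration.integral_mono)
      fix x :: "real^'n"
      show "norm (f (x + t *\<^sub>R ?e) - f x - t *\<^sub>R partials [i] f x) \<le> indicator (cball 0 (b + 1)) x *\<^sub>R (C * t\<^sup>2)"
      proof (cases "norm x > b + 1")
        case True
        then have "norm (x + t *\<^sub>R ?e) > b"
          using t norm_triangle_ineq2[of x "- (t *\<^sub>R ?e)"] by (simp add: norm_axis_1)
        then show ?thesis using out[of x] True out[of "x + t *\<^sub>R ?e"] by (simp add: indicator_def)
      next
        case False
        then show ?thesis
          using C(2)[of x "t *\<^sub>R ?e"] t unfolding D by (simp add: norm_axis_1)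
      qed
    qed (use int ints in \<open>auto intro!: integrable_real_indicator simp: emeasure_bounded_finite[OF bounded_cball, simplified infinity_ennreal_def]\<close>)
    also have "\<dots> = ?M * (C * t\<^sup>2)"
      by simp
    finally show ?thesis using t by (simp add: power2_eq_square mult_ac)
  qed
  \<comment> \<open>The remainder is quadratic in t and one factor t has been divided out, so the
    bound still tends to 0.\<close>
  have "((\<lambda>t. t * (C * ?M)) \<longlongrightarrow> 0 * (C * ?M)) (at_right 0)"
    by (intro tendsto_intros)
  then have "norm (\<integral>x. partials [i] f x \<partial>lborel) \<le> 0 * (C * ?M)"
  proof (rule tendsto_lowerbound)
    show "\<forall>\<^sub>F t in at_right 0. norm (\<integral>x. partials [i] f x \<partial>lborel) \<le> t * (C * ?M)"
      using le unfolding eventually_at_right_field by (intro exI[of _ 1]) (auto)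
  qed simp
  then show ?thesis
    using smooth_borel[OF smi] by (simp add: integral_completion)
qed

subsection \<open>Lebesgue norms\<close>

lemma ennpowr_mono: "a \<le> b \<Longrightarrow> 0 < r \<Longrightarrow> ennpowr a r \<le> ennpowr b r"
  unfolding ennpowr_def
  by (auto simp: top_unique less_top intro!: ennreal_leI powr_mono2 enn2real_mono)

lemma ennpowr_ennreal: "0 \<le> a \<Longrightarrow> ennpowr (ennreal a) r = ennreal (a powr r)"
  by (simp add: ennpowr_def)

lemma ennpowr_mult:
  assumes "0 < r"
  shows "ennpowr (a * b) r = ennpowr a r * ennpowr b r"
proof (cases a; cases b)
  fix x y assume "a = ennreal x" "b = ennreal y" "0 \<le> x" "0 \<le> y"
  then show ?thesis
    by (simp add: ennpowr_ennreal powr_mult flip: ennreal_mult)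
next
  fix x assume "a = ennreal x" "0 \<le> x" "b = top"
  then show ?thesis
    using assms by (cases "x = 0") (auto simp: ennpowr_def ennreal_mult_top ennreal_mult_eq_top_iff)
next
  fix x assume "b = ennreal x" "0 \<le> x" "a = top"
  then show ?thesis
    using assms by (cases "x = 0") (auto simp: ennpowr_def ennreal_top_mult ennreal_mult_eq_top_iff)
qed (auto simp: ennpowr_def ennreal_mult_eq_top_iff)

lemma ennpowr_ennpowr: "ennpowr (ennpowr a r) s = ennpowr a (r * s)"
  by (cases a) (auto simp: ennpowr_def powr_powr)

lemma ennpowr_1: "ennpowr a 1 = a"
  by (cases a) (auto simp: ennpowr_def)

lemma Lp_norm_powr:
  "0 < p \<Longrightarrow> ennpowr (Lp_norm p U f) p = (\<integral>\<^sup>+x. ennreal (norm (f x) powr p) \<partial>lebesgue_on U)"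
  by (simp add: Lp_norm_def ennpowr_ennpowr ennpowr_1)

text \<open>Turns a finite bound on the norm into one on the integral of a real power, where
  pointwise inequalities can be integrated.\<close>

lemma Lp_norm_le_iff:
  assumes "0 < p" "0 \<le> A"
  shows "Lp_norm p U f \<le> ennreal A \<longleftrightarrow> (\<integral>\<^sup>+x. ennreal (norm (f x) powr p) \<partial>lebesgue_on U) \<le> ennreal (A powr p)"
proof
  assume "Lp_norm p U f \<le> ennreal A"
  then show "(\<integral>\<^sup>+x. ennreal (norm (f x) powr p) \<partial>lebesgue_on U) \<le> ennreal (A powr p)"
    using ennpowr_mono[of _ _ p] assms by (metis Lp_norm_powr ennpowr_ennreal)
next
  assume "(\<integral>\<^sup>+x. ennreal (norm (f x) powr p) \<partial>lebesgue_on U) \<le> ennreal (A powr p)"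
  then have "Lp_norm p U f \<le> ennpowr (ennreal (A powr p)) (1 / p)"
    unfolding Lp_norm_def using assms by (intro ennpowr_mono) auto
  then show "Lp_norm p U f \<le> ennreal A"
    using assms by (simp add: ennpowr_ennreal powr_powr)
qed

lemma Lp_norm_mono_AE:
  assumes "0 < p" "AE x in lebesgue_on U. norm (f x) \<le> norm (g x)"
  shows "Lp_norm p U f \<le> Lp_norm p U g"
  unfolding Lp_norm_def using assms
  by (intro ennpowr_mono nn_integral_mono_AE) (auto intro!: ennreal_leI powr_mono2 elim!: eventually_mono)

lemma Lp_norm_mono:
  assumes "0 < p" "\<And>x. x \<in> U \<Longrightarrow> norm (f x) \<le> norm (g x)"
  shows "Lp_norm p U f \<le> Lp_norm p U g"
  using assms by (intro Lp_norm_mono_AE AE_I2) auto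

lemma Lp_norm_cong_AE:
  assumes "AE x in lebesgue_on U. norm (f x) = norm (g x)"
  shows "Lp_norm p U f = Lp_norm p U g"
  unfolding Lp_norm_def using assms
  by (intro arg_cong2[where f=ennpowr] nn_integral_cong_AE) (auto elim!: eventually_mono)

lemma Lp_norm_cong:
  assumes "\<And>x. x \<in> U \<Longrightarrow> norm (f x) = norm (g x)"
  shows "Lp_norm p U f = Lp_norm p U g"
  using assms by (intro Lp_norm_cong_AE AE_I2) auto

text \<open>Extension by zero: norms over subsets become norms over one larger set, where pieces
  with different supports can be added by the triangle inequality.\<close>

lemma Lp_norm_indicator:
  fixes f :: "real^'n \<Rightarrow> 'a::euclidean_space"
  assumes "0 < p" "U \<in> sets lebesgue" "V \<in> sets lebesgue"
  shows "Lp_norm p V (\<lambda>x. indicator U x *\<^sub>R f x) = Lp_norm p (U \<inter> V) f"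
proof -
  have "(\<integral>\<^sup>+x. ennreal (norm (indicator U x *\<^sub>R f x) powr p) \<partial>lebesgue_on V)
      = (\<integral>\<^sup>+x. ennreal (norm (f x) powr p) \<partial>lebesgue_on (U \<inter> V))"
    using assms
    by (simp add: nn_integral_restrict_space)
       (auto intro!: nn_integral_cong simp: indicator_def)
  then show ?thesis by (simp add: Lp_norm_def)
qed

lemma Lp_norm_subset:
  fixes f :: "real^'n \<Rightarrow> 'a::euclidean_space"
  assumes "0 < p" "U \<in> sets lebesgue" "V \<in> sets lebesgue" "U \<subseteq> V"
  shows "Lp_norm p U f \<le> Lp_norm p V f"
proof -
  have "Lp_norm p U f = Lp_norm p V (\<lambda>x. indicator U x *\<^sub>R f x)"
    using assms by (simp add: Lp_norm_indicator Int_absorb2)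
  also have "\<dots> \<le> Lp_norm p V f"
    using assms(1) by (intro Lp_norm_mono) (auto simp: indicator_def)
  finally show ?thesis .
qed

lemma Lp_norm_scaleR:
  assumes "0 < p" "f \<in> borel_measurable (lebesgue_on U)"
  shows "Lp_norm p U (\<lambda>x. c *\<^sub>R f x) = ennreal \<bar>c\<bar> * Lp_norm p U f"
proof -
  have "(\<integral>\<^sup>+x. ennreal (norm (c *\<^sub>R f x) powr p) \<partial>lebesgue_on U)
     = ennreal (\<bar>c\<bar> powr p) * (\<integral>\<^sup>+x. ennreal (norm (f x) powr p) \<partial>lebesgue_on U)"
    using assms(2) by (subst nn_integral_cmult[symmetric]) (auto simp: powr_mult ennreal_mult)
  then show ?thesis
    using assms(1) by (simp add: Lp_norm_def ennpowr_mult ennpowr_ennreal powr_powr)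
qed

lemma Lp_norm_eq_0:
  assumes "0 < p" "f \<in> borel_measurable (lebesgue_on U)" "Lp_norm p U f = 0"
  shows "AE x in lebesgue_on U. f x = 0"
proof -
  have "(\<integral>\<^sup>+x. ennreal (norm (f x) powr p) \<partial>lebesgue_on U) = 0"
    using assms(3) Lp_norm_le_iff[OF assms(1), of 0 U f] by simp
  then show ?thesis
    using assms(1,2) by (subst (asm) nn_integral_0_iff_AE) (auto elim!: eventually_mono)
qed

lemma Lp_norm_0: "0 < p \<Longrightarrow> AE x in lebesgue_on U. f x = 0 \<Longrightarrow> Lp_norm p U f = 0"
  using Lp_norm_cong_AE[where f=f and g="\<lambda>_. 0 :: real"] Lp_norm_le_iff[of p 0 U "\<lambda>_. 0 :: real"]
  by (auto elim!: eventually_mono)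

section \<open>The inequalities of Minkowski and Holder\<close>

lemma powr_convex_combination:
  fixes x y :: real
  assumes "1 \<le> p" "0 \<le> x" "0 \<le> y" "0 \<le> u" "0 \<le> v" "u + v = 1"
  shows "(u * x + v * y) powr p \<le> u * x powr p + v * y powr p"
proof -
  \<comment> \<open>When one of the two points is 0, the claim reduces to this inequality for the
    other weight.\<close>
  have pw: "w powr p \<le> w" if "0 \<le> w" "w \<le> 1" for w :: real
    using powr_mono'[of 1 p w] that assms(1) by simp
  have "u \<le> 1" "v \<le> 1" using assms by auto
  then consider "x = 0" | "y = 0" | "x > 0" "y > 0" using assms by linarith
  then show ?thesis
  proof cases
    case 3
    have "u = 1 - v" using assms(6) by simp
    then show ?thesis
      using convex_onD[OF powr_convex[OF assms(1)], of v x y] assms 3 \<open>v \<le> 1\<close>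
      by (simp only: \<open>u = 1 - v\<close>) simp
  qed (use assms pw \<open>u \<le> 1\<close> \<open>v \<le> 1\<close> in \<open>auto simp: powr_mult intro!: mult_right_mono\<close>)
qed

text \<open>\<open>(f + g) / (A + B)\<close> is the convex combination of \<open>f / A\<close> and
  \<open>g / B\<close> with weights \<open>A / (A + B)\<close> and \<open>B / (A + B)\<close>;
  convexity of the power is then integrated. A and B are positive upper bounds instead of the norms,
  so that the divisions make sense when a norm is 0.\<close>

lemma Lp_norm_triangle_aux:
  assumes p: "1 \<le> p" and f: "f \<in> borel_measurable (lebesgue_on U)" and g: "g \<in> borel_measurable (lebesgue_on U)"
    and A: "0 < A" "Lp_norm p U f \<le> ennreal A" and B: "0 < B" "Lp_norm p U g \<le> ennreal B"
  shows "Lp_norm p U (\<lambda>x. f x + g x) \<le> ennreal (A + B)"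
proof -
  have iA: "(\<integral>\<^sup>+x. ennreal (norm (f x) powr p) \<partial>lebesgue_on U) \<le> ennreal (A powr p)"
    and iB: "(\<integral>\<^sup>+x. ennreal (norm (g x) powr p) \<partial>lebesgue_on U) \<le> ennreal (B powr p)"
    using A B p by (simp_all add: Lp_norm_le_iff)
  let ?a = "(A + B) powr p * (A / (A + B)) / A powr p"
  let ?b = "(A + B) powr p * (B / (A + B)) / B powr p"
  have pt: "norm (f x + g x) powr p \<le> ?a * norm (f x) powr p + ?b * norm (g x) powr p" for x
  proof -
    have "norm (f x + g x) powr p \<le> (norm (f x) + norm (g x)) powr p"
      using p by (intro powr_mono2 norm_triangle_ineq) auto
    also have "norm (f x) + norm (g x)
        = (A + B) * (A / (A + B) * (norm (f x) / A) + B / (A + B) * (norm (g x) / B))"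
      using A B by (simp add: add_divide_distrib[symmetric])
    also have "\<dots> powr p = (A + B) powr p * (A / (A + B) * (norm (f x) / A) + B / (A + B) * (norm (g x) / B)) powr p"
      using A B by (simp add: powr_mult)
    also have "\<dots> \<le> (A + B) powr p * (A / (A + B) * (norm (f x) / A) powr p + B / (A + B) * (norm (g x) / B) powr p)"
      using A B p by (intro mult_left_mono powr_convex_combination)
        (simp_all flip: add_divide_distrib)
    also have "\<dots> = ?a * norm (f x) powr p + ?b * norm (g x) powr p"
      using A B by (simp add: powr_divide algebra_simps)
    finally show ?thesis .
  qed
  have "(\<integral>\<^sup>+x. ennreal (norm (f x + g x) powr p) \<partial>lebesgue_on U)
     \<le> (\<integral>\<^sup>+x. ennreal ?a * ennreal (norm (f x) powr p) + ennreal ?b * ennreal (norm (g x) powr p) \<partial>lebesgue_on U)"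
    using pt A B by (intro nn_integral_mono) (auto simp flip: ennreal_mult ennreal_plus intro!: ennreal_leI)
  also have "\<dots> = ennreal ?a * (\<integral>\<^sup>+x. ennreal (norm (f x) powr p) \<partial>lebesgue_on U)
      + ennreal ?b * (\<integral>\<^sup>+x. ennreal (norm (g x) powr p) \<partial>lebesgue_on U)"
    using f g by (subst nn_integral_add) (auto simp: nn_integral_cmult)
  also have "\<dots> \<le> ennreal ?a * ennreal (A powr p) + ennreal ?b * ennreal (B powr p)"
    by (intro add_mono mult_left_mono iA iB) auto
  also have "\<dots> = ennreal (?a * A powr p + ?b * B powr p)"
    using A B by (simp flip: ennreal_mult ennreal_plus)
  also have "?a * A powr p + ?b * B powr p = (A + B) powr p * (A / (A + B)) + (A + B) powr p * (B / (A + B))"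
    using A B by (intro arg_cong2[where f="(+)"]) auto
  also have "\<dots> = (A + B) powr p"
    using A B by (simp flip: distrib_left add_divide_distrib)
  finally show ?thesis using A B p by (subst Lp_norm_le_iff) auto
qed

lemma Lp_norm_triangle:
  assumes "1 \<le> p" "f \<in> borel_measurable (lebesgue_on U)" "g \<in> borel_measurable (lebesgue_on U)"
  shows "Lp_norm p U (\<lambda>x. f x + g x) \<le> Lp_norm p U f + Lp_norm p U g"
proof (cases "Lp_norm p U f = top \<or> Lp_norm p U g = top")
  case False
  then obtain A B where AB: "Lp_norm p U f = ennreal A" "0 \<le> A" "Lp_norm p U g = ennreal B" "0 \<le> B"
    by (cases "Lp_norm p U f"; cases "Lp_norm p U g") auto
  show ?thesis
  proof (rule ennreal_le_epsilon)
    fix e :: real assume "0 < e"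
    \<comment> \<open>The slack e/2 makes both bounds positive, as the auxiliary inequality
      demands.\<close>
    then have "Lp_norm p U (\<lambda>x. f x + g x) \<le> ennreal ((A + e / 2) + (B + e / 2))"
      using AB assms by (intro Lp_norm_triangle_aux) (auto intro!: ennreal_leI)
    also have "(A + e / 2) + (B + e / 2) = A + B + e" by simp
    also have "\<dots> = Lp_norm p U f + Lp_norm p U g + ennreal e"
      using AB \<open>0 < e\<close> by (simp flip: ennreal_plus)
    finally show "Lp_norm p U (\<lambda>x. f x + g x) \<le> Lp_norm p U f + Lp_norm p U g + ennreal e" .
  qed
qed auto

text \<open>Young's inequality with weights r/p and r/q, applied to \<open>f / A\<close> and
  \<open>g / B\<close>. The relation between the exponents says that these weights add up to
  1.\<close>

lemma Lp_norm_Holder_aux: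
  assumes pq: "0 < p" "0 < q" "0 < r" "1 / r = 1 / p + 1 / q"
    and f: "f \<in> borel_measurable (lebesgue_on U)" and g: "g \<in> borel_measurable (lebesgue_on U)"
    and h: "AE x in lebesgue_on U. norm (h x) \<le> norm (f x) * norm (g x)"
    and A: "0 < A" "Lp_norm p U f \<le> ennreal A" and B: "0 < B" "Lp_norm q U g \<le> ennreal B"
  shows "Lp_norm r U h \<le> ennreal (A * B)"
proof -
  have iA: "(\<integral>\<^sup>+x. ennreal (norm (f x) powr p) \<partial>lebesgue_on U) \<le> ennreal (A powr p)"
    and iB: "(\<integral>\<^sup>+x. ennreal (norm (g x) powr q) \<partial>lebesgue_on U) \<le> ennreal (B powr q)"
    using A B pq by (simp_all add: Lp_norm_le_iff)
  have one: "r / p + r / q = 1" using pq(3) arg_cong[OF pq(4), of "\<lambda>x. r * x"] by (simp add: distrib_left)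
  have young: "(a * b) powr r \<le> r / p * a powr p + r / q * b powr q" if "0 \<le> a" "0 \<le> b" for a b :: real
  proof (cases "a = 0 \<or> b = 0")
    case False
    then show ?thesis
      using Youngs_inequality_0[of "r / p" "r / q" "a powr p" "b powr q"] that pq one
      by (simp add: powr_powr powr_mult)
  qed (use pq in auto)
  let ?a = "(A * B) powr r * (r / p) / A powr p"
  let ?b = "(A * B) powr r * (r / q) / B powr q"
  have pt: "(norm (f x) * norm (g x)) powr r \<le> ?a * norm (f x) powr p + ?b * norm (g x) powr q" for x
  proof -
    have "(norm (f x) * norm (g x)) powr r = (A * B) powr r * (norm (f x) / A * (norm (g x) / B)) powr r"
      using A B by (simp flip: powr_mult)
    also have "\<dots> \<le> (A * B) powr r * (r / p * (norm (f x) / A) powr p + r / q * (norm (g x) / B) powr q)"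
      using A B by (intro mult_left_mono young) auto
    also have "\<dots> = ?a * norm (f x) powr p + ?b * norm (g x) powr q"
      using A B by (simp add: powr_divide algebra_simps)
    finally show ?thesis .
  qed
  have "(\<integral>\<^sup>+x. ennreal (norm (h x) powr r) \<partial>lebesgue_on U)
     \<le> (\<integral>\<^sup>+x. ennreal ?a * ennreal (norm (f x) powr p) + ennreal ?b * ennreal (norm (g x) powr q) \<partial>lebesgue_on U)"
  proof (rule nn_integral_mono_AE, use h in eventually_elim)
    fix x assume "norm (h x) \<le> norm (f x) * norm (g x)"
    then have "norm (h x) powr r \<le> (norm (f x) * norm (g x)) powr r"
      using pq by (intro powr_mono2) auto
    then have "norm (h x) powr r \<le> ?a * norm (f x) powr p + ?b * norm (g x) powr q"
      using pt[of x] by linarith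
    then show "ennreal (norm (h x) powr r) \<le> ennreal ?a * ennreal (norm (f x) powr p) + ennreal ?b * ennreal (norm (g x) powr q)"
      using A B pq by (auto simp flip: ennreal_mult ennreal_plus intro!: ennreal_leI)
  qed
  also have "\<dots> = ennreal ?a * (\<integral>\<^sup>+x. ennreal (norm (f x) powr p) \<partial>lebesgue_on U)
      + ennreal ?b * (\<integral>\<^sup>+x. ennreal (norm (g x) powr q) \<partial>lebesgue_on U)"
    using f g by (subst nn_integral_add) (auto simp: nn_integral_cmult)
  also have "\<dots> \<le> ennreal ?a * ennreal (A powr p) + ennreal ?b * ennreal (B powr q)"
    by (intro add_mono mult_left_mono iA iB) auto
  also have "\<dots> = ennreal (?a * A powr p + ?b * B powr q)"
    using A B pq by (simp flip: ennreal_mult ennreal_plus)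
  also have "?a * A powr p + ?b * B powr q = (A * B) powr r * (r / p + r / q)"
    using A B by (simp add: distrib_left)
  finally have "(\<integral>\<^sup>+x. ennreal (norm (h x) powr r) \<partial>lebesgue_on U) \<le> ennreal ((A * B) powr r)"
    by (simp only: one mult_1_right)
  then show ?thesis using A B pq by (subst Lp_norm_le_iff) auto
qed

text \<open>Since h is only dominated by the product of the norms, scalar multiples, field products
  and inner products are covered at once. A factor of norm 0 is treated separately: it forces h = 0
  almost everywhere even if the other norm is infinite.\<close>

lemma Lp_norm_Holder:
  assumes pq: "0 < p" "0 < q" "0 < r" "1 / r = 1 / p + 1 / q"
    and f: "f \<in> borel_measurable (lebesgue_on U)" and g: "g \<in> borel_measurable (lebesgue_on U)"
    and h: "AE x in lebesgue_on U. norm (h x) \<le> norm (f x) * norm (g x)"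
  shows "Lp_norm r U h \<le> Lp_norm p U f * Lp_norm q U g"
proof -
  consider "Lp_norm p U f = 0" | "Lp_norm q U g = 0"
    | A B where "Lp_norm p U f = ennreal A" "0 < A" "Lp_norm q U g = ennreal B" "0 < B"
    | "Lp_norm p U f * Lp_norm q U g = top"
    by (cases "Lp_norm p U f"; cases "Lp_norm q U g")
       (auto simp: ennreal_mult_eq_top_iff less_le)
  then show ?thesis
  proof cases
    case 1
    then have "AE x in lebesgue_on U. h x = 0"
      using Lp_norm_eq_0[OF pq(1) f] h by (auto elim: eventually_elim2)
    then have "Lp_norm r U h = 0" by (rule Lp_norm_0[OF pq(3)])
    then show ?thesis by simp
  next
    case 2
    then have "AE x in lebesgue_on U. h x = 0"
      using Lp_norm_eq_0[OF pq(2) g] h by (auto elim: eventually_elim2)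
    then have "Lp_norm r U h = 0" by (rule Lp_norm_0[OF pq(3)])
    then show ?thesis by simp
  next
    case 3
    then show ?thesis
      using Lp_norm_Holder_aux[OF pq f g h, of A B] by (simp add: ennreal_mult)
  qed simp
qed

section \<open>Limit theorems for Lebesgue norms\<close>

lemma Lp_norm_Fatou:
  assumes p: "0 < p" and f: "\<And>k. f k \<in> borel_measurable (lebesgue_on U)"
    and lim: "AE x in lebesgue_on U. (\<lambda>k. f k x) \<longlonglongrightarrow> g x"
    and le: "\<And>k. Lp_norm p U (f k) \<le> C"
  shows "Lp_norm p U g \<le> C"
proof (cases C)
  case (real c)
  have "(\<integral>\<^sup>+x. ennreal (norm (g x) powr p) \<partial>lebesgue_on U)
      = (\<integral>\<^sup>+x. liminf (\<lambda>k. ennreal (norm (f k x) powr p)) \<partial>lebesgue_on U)"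
  proof (rule nn_integral_cong_AE, use lim in eventually_elim)
    fix x assume "(\<lambda>k. f k x) \<longlonglongrightarrow> g x"
    then have "(\<lambda>k. norm (f k x) powr p) \<longlonglongrightarrow> norm (g x) powr p"
      using p by (intro tendsto_powr2 tendsto_norm) auto
    then have "(\<lambda>k. ennreal (norm (f k x) powr p)) \<longlonglongrightarrow> ennreal (norm (g x) powr p)"
      by (rule tendsto_ennrealI)
    then show "ennreal (norm (g x) powr p) = liminf (\<lambda>k. ennreal (norm (f k x) powr p))"
      by (metis lim_imp_Liminf trivial_limit_sequentially)
  qed
  also have "\<dots> \<le> liminf (\<lambda>k. \<integral>\<^sup>+x. ennreal (norm (f k x) powr p) \<partial>lebesgue_on U)"
    using f by (intro nn_integral_liminf) measurable
  also have "\<dots> \<le> liminf (\<lambda>k. ennreal (c powr p))"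
    using le real p Lp_norm_le_iff[OF p] by (intro Liminf_mono always_eventually) auto
  also have "\<dots> = ennreal (c powr p)"
    by (simp add: Liminf_const)
  finally show ?thesis using real p by (simp add: Lp_norm_le_iff)
qed simp

lemma tendsto_Lp_norm_iff:
  assumes "0 < p"
  shows "(\<lambda>k. Lp_norm p U (f k)) \<longlonglongrightarrow> 0
    \<longleftrightarrow> (\<lambda>k. \<integral>\<^sup>+x. ennreal (norm (f k x) powr p) \<partial>lebesgue_on U) \<longlonglongrightarrow> 0"
proof -
  have pw: "(\<lambda>k. ennpowr (a k) r) \<longlonglongrightarrow> 0" if a: "a \<longlonglongrightarrow> 0" and r: "0 < r" for a :: "nat \<Rightarrow> ennreal" and r
  proof -
    \<comment> \<open>Values below 1 are finite, and there \<open>ennpowr\<close> is the real power,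
      whose continuity applies.\<close>
    have ev: "\<forall>\<^sub>F k in sequentially. a k < 1"
      using order_tendstoD(2)[OF a] by simp
    have "(\<lambda>k. enn2real (a k)) \<longlonglongrightarrow> 0"
      using tendsto_enn2real[of a 0] a by simp
    then have "(\<lambda>k. enn2real (a k) powr r) \<longlonglongrightarrow> 0 powr r"
      using r by (intro tendsto_powr2) auto
    then have "(\<lambda>k. ennreal (enn2real (a k) powr r)) \<longlonglongrightarrow> ennreal 0"
      using r by (intro tendsto_ennrealI) auto
    moreover have "\<forall>\<^sub>F k in sequentially. ennreal (enn2real (a k) powr r) = ennpowr (a k) r"
      using ev by eventually_elim (auto simp: ennpowr_def)
    ultimately show ?thesis using Lim_transform_eventually by fastforce
  qed
  show ?thesis
  proof
    assume "(\<lambda>k. Lp_norm p U (f k)) \<longlonglongrightarrow> 0"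
    from pw[OF this assms] show "(\<lambda>k. \<integral>\<^sup>+x. ennreal (norm (f k x) powr p) \<partial>lebesgue_on U) \<longlonglongrightarrow> 0"
      by (simp only: Lp_norm_powr[OF assms])
  next
    assume "(\<lambda>k. \<integral>\<^sup>+x. ennreal (norm (f k x) powr p) \<partial>lebesgue_on U) \<longlonglongrightarrow> 0"
    from pw[OF this, of "1 / p"] show "(\<lambda>k. Lp_norm p U (f k)) \<longlonglongrightarrow> 0"
      using assms by (simp add: Lp_norm_def)
  qed
qed

text \<open>The p-th powers of the norms tend to 0 in L^1, which gives a subsequence converging
  almost everywhere; a root returns to f.\<close>

lemma Lp_norm_tendsto_AE_subseq:
  assumes p: "0 < p" and f: "\<And>k. f k \<in> borel_measurable (lebesgue_on U)"
    and lim: "(\<lambda>k. Lp_norm p U (f k)) \<longlonglongrightarrow> 0"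
  obtains r :: "nat \<Rightarrow> nat" where "strict_mono r" "AE x in lebesgue_on U. (\<lambda>k. f (r k) x) \<longlonglongrightarrow> 0"
proof -
  have lim1: "(\<lambda>k. \<integral>\<^sup>+x. ennreal (norm (f k x) powr p) \<partial>lebesgue_on U) \<longlonglongrightarrow> 0"
    using lim p by (simp add: tendsto_Lp_norm_iff)
  \<comment> \<open>Finitely many initial terms may have infinite norm; from N on the powers are
    integrable.\<close>
  then obtain N where N: "\<And>k. k \<ge> N \<Longrightarrow> (\<integral>\<^sup>+x. ennreal (norm (f k x) powr p) \<partial>lebesgue_on U) < 1"
    using order_tendstoD(2)[OF lim1, of 1] unfolding eventually_sequentially by auto
  have int: "integrable (lebesgue_on U) (\<lambda>x. norm (f (k + N) x) powr p)" for k
    using N[of "k + N"] f less_trans[OF _ ennreal_one_less_top] unfolding integrable_iff_bounded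
    by auto
  have "(\<lambda>k. \<integral>x. norm (norm (f (k + N) x) powr p) \<partial>lebesgue_on U) \<longlonglongrightarrow> 0"
  proof -
    have "(\<lambda>k. ennreal (\<integral>x. norm (f (k + N) x) powr p \<partial>lebesgue_on U)) \<longlonglongrightarrow> ennreal 0"
      using LIMSEQ_ignore_initial_segment[OF lim1, of N] int by (simp add: nn_integral_eq_integral)
    then show ?thesis by (subst (asm) tendsto_ennreal_iff) auto
  qed
  then obtain r where r: "strict_mono r"
    "AE x in lebesgue_on U. (\<lambda>k. norm (f (r k + N) x) powr p) \<longlonglongrightarrow> 0"
    using tendsto_L1_AE_subseq[of "lebesgue_on U" "\<lambda>k x. norm (f (k + N) x) powr p"] int by blast
  show thesis
  proof (rule that)
    show "strict_mono (\<lambda>k. r k + N)" using r(1) by (auto simp: strict_mono_def)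
    show "AE x in lebesgue_on U. (\<lambda>k. f (r k + N) x) \<longlonglongrightarrow> 0"
      using r(2)
    proof eventually_elim
      fix x assume "(\<lambda>k. norm (f (r k + N) x) powr p) \<longlonglongrightarrow> 0"
      then have "(\<lambda>k. (norm (f (r k + N) x) powr p) powr (1 / p)) \<longlonglongrightarrow> 0 powr (1 / p)"
        using p by (intro tendsto_powr2) auto
      then show "(\<lambda>k. f (r k + N) x) \<longlonglongrightarrow> 0"
        using p by (simp add: powr_powr tendsto_norm_zero_iff)
    qed
  qed
qed

subsection \<open>Mollification\<close>

text \<open>Required for Fubini's theorem on the completed measure, which bounds convolutions in
  \<open>Lp_norm_conv\<close>. The countable cover is inherited from \<open>lborel\<close>.\<close>

lemma sigma_finite_lebesgue: "sigma_finite_measure (lebesgue :: 'a::euclidean_space measure)"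
proof
  obtain A :: "'a set set" where A: "countable A" "A \<subseteq> sets lborel" "\<Union>A = space lborel" "\<forall>a\<in>A. emeasure lborel a \<noteq> \<infinity>"
    using lborel.sigma_finite_countable by blast
  have "emeasure lebesgue a \<noteq> \<infinity>" if "a \<in> A" for a
    using A(2,4) that by auto
  moreover have "A \<subseteq> sets lebesgue" using A(2) by auto
  ultimately show "\<exists>A :: 'a set set. countable A \<and> A \<subseteq> sets lebesgue \<and> \<Union>A = space lebesgue \<and> (\<forall>a\<in>A. emeasure lebesgue a \<noteq> \<infinity>)"
    using A by (intro exI[of _ A]) auto
qed

interpretation lebesgue_pair: pair_sigma_finite lebesgue lebesgue
  by (intro pair_sigma_finite.intro sigma_finite_lebesgue)

lemma integral_reflect_translate:
  fixes f :: "real^'n \<Rightarrow> 'b::{banach, second_countable_topology}"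
  assumes [measurable]: "f \<in> borel_measurable borel"
  shows "(\<integral>y. f (x - y) \<partial>lborel) = (\<integral>y. f y \<partial>lborel)"
proof -
  have "(\<integral>y. f y \<partial>lborel) = (\<integral>y. f y \<partial>density (distr lborel borel (\<lambda>y. x + (- 1) *\<^sub>R y)) (\<lambda>_. \<bar>- 1 :: real\<bar> ^ DIM(real^'n)))"
    by (subst lborel_affine[of "- 1 :: real" x]) simp_all
  also have "\<dots> = (\<integral>y. f (x - y) \<partial>lborel)"
    by (simp add: integral_distr density_1 flip: one_ennreal_def)
  finally show ?thesis ..
qed

text \<open>The variable x sits in the kernel alone, so the result is as regular as \<zeta> even
  when v is merely integrable.\<close>

definition conv :: "(real^'n \<Rightarrow> real) \<Rightarrow> (real^'n \<Rightarrow> 'a::euclidean_space) \<Rightarrow> real^'n \<Rightarrow> 'a" where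
  "conv \<zeta> v x = (\<integral>y. \<zeta> (x - y) *\<^sub>R v y \<partial>lebesgue)"

lemma smooth_reflect:
  fixes \<zeta> :: "real^'n \<Rightarrow> 'b::real_normed_vector"
  assumes "smooth \<zeta>"
  shows "smooth (\<lambda>y. \<zeta> (x - y))"
  using smooth_affine[OF assms, of x "-1"] by simp

lemma integral_reflect_eq_1:
  fixes \<zeta> :: "real^'n \<Rightarrow> real"
  assumes "smooth \<zeta>" "(\<integral>x. \<zeta> x \<partial>lebesgue) = 1"
  shows "integrable lebesgue (\<lambda>y. \<zeta> (x - y))" "(\<integral>y. \<zeta> (x - y) \<partial>lebesgue) = 1"
proof -
  note b = smooth_borel[OF assms(1)] smooth_borel[OF smooth_reflect[OF assms(1)]]
  show "(\<integral>y. \<zeta> (x - y) \<partial>lebesgue) = 1"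
    using assms(2) b integral_reflect_translate[OF b(1), of x] by (simp add: integral_completion)
  \<comment> \<open>A function that is not integrable has Bochner integral 0 by convention, so the
    value 1 implies integrability.\<close>
  then show "integrable lebesgue (\<lambda>y. \<zeta> (x - y))"
    using not_integrable_integral_eq by fastforce
qed

lemma conv_integrable:
  fixes v :: "real^'n \<Rightarrow> 'a::euclidean_space"
  assumes "\<zeta> \<in> test_functions U" "integrable lebesgue v"
  shows "integrable lebesgue (\<lambda>y. \<zeta> (x - y) *\<^sub>R v y)"
proof -
  obtain C where C: "C > 0" "\<And>x. norm (\<zeta> x) \<le> C"
    by (rule test_functions_bounded[OF assms(1), where thesis=thesis]) (rule that)
  have "(\<lambda>y. \<zeta> (x - y)) \<in> borel_measurable lebesgue"
    by (intro smooth_measurable smooth_reflect test_functions_smooth[OF assms(1)])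
  then show ?thesis
    using assms(2) C
    by (intro Bochner_Integration.integrable_bound[where f="\<lambda>y. C *\<^sub>R v y" and g="\<lambda>y. \<zeta> (x - y) *\<^sub>R v y"])
       (auto intro!: mult_right_mono simp: abs_of_pos)
qed

text \<open>The uniform Taylor remainder of \<zeta>, integrated against v, is at most a constant
  times the L^1 norm of v times the square of \<open>norm h\<close>.\<close>

lemma conv_has_derivative:
  fixes v :: "real^'n \<Rightarrow> 'a::euclidean_space"
  assumes \<zeta>: "\<zeta> \<in> test_functions U" and v: "integrable lebesgue v"
  shows "(conv \<zeta> v has_derivative (\<lambda>h. \<Sum>i\<in>UNIV. h $ i *\<^sub>R conv (partials [i] \<zeta>) v x)) (at x)"
proof -
  obtain C where C: "C > 0"
    "\<And>x h. norm (\<zeta> (x + h) - \<zeta> x - (\<Sum>i\<in>UNIV. h $ i *\<^sub>R partials [i] \<zeta> x)) \<le> C * (norm h)\<^sup>2"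
    by (rule test_functions_taylor[OF \<zeta>, where thesis=thesis]) (rule that)
  let ?D = "\<lambda>h. \<Sum>i\<in>UNIV. h $ i *\<^sub>R conv (partials [i] \<zeta>) v x"
  define V where "V = (\<integral>y. norm (v y) \<partial>lebesgue)"
  have V: "0 \<le> V" by (simp add: V_def)
  have int: "integrable lebesgue (\<lambda>y. \<zeta> (z - y) *\<^sub>R v y)" "integrable lebesgue (\<lambda>y. partials [i] \<zeta> (z - y) *\<^sub>R v y)" for z i
    using conv_integrable[OF _ v] \<zeta> test_functions_partials by blast+
  have rem: "norm (conv \<zeta> v (x + h) - conv \<zeta> v x - ?D h) \<le> C * V * (norm h)\<^sup>2" for h
  proof -
    let ?r = "\<lambda>y. \<zeta> (x + h - y) - \<zeta> (x - y) - (\<Sum>i\<in>UNIV. h $ i *\<^sub>R partials [i] \<zeta> (x - y))"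
    have "conv \<zeta> v (x + h) - conv \<zeta> v x - ?D h = (\<integral>y. \<zeta> (x + h - y) *\<^sub>R v y - \<zeta> (x - y) *\<^sub>R v y
        - (\<Sum>i\<in>UNIV. h $ i *\<^sub>R partials [i] \<zeta> (x - y) *\<^sub>R v y) \<partial>lebesgue)"
      unfolding conv_def using int by (simp del: scaleR_scaleR)
    also have "\<dots> = (\<integral>y. ?r y *\<^sub>R v y \<partial>lebesgue)"
      by (intro Bochner_Integration.integral_cong) (auto simp: scaleR_diff_left scaleR_sum_left)
    finally have "norm (conv \<zeta> v (x + h) - conv \<zeta> v x - ?D h) \<le> (\<integral>y. norm (?r y *\<^sub>R v y) \<partial>lebesgue)"
      using integral_norm_bound by (simp only:)
    also have "\<dots> \<le> (\<integral>y. (C * (norm h)\<^sup>2) * norm (v y) \<partial>lebesgue)"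
    proof (rule integral_mono')
      show "integrable lebesgue (\<lambda>y. (C * (norm h)\<^sup>2) * norm (v y))" using v by simp
      fix y
      have "\<bar>?r y\<bar> \<le> C * (norm h)\<^sup>2"
        using C(2)[of "x - y" h] by (simp add: algebra_simps)
      then show "norm (?r y *\<^sub>R v y) \<le> (C * (norm h)\<^sup>2) * norm (v y)"
        by (simp add: mult_right_mono)
    qed (use C in auto)
    finally show ?thesis by (simp add: V_def mult_ac)
  qed
  show ?thesis
    unfolding has_derivative_at
  proof
    show "bounded_linear ?D"
      by (intro bounded_linear_sum bounded_linear_compose[OF bounded_linear_scaleR_left] bounded_linear_vec_nth)
    show "(\<lambda>h. norm (conv \<zeta> v (x + h) - conv \<zeta> v x - ?D h) / norm h) \<midarrow>0\<rightarrow> 0"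
    proof (rule Lim_null_comparison)
      show "((\<lambda>h. C * V * norm h) \<longlongrightarrow> 0) (at (0::real^'n))"
        by (auto intro!: tendsto_eq_intros)
      have "norm (conv \<zeta> v (x + h) - conv \<zeta> v x - ?D h) / norm h \<le> C * V * norm h" for h
      proof (cases "h = 0")
        case False
        then show ?thesis using rem[of h] by (simp add: pos_divide_le_eq power2_eq_square mult_ac)
      qed simp
      then show "\<forall>\<^sub>F h in at 0. norm (norm (conv \<zeta> v (x + h) - conv \<zeta> v x - ?D h) / norm h) \<le> C * V * norm h"
        by simp
    qed
  qed
qed

lemma partials_conv_single:
  fixes v :: "real^'n \<Rightarrow> 'a::euclidean_space"
  assumes "\<zeta> \<in> test_functions U" "integrable lebesgue v"
  shows "partials [i] (conv \<zeta> v) = conv (partials [i] \<zeta>) v"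
proof
  fix x
  have "partials [i] (conv \<zeta> v) x = (\<Sum>j\<in>UNIV. axis i 1 $ j *\<^sub>R conv (partials [j] \<zeta>) v x)"
    by (rule partials_single[OF conv_has_derivative[OF assms]])
  also have "\<dots> = (\<Sum>j\<in>UNIV. if i = j then conv (partials [j] \<zeta>) v x else 0)"
    by (rule sum.cong) (auto simp: axis_def)
  finally show "partials [i] (conv \<zeta> v) x = conv (partials [i] \<zeta>) v x" by simp
qed

lemma partials_conv:
  fixes v :: "real^'n \<Rightarrow> 'a::euclidean_space"
  assumes "\<zeta> \<in> test_functions U" "integrable lebesgue v"
  shows "partials is (conv \<zeta> v) = conv (partials is \<zeta>) v"
proof (induction "is")
  case (Cons i "is")
  have "partials (i # is) (conv \<zeta> v) = partials [i] (conv (partials is \<zeta>) v)"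
    using partials_append[of "[i]" "is" "conv \<zeta> v"] Cons by simp
  also have "\<dots> = conv (partials (i # is) \<zeta>) v"
    using partials_conv_single[OF test_functions_partials[OF assms(1)] assms(2), of i "is"]
      partials_append[of "[i]" "is" \<zeta>] by simp
  finally show ?case .
qed simp

lemma smooth_conv:
  fixes v :: "real^'n \<Rightarrow> 'a::euclidean_space"
  assumes "\<zeta> \<in> test_functions U" "integrable lebesgue v"
  shows "smooth (conv \<zeta> v)"
  unfolding smooth_def partials_conv[OF assms] differentiable_def
  using conv_has_derivative[OF test_functions_partials[OF assms(1)] assms(2)] by blast

lemma conv_eq_0:
  fixes v :: "real^'n \<Rightarrow> 'a::euclidean_space"
  assumes "\<zeta> \<in> test_functions (ball 0 d)" "\<And>x. norm x > s \<Longrightarrow> v x = 0" "norm x > s + d"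
  shows "conv \<zeta> v x = 0"
proof -
  have "\<zeta> (x - y) *\<^sub>R v y = 0" for y
  proof (cases "norm y > s")
    case False
    then have "x - y \<notin> ball 0 d" using assms(3) norm_triangle_sub[of x y] by auto
    then show ?thesis using test_functions_outside[OF assms(1)] by simp
  qed (use assms(2) in auto)
  then have "(\<lambda>y. \<zeta> (x - y) *\<^sub>R v y) = (\<lambda>_. 0)" by (rule ext)
  then show ?thesis by (simp only: conv_def) simp
qed

lemma test_functions_conv:
  fixes v :: "real^'n \<Rightarrow> 'a::euclidean_space"
  assumes "\<zeta> \<in> test_functions (ball 0 d)" "integrable lebesgue v" "\<And>x. norm x > s \<Longrightarrow> v x = 0" "s + d < r"
  shows "conv \<zeta> v \<in> test_functions (ball 0 r)"
  unfolding test_functions_iff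
proof (intro conjI smooth_conv exI)
  show "\<forall>x. x \<notin> cball 0 (s + d) \<longrightarrow> conv \<zeta> v x = 0"
    using conv_eq_0[OF assms(1,3)] by auto
qed (use assms in auto)

text \<open>The radii 1/(k + 1) shrink to 0 and are already meaningful at index 0.\<close>

definition mollifier :: "(nat \<Rightarrow> real^'n \<Rightarrow> real) \<Rightarrow> bool" where
  "mollifier \<zeta> \<longleftrightarrow> (\<forall>k. \<zeta> k \<in> test_functions (ball 0 (1 / (real k + 1))) \<and> (\<forall>x. 0 \<le> \<zeta> k x) \<and>
     (\<integral>x. \<zeta> k x \<partial>lebesgue) = 1)"

text \<open>The kernels are rescaled copies of \<phi> divided by their integrals. Each integral is
  positive because the copy equals 1 on a ball of positive volume.\<close>

lemma mollifier_exists: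
  fixes \<phi> :: "real^'n \<Rightarrow> real"
  assumes \<phi>: "\<phi> \<in> test_functions (ball 0 1)" "\<And>x. 0 \<le> \<phi> x" "\<And>x. x \<in> ball 0 (1 / 2) \<Longrightarrow> \<phi> x = 1"
  shows "\<exists>\<zeta> :: nat \<Rightarrow> real^'n \<Rightarrow> real. mollifier \<zeta>"
proof -
  have "\<exists>\<zeta> :: real^'n \<Rightarrow> real. \<zeta> \<in> test_functions (ball 0 (1 / (real k + 1))) \<and> (\<forall>x. 0 \<le> \<zeta> x) \<and> (\<integral>x. \<zeta> x \<partial>lebesgue) = 1" for k
  proof -
    let ?r = "real k + 1"
    define g where "g x = \<phi> (?r *\<^sub>R x)" for x
    have g: "g \<in> test_functions (ball 0 (1 / ?r))"
    proof -
      obtain K where K: "compact K" "K \<subseteq> ball 0 1" "\<And>x. x \<notin> K \<Longrightarrow> \<phi> x = 0"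
        using \<phi>(1) unfolding test_functions_iff by blast
      let ?K = "(\<lambda>x. (1 / ?r) *\<^sub>R x) ` K"
      have "smooth g" unfolding g_def using smooth_affine[OF test_functions_smooth[OF \<phi>(1)], of 0 ?r] by simp
      moreover have "compact ?K" using K(1) by (rule compact_scaling)
      moreover have "?K \<subseteq> ball 0 (1 / ?r)"
        using K(2) by (auto simp: divide_less_cancel)
      moreover have "g x = 0" if "x \<notin> ?K" for x
      proof -
        have "?r *\<^sub>R x \<notin> K"
          using that by (metis (no_types, lifting) add_nonneg_pos image_eqI less_numeral_extra(1) less_numeral_extra(3)
              nonzero_eq_divide_eq of_nat_0_le_iff scaleR_one scaleR_scaleR)
        then show ?thesis using K(3) by (simp add: g_def)
      qed
      ultimately show ?thesis unfolding test_functions_iff by blast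
    qed
    have int: "integrable lebesgue g" by (rule test_functions_integrable(2)[OF g])
    have nn: "0 \<le> g x" for x using \<phi>(2) by (simp add: g_def)
    have "0 < measure lborel (ball (0::real^'n) (1 / (2 * ?r)))"
      by (rule content_ball_pos) simp
    also have "\<dots> = measure lebesgue (ball (0::real^'n) (1 / (2 * ?r)))"
      by simp
    also have "\<dots> = (\<integral>x. indicator (ball (0::real^'n) (1 / (2 * ?r))) x \<partial>lebesgue)"
      by simp
    also have "\<dots> \<le> (\<integral>x. g x \<partial>lebesgue)"
    proof (rule integral_mono'[OF int])
      fix x :: "real^'n"
      show "indicator (ball (0::real^'n) (1 / (2 * ?r))) x \<le> g x"
      proof (cases "norm x < 1 / (2 * ?r)")
        case True
        then have "?r * norm x < ?r * (1 / (2 * ?r))" by (intro mult_strict_left_mono) auto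
        moreover have "?r * (1 / (2 * ?r)) = 1 / 2" "norm (?r *\<^sub>R x) = ?r * norm x"
          by (auto simp: divide_simps)
        ultimately have "norm (?r *\<^sub>R x) < 1 / 2" by metis
        then show ?thesis using True \<phi>(3)[of "?r *\<^sub>R x"] by (simp add: g_def del: norm_scaleR)
      qed (use nn in simp)
    qed (use nn in auto)
    finally have c: "0 < (\<integral>x. g x \<partial>lebesgue)" .
    let ?\<zeta> = "\<lambda>x. (1 / (\<integral>x. g x \<partial>lebesgue)) *\<^sub>R g x"
    have "?\<zeta> \<in> test_functions (ball 0 (1 / ?r))"
      by (rule test_functions_scaleR_right[OF smooth_const g])
    moreover have "(\<integral>x. ?\<zeta> x \<partial>lebesgue) = 1" using c by simp
    moreover have "\<forall>x. 0 \<le> ?\<zeta> x" using nn c by simp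
    ultimately show ?thesis by blast
  qed
  then show ?thesis unfolding mollifier_def by metis
qed

text \<open>This is the tangent inequality
  \<open>t powr p \<ge> A powr p + p * A powr (p - 1) * (t - A)\<close> with the negative term moved
  to the other side, so that it can be integrated in the extended nonnegative reals.\<close>

lemma powr_tangent:
  fixes A t :: real
  assumes "1 \<le> p" "0 \<le> A" "0 \<le> t"
  shows "A powr p + p * A powr (p - 1) * t \<le> t powr p + p * A powr p"
proof (cases "A = 0 \<or> t = 0")
  case False
  then have pos: "0 < A" "0 < t" using assms by auto
  have "t / A \<le> (1 / p) * (t / A) powr p + (1 - 1 / p) * 1"
    using Youngs_inequality_0[of "1 / p" "1 - 1 / p" "(t / A) powr p" 1] assms(1) pos by (simp add: powr_powr)
  then have "p * A powr p * (t / A) \<le> p * A powr p * ((1 / p) * (t / A) powr p + (1 - 1 / p) * 1)"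
    using assms(1) by (intro mult_left_mono) auto
  also have "\<dots> = A powr p * (t / A) powr p + p * A powr p - A powr p"
    using assms(1) by (simp add: field_simps)
  also have "A powr p * (t / A) powr p = t powr p"
    using pos by (simp add: powr_divide)
  also have "p * A powr p * (t / A) = p * A powr (p - 1) * t"
    using pos by (simp add: powr_diff)
  finally show ?thesis by linarith
next
  case True
  have "A powr p \<le> p * A powr p" using assms(1) by (simp add: mult_le_cancel_right1)
  moreover have "A powr (p - 1) * t = 0" using True by auto
  ultimately show ?thesis using powr_ge_zero[of t p] by (simp only: mult.assoc)
qed

text \<open>Jensen's inequality for the probability density \<open>\<zeta> (x - y)\<close>: the
  tangent inequality is taken at the mean A of \<open>norm (v y)\<close> and integrated against the
  density.\<close>

lemma conv_Jensen:
  fixes v :: "real^'n \<Rightarrow> 'a::euclidean_space"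
  assumes p: "1 \<le> p" and \<zeta>: "\<zeta> \<in> test_functions U" "\<And>x. 0 \<le> \<zeta> x" "(\<integral>x. \<zeta> x \<partial>lebesgue) = 1"
    and v: "integrable lebesgue v"
  shows "ennreal (norm (conv \<zeta> v x) powr p) \<le> (\<integral>\<^sup>+y. ennreal (\<zeta> (x - y)) * ennreal (norm (v y) powr p) \<partial>lebesgue)"
proof -
  define A where "A = (\<integral>y. \<zeta> (x - y) * norm (v y) \<partial>lebesgue)"
  have A0: "0 \<le> A" unfolding A_def using \<zeta>(2) by (intro Bochner_Integration.integral_nonneg) auto
  have vn: "integrable lebesgue (\<lambda>y. norm (v y))" using v by simp
  have intA: "integrable lebesgue (\<lambda>y. \<zeta> (x - y) * norm (v y))"
    using conv_integrable[OF \<zeta>(1) vn] by simp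
  have sm: "smooth \<zeta>" by (rule test_functions_smooth[OF \<zeta>(1)])
  have [measurable]: "v \<in> borel_measurable lebesgue" "(\<lambda>y. \<zeta> (x - y)) \<in> borel_measurable lebesgue"
    using v smooth_measurable[OF smooth_reflect[OF sm]] by auto
  have one: "(\<integral>\<^sup>+y. ennreal (\<zeta> (x - y)) \<partial>lebesgue) = 1"
    using integral_reflect_eq_1[OF sm \<zeta>(3), of x] \<zeta>(2) by (simp add: nn_integral_eq_integral)
  have "norm (conv \<zeta> v x) \<le> (\<integral>y. norm (\<zeta> (x - y) *\<^sub>R v y) \<partial>lebesgue)"
    unfolding conv_def by (rule integral_norm_bound)
  also have "\<dots> = A" unfolding A_def using \<zeta>(2) by simp
  finally have "ennreal (norm (conv \<zeta> v x) powr p) \<le> ennreal (A powr p)"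
    using p by (intro ennreal_leI powr_mono2) auto
  also have "\<dots> \<le> (\<integral>\<^sup>+y. ennreal (\<zeta> (x - y)) * ennreal (norm (v y) powr p) \<partial>lebesgue)" (is "_ \<le> ?I")
  proof (cases "A = 0")
    case False
    have Apos: "0 < A" using False A0 by simp
    have nnA: "(\<integral>\<^sup>+y. ennreal (\<zeta> (x - y) * norm (v y)) \<partial>lebesgue) = ennreal A"
      unfolding A_def using intA \<zeta>(2) by (intro nn_integral_eq_integral) auto
    have "ennreal (A powr p) + ennreal (p * A powr p)
        = ennreal (A powr p) * (\<integral>\<^sup>+y. ennreal (\<zeta> (x - y)) \<partial>lebesgue)
          + ennreal (p * A powr (p - 1)) * (\<integral>\<^sup>+y. ennreal (\<zeta> (x - y) * norm (v y)) \<partial>lebesgue)"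
    proof -
      have "p * A powr (p - 1) * A = p * A powr p" using Apos by (simp add: powr_diff)
      then show ?thesis using A0 p by (simp add: one nnA flip: ennreal_mult)
    qed
    also have "\<dots> = (\<integral>\<^sup>+y. ennreal (A powr p) * ennreal (\<zeta> (x - y))
         + ennreal (p * A powr (p - 1)) * ennreal (\<zeta> (x - y) * norm (v y)) \<partial>lebesgue)"
      by (subst nn_integral_add) (auto simp: nn_integral_cmult)
    also have "\<dots> \<le> (\<integral>\<^sup>+y. ennreal (\<zeta> (x - y)) * ennreal (norm (v y) powr p)
         + ennreal (p * A powr p) * ennreal (\<zeta> (x - y)) \<partial>lebesgue)"
    proof (rule nn_integral_mono)
      fix y
      have "\<zeta> (x - y) * (A powr p + p * A powr (p - 1) * norm (v y))
          \<le> \<zeta> (x - y) * (norm (v y) powr p + p * A powr p)"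
        using p A0 \<zeta>(2) by (intro mult_left_mono powr_tangent) auto
      then have "A powr p * \<zeta> (x - y) + p * A powr (p - 1) * (\<zeta> (x - y) * norm (v y))
         \<le> \<zeta> (x - y) * norm (v y) powr p + p * A powr p * \<zeta> (x - y)"
        by (simp add: algebra_simps)
      then show "ennreal (A powr p) * ennreal (\<zeta> (x - y)) + ennreal (p * A powr (p - 1)) * ennreal (\<zeta> (x - y) * norm (v y))
         \<le> ennreal (\<zeta> (x - y)) * ennreal (norm (v y) powr p) + ennreal (p * A powr p) * ennreal (\<zeta> (x - y))"
        using p \<zeta>(2) by (auto simp flip: ennreal_mult ennreal_plus intro!: ennreal_leI)
    qed
    also have "\<dots> = ?I + ennreal (p * A powr p)"
      by (subst nn_integral_add) (auto simp: nn_integral_cmult one)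
    \<comment> \<open>The finite term \<open>p * A powr p\<close> stands on both sides and
      cancels.\<close>
    finally show ?thesis by (simp add: ennreal_add_left_cancel_le add.commute)
  qed simp
  finally show ?thesis .
qed

text \<open>After Jensen's inequality the order of integration is exchanged; the inner integral over
  x of \<open>\<zeta> (x - y)\<close> is 1 by translation invariance.\<close>

lemma Lp_norm_conv:
  fixes v :: "real^'n \<Rightarrow> 'a::euclidean_space"
  assumes p: "1 \<le> p" and \<zeta>: "\<zeta> \<in> test_functions U" "\<And>x. 0 \<le> \<zeta> x" "(\<integral>x. \<zeta> x \<partial>lebesgue) = 1"
    and v: "integrable lebesgue v"
  shows "Lp_norm p UNIV (conv \<zeta> v) \<le> Lp_norm p UNIV v"
proof -
  have sm: "smooth \<zeta>" by (rule test_functions_smooth[OF \<zeta>(1)])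
  have [measurable]: "v \<in> borel_measurable lebesgue" "\<zeta> \<in> borel_measurable borel"
    using v smooth_borel[OF sm] by auto
  have one: "(\<integral>\<^sup>+x. ennreal (\<zeta> (x - y)) \<partial>lebesgue) = 1" for y
  proof -
    have b: "(\<lambda>x. \<zeta> (x - y)) \<in> borel_measurable borel" "\<zeta> \<in> borel_measurable borel"
      using smooth_borel[OF smooth_affine[OF sm, of "- y" 1]] smooth_borel[OF sm] by auto
    have I: "(\<integral>x. \<zeta> (x - y) \<partial>lborel) = 1"
      using \<zeta>(3) b(2) lborel_integral_translation[OF b(2), of "- y"] by (simp add: integral_completion)
    then have "integrable lborel (\<lambda>x. \<zeta> (x - y))" using not_integrable_integral_eq by fastforce
    then have "(\<integral>\<^sup>+x. ennreal (\<zeta> (x - y)) \<partial>lborel) = 1"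
      using I \<zeta>(2) by (simp add: nn_integral_eq_integral)
    then show ?thesis by (simp add: nn_integral_completion)
  qed
  \<comment> \<open>The coordinates of the product of the completed measures are measurable into
    \<open>borel\<close>, and there the continuous map (x, y) to \<open>\<zeta> (x - y)\<close> is
    measurable.\<close>
  have [measurable]: "(\<lambda>z. ennreal (\<zeta> (fst z - snd z))) \<in> borel_measurable (lebesgue \<Otimes>\<^sub>M lebesgue)"
  proof -
    have "fst \<in> (lebesgue \<Otimes>\<^sub>M lebesgue) \<rightarrow>\<^sub>M (borel :: (real^'n) measure)"
      "snd \<in> (lebesgue \<Otimes>\<^sub>M lebesgue) \<rightarrow>\<^sub>M (borel :: (real^'n) measure)"
      using measurable_comp[OF measurable_fst id_borel_measurable_lebesgue]
        measurable_comp[OF measurable_snd id_borel_measurable_lebesgue] by simp_all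
    then show ?thesis by measurable
  qed
  have "(\<integral>\<^sup>+x. ennreal (norm (conv \<zeta> v x) powr p) \<partial>lebesgue)
      \<le> (\<integral>\<^sup>+x. (\<integral>\<^sup>+y. ennreal (\<zeta> (x - y)) * ennreal (norm (v y) powr p) \<partial>lebesgue) \<partial>lebesgue)"
    by (intro nn_integral_mono conv_Jensen[OF p \<zeta> v])
  also have "\<dots> = (\<integral>\<^sup>+y. (\<integral>\<^sup>+x. ennreal (\<zeta> (x - y)) * ennreal (norm (v y) powr p) \<partial>lebesgue) \<partial>lebesgue)"
    by (rule lebesgue_pair.Fubini'[symmetric]) (simp add: case_prod_beta')
  also have "\<dots> = (\<integral>\<^sup>+y. ennreal (norm (v y) powr p) \<partial>lebesgue)"
  proof (rule nn_integral_cong)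
    fix y
    have "(\<lambda>x. ennreal (\<zeta> (x - y))) \<in> borel_measurable lebesgue"
      using smooth_measurable[OF smooth_affine[OF sm, of "- y" 1]] by simp
    then show "(\<integral>\<^sup>+x. ennreal (\<zeta> (x - y)) * ennreal (norm (v y) powr p) \<partial>lebesgue) = ennreal (norm (v y) powr p)"
      by (simp add: nn_integral_multc one)
  qed
  finally show ?thesis
    unfolding Lp_norm_def using p by (intro ennpowr_mono) (auto simp: lebesgue_on_UNIV_eq)
qed

section \<open>Smooth approximation in Lebesgue norms\<close>

lemma Lp_norm_lt_top_iff: "Lp_norm p U f < top \<longleftrightarrow> (\<integral>\<^sup>+x. ennreal (norm (f x) powr p) \<partial>lebesgue_on U) < top"
  by (simp add: Lp_norm_def ennpowr_def less_top)

lemma Lp_norm_dominated_convergence: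
  fixes f :: "nat \<Rightarrow> real^'n \<Rightarrow> 'a::euclidean_space"
  assumes p: "0 < p" and f: "\<And>k. f k \<in> borel_measurable (lebesgue_on U)" and g: "g \<in> borel_measurable (lebesgue_on U)"
    and w: "w \<in> borel_measurable (lebesgue_on U)" "Lp_norm p U w < top"
    and bound: "\<And>k. AE x in lebesgue_on U. norm (f k x - g x) \<le> norm (w x)"
    and lim: "AE x in lebesgue_on U. (\<lambda>k. f k x) \<longlonglongrightarrow> g x"
  shows "(\<lambda>k. Lp_norm p U (\<lambda>x. f k x - g x)) \<longlonglongrightarrow> 0"
proof -
  have "(\<lambda>k. \<integral>\<^sup>+x. ennreal (norm (f k x - g x) powr p) \<partial>lebesgue_on U) \<longlonglongrightarrow> (\<integral>\<^sup>+x. 0 \<partial>lebesgue_on U)"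
  proof (rule nn_integral_dominated_convergence)
    show "(\<integral>\<^sup>+x. ennreal (norm (w x) powr p) \<partial>lebesgue_on U) < \<infinity>"
      using w(2) by (simp add: Lp_norm_lt_top_iff)
    show "AE x in lebesgue_on U. ennreal (norm (f k x - g x) powr p) \<le> ennreal (norm (w x) powr p)" for k
      using bound[of k] by eventually_elim (use p in \<open>auto intro!: ennreal_leI powr_mono2\<close>)
    show "AE x in lebesgue_on U. (\<lambda>k. ennreal (norm (f k x - g x) powr p)) \<longlonglongrightarrow> 0"
      using lim
    proof eventually_elim
      fix x assume "(\<lambda>k. f k x) \<longlonglongrightarrow> g x"
      then have "(\<lambda>k. norm (f k x - g x) powr p) \<longlonglongrightarrow> 0 powr p"
        using p by (intro tendsto_powr2) (auto simp: LIM_zero_iff tendsto_norm_zero_iff)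
      then show "(\<lambda>k. ennreal (norm (f k x - g x) powr p)) \<longlonglongrightarrow> 0"
        using p tendsto_ennrealI by fastforce
    qed
  qed (use f g w in measurable)
  then show ?thesis using p by (simp add: tendsto_Lp_norm_iff)
qed

lemma Lp_norm_bounded_support:
  fixes f :: "real^'n \<Rightarrow> 'a::euclidean_space"
  assumes p: "0 < p" and bd: "bounded S" "\<And>x. x \<notin> S \<Longrightarrow> f x = 0" "\<And>x. norm (f x) \<le> C"
  shows "Lp_norm p UNIV f < top"
proof -
  obtain r where r: "S \<subseteq> cball 0 r" using bounded_subset_ballD[OF bd(1), of 0] ball_subset_cball by blast
  have "C \<ge> 0" using bd(3) norm_ge_zero order_trans by blast
  have "(\<integral>\<^sup>+x. ennreal (norm (f x) powr p) \<partial>lebesgue)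
     \<le> (\<integral>\<^sup>+x. ennreal (C powr p) * indicator (cball (0 :: real^'n) r) x \<partial>lebesgue)"
  proof (rule nn_integral_mono)
    fix x :: "real^'n"
    show "ennreal (norm (f x) powr p) \<le> ennreal (C powr p) * indicator (cball 0 r) x"
      using subsetD[OF r, of x] bd(2)[of x] bd(3)[of x] p by (cases "x \<in> S") (auto intro!: ennreal_leI powr_mono2)
  qed
  also have "\<dots> = ennreal (C powr p) * emeasure lborel (cball (0 :: real^'n) r)"
    by (subst nn_integral_cmult_indicator) auto
  also have "\<dots> < top"
    using emeasure_bounded_finite[of "cball (0 :: real^'n) r"] by (simp add: ennreal_mult_less_top)
  finally show ?thesis by (simp add: Lp_norm_lt_top_iff lebesgue_on_UNIV_eq)
qed

text \<open>First v is truncated to values of norm at most m. Then continuous functions converging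
  to v almost everywhere are truncated in the same way and cut off to a bounded set, which provides
  a dominating function. Dominated convergence handles both errors.\<close>

lemma continuous_dense_Lp:
  fixes v :: "real^'n \<Rightarrow> 'a::euclidean_space"
  assumes p: "1 \<le> p" and v: "v \<in> borel_measurable lebesgue" "Lp_norm p UNIV v < top"
    and supp: "\<And>x. norm x > s \<Longrightarrow> v x = 0" and e: "0 < e"
  obtains h where "continuous_on UNIV h" "\<And>x. norm x > s + 1 \<Longrightarrow> h x = 0"
    "Lp_norm p UNIV (\<lambda>x. h x - v x) < ennreal e"
proof -
  have p0: "0 < p" using p by simp
  \<comment> \<open>The radial retraction onto the ball of radius m in the space of values; it is
    continuous for m > 0 and fixes every z with \<open>norm z \<le> real m\<close>.\<close>
  define T where "T m z = (real m / max (real m) (norm z)) *\<^sub>R z" for m :: nat and z :: 'a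
  have Tcont: "continuous_on UNIV (T m)" if "m > 0" for m
    unfolding T_def using that by (intro continuous_intros) (auto simp: max_def)
  have Tbound: "norm (T m z) \<le> real m" for m z
  proof (cases "m = 0")
    case False
    then show ?thesis by (auto simp: T_def max_def)
  qed (simp add: T_def)
  have Tle: "norm (T m z) \<le> norm z" for m z
    by (cases "m = 0") (auto simp: T_def max_def field_simps)
  have Tid: "T m z = z" if "norm z \<le> real m" for m z
    using that by (cases "m = 0") (auto simp: T_def max_def)
  have Tmeas: "(\<lambda>x. T m (v x)) \<in> borel_measurable lebesgue" for m
    unfolding T_def using v(1) by measurable
  \<comment> \<open>Lebesgue measurable functions are limits of continuous functions off a
    negligible set.\<close>
  obtain N g where N: "negligible N" and gc: "\<And>n :: nat. continuous_on UNIV (g n)"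
    and glim: "\<And>x. x \<notin> N \<Longrightarrow> (\<lambda>n. g n x) \<longlonglongrightarrow> v x"
    using lebesgue_measurable_imp_measurable_on[OF v(1), of UNIV] unfolding measurable_on_def by auto
  have AEN: "AE x in lebesgue. x \<notin> N"
    using N by (simp add: AE_not_in negligible_iff_null_sets)
  have l1: "(\<lambda>m. Lp_norm p UNIV (\<lambda>x. T m (v x) - v x)) \<longlonglongrightarrow> 0"
  proof (rule Lp_norm_dominated_convergence[where w="\<lambda>x. 2 *\<^sub>R v x", OF p0])
    show "Lp_norm p UNIV (\<lambda>x. 2 *\<^sub>R v x) < top"
      using v p0 by (subst Lp_norm_scaleR) (auto simp: lebesgue_on_UNIV_eq ennreal_mult_less_top)
    show "AE x in lebesgue_on UNIV. norm (T m (v x) - v x) \<le> norm (2 *\<^sub>R v x)" for m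
    proof (rule AE_I2)
      fix x
      show "norm (T m (v x) - v x) \<le> norm (2 *\<^sub>R v x)"
        using norm_triangle_ineq4[of "T m (v x)" "v x"] Tle[of m "v x"] by simp
    qed
    show "AE x in lebesgue_on UNIV. (\<lambda>m. T m (v x)) \<longlonglongrightarrow> v x"
    proof (rule AE_I2)
      fix x
      obtain M :: nat where "norm (v x) \<le> real M" using real_arch_simple by blast
      then have "\<forall>m\<ge>M. T m (v x) = v x" using Tid by (meson of_nat_mono order_trans)
      then show "(\<lambda>m. T m (v x)) \<longlonglongrightarrow> v x"
        by (intro tendsto_eventually) (auto simp: eventually_sequentially)
    qed
  qed (use v Tmeas in \<open>auto simp: lebesgue_on_UNIV_eq\<close>)
  have "\<forall>\<^sub>F m in sequentially. Lp_norm p UNIV (\<lambda>x. T m (v x) - v x) < ennreal (e / 2) \<and> 0 < m"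
    using order_tendstoD(2)[OF l1, of "ennreal (e / 2)"] e eventually_gt_at_top[of 0] by (intro eventually_conj) auto
  then obtain m where m: "Lp_norm p UNIV (\<lambda>x. T m (v x) - v x) < ennreal (e / 2)" "0 < m"
    using eventually_happens'[OF sequentially_bot] by blast
  \<comment> \<open>A continuous cut-off equal to 1 wherever v may be nonzero; it gives all
    approximants a common bounded support.\<close>
  define \<kappa> where "\<kappa> x = max 0 (min 1 (s + 1 - norm x))" for x :: "real^'n"
  have \<kappa>: "continuous_on UNIV \<kappa>" "\<And>x. 0 \<le> \<kappa> x" "\<And>x. \<kappa> x \<le> 1" "\<And>x. norm x \<le> s \<Longrightarrow> \<kappa> x = 1" "\<And>x. norm x > s + 1 \<Longrightarrow> \<kappa> x = 0"
    unfolding \<kappa>_def by (auto intro!: continuous_intros)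
  define h where "h n x = \<kappa> x *\<^sub>R T m (g n x)" for n x
  have hc: "continuous_on UNIV (h n)" for n
    unfolding h_def
    by (intro continuous_intros \<kappa>(1) continuous_on_compose2[OF Tcont[OF m(2)] gc]) auto
  have hb: "norm (h n x) \<le> real m" for n x
    unfolding h_def using \<kappa>(2,3)[of x] Tbound[of m "g n x"]
    by (simp add: mult_left_le_one_le order_trans[OF mult_left_le_one_le])
  have hm: "h n \<in> borel_measurable lebesgue" for n
    using borel_measurable_continuous_onI[OF hc[of n]] by (simp add: measurable_completion)
  let ?w = "\<lambda>x. indicator (cball 0 (s + 1)) x *\<^sub>R (2 * real m)"
  have l2: "(\<lambda>n. Lp_norm p UNIV (\<lambda>x. h n x - T m (v x))) \<longlonglongrightarrow> 0"
  proof (rule Lp_norm_dominated_convergence[where w="?w", OF p0])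
    show "Lp_norm p UNIV ?w < top"
      by (rule Lp_norm_bounded_support[OF p0 bounded_cball[of 0 "s + 1"], where C="2 * real m"])
        (auto simp: indicator_def)
    show "AE x in lebesgue_on UNIV. norm (h n x - T m (v x)) \<le> norm (?w x)" for n
    proof (rule AE_I2)
      fix x
      show "norm (h n x - T m (v x)) \<le> norm (?w x)"
      proof (cases "norm x > s + 1")
        case True
        then show ?thesis using \<kappa>(5)[of x] supp[of x] by (simp add: h_def T_def)
      next
        case False
        then show ?thesis
          using norm_triangle_ineq4[of "h n x" "T m (v x)"] hb[of n x] Tbound[of m "v x"] by simp
      qed
    qed
    show "AE x in lebesgue_on UNIV. (\<lambda>n. h n x) \<longlonglongrightarrow> T m (v x)"
      using AEN unfolding lebesgue_on_UNIV_eq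
    proof eventually_elim
      fix x assume "x \<notin> N"
      then have "(\<lambda>n. T m (g n x)) \<longlonglongrightarrow> T m (v x)"
        using continuous_on_tendsto_compose[OF Tcont[OF m(2)] glim] by simp
      then have "(\<lambda>n. h n x) \<longlonglongrightarrow> \<kappa> x *\<^sub>R T m (v x)"
        unfolding h_def by (intro tendsto_intros)
      moreover have "\<kappa> x *\<^sub>R T m (v x) = T m (v x)"
        using \<kappa>(4)[of x] supp[of x] by (cases "norm x \<le> s") (auto simp: T_def)
      ultimately show "(\<lambda>n. h n x) \<longlonglongrightarrow> T m (v x)" by simp
    qed
  qed (use Tmeas hm in \<open>auto simp: lebesgue_on_UNIV_eq intro!: borel_measurable_times borel_measurable_indicator\<close>)
  have "\<forall>\<^sub>F n in sequentially. Lp_norm p UNIV (\<lambda>x. h n x - T m (v x)) < ennreal (e / 2)"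
    using order_tendstoD(2)[OF l2, of "ennreal (e / 2)"] e by auto
  then obtain n where n: "Lp_norm p UNIV (\<lambda>x. h n x - T m (v x)) < ennreal (e / 2)"
    using eventually_happens'[OF sequentially_bot] by blast
  have "Lp_norm p UNIV (\<lambda>x. h n x - v x) = Lp_norm p UNIV (\<lambda>x. (h n x - T m (v x)) + (T m (v x) - v x))"
    by simp
  also have "\<dots> \<le> Lp_norm p UNIV (\<lambda>x. h n x - T m (v x)) + Lp_norm p UNIV (\<lambda>x. T m (v x) - v x)"
    using p hm Tmeas v(1) by (intro Lp_norm_triangle) (auto simp: lebesgue_on_UNIV_eq)
  also have "\<dots> < ennreal (e / 2) + ennreal (e / 2)"
    by (intro add_strict_mono n m)
  also have "\<dots> = ennreal e" using e by (simp flip: ennreal_plus)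
  finally show thesis
    using that[of "h n"] hc \<kappa>(5) by (auto simp: h_def)
qed

text \<open>For p \<ge> 1 each t \<ge> 0 satisfies t \<le> 1 + t^p, and the constant 1 is integrable
  over the ball that carries v.\<close>

lemma integrable_of_Lp_bounded_support:
  fixes v :: "real^'n \<Rightarrow> 'a::euclidean_space"
  assumes p: "1 \<le> p" and v: "v \<in> borel_measurable lebesgue" "Lp_norm p UNIV v < top"
    and supp: "\<And>x. norm x > s \<Longrightarrow> v x = 0"
  shows "integrable lebesgue v"
proof -
  have pow: "integrable lebesgue (\<lambda>x. norm (v x) powr p)"
    using v unfolding integrable_iff_bounded by (auto simp: Lp_norm_lt_top_iff lebesgue_on_UNIV_eq)
  have "integrable lebesgue (indicator (cball (0 :: real^'n) s) :: _ \<Rightarrow> real)"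
    using emeasure_bounded_finite[of "cball (0 :: real^'n) s"] by (intro integrable_real_indicator) auto
  then have "integrable lebesgue (\<lambda>x. indicator (cball 0 s) x + norm (v x) powr p)"
    using pow by (rule Bochner_Integration.integrable_add)
  then show ?thesis
  proof (rule Bochner_Integration.integrable_bound)
    show "AE x in lebesgue. norm (v x) \<le> norm (indicator (cball 0 s) x + norm (v x) powr p)"
    proof (rule AE_I2)
      fix x :: "real^'n"
      show "norm (v x) \<le> norm (indicator (cball 0 s) x + norm (v x) powr p)"
      proof (cases "norm x > s")
        case False
        have "norm (v x) \<le> 1 + norm (v x) powr p"
        proof (cases "norm (v x) \<le> 1")
          case True
          then show ?thesis using powr_ge_zero[of "norm (v x)" p] by linarith
        next
          case False
          then show ?thesis using powr_mono[of 1 p "norm (v x)"] p by simp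
        qed
        then show ?thesis using False by simp
      qed (simp add: supp)
    qed
  qed (use v in auto)
qed

lemma conv_diff:
  fixes v w :: "real^'n \<Rightarrow> 'a::euclidean_space"
  assumes "\<zeta> \<in> test_functions U" "integrable lebesgue v" "integrable lebesgue w"
  shows "conv \<zeta> (\<lambda>y. v y - w y) x = conv \<zeta> v x - conv \<zeta> w x"
  using conv_integrable[OF assms(1,2), of x] conv_integrable[OF assms(1,3), of x]
  by (simp add: conv_def scaleR_diff_right)

text \<open>The error at x is the mean of \<open>h y - h x\<close> over points y closer to x than
  1/(k + 1), so uniform continuity bounds it for all x simultaneously.\<close>

lemma mollify_uniform:
  fixes h :: "real^'n \<Rightarrow> 'a::euclidean_space"
  assumes \<zeta>: "mollifier \<zeta>" and h: "continuous_on UNIV h" "\<And>x. norm x > s \<Longrightarrow> h x = 0" and e: "0 < e"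
  shows "\<forall>\<^sub>F k in sequentially. \<forall>x. norm (conv (\<zeta> k) h x - h x) \<le> e"
proof -
  have hint: "integrable lebesgue h"
    by (rule integrable_compact_support(2)[OF h(1) compact_cball[of 0 s]]) (use h(2) in auto)
  have "uniformly_continuous_on (cball 0 (s + 2)) h"
    by (intro compact_uniformly_continuous continuous_on_subset[OF h(1)]) auto
  then obtain d where d: "d > 0"
    "\<And>x y. x \<in> cball 0 (s + 2) \<Longrightarrow> y \<in> cball 0 (s + 2) \<Longrightarrow> dist x y < d \<Longrightarrow> dist (h x) (h y) < e"
    using e unfolding uniformly_continuous_on_def by metis
  \<comment> \<open>The bound 1 on the distance leaves two cases: both values vanish, or both points
    lie in the ball on which uniform continuity is available.\<close>
  have small: "norm (h x - h y) \<le> e" if "dist x y < min d 1" for x y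
  proof (cases "norm x > s + 1")
    case True
    then have "norm y > s" using that norm_triangle_sub[of x y] by (simp add: dist_norm)
    then show ?thesis using h(2)[of x] h(2)[of y] True e by simp
  next
    case False
    then have "norm y \<le> s + 2" using that norm_triangle_sub[of y x] by (simp add: dist_norm norm_minus_commute)
    then show ?thesis using d(2)[of x y] that False by (simp add: dist_norm)
  qed
  obtain K where K: "1 / (real K + 1) < min d 1"
    using reals_Archimedean[of "min d 1"] d(1) by (auto simp: inverse_eq_divide add.commute)
  show ?thesis
    unfolding eventually_sequentially
  proof (intro exI[of _ K] allI impI)
    fix k x assume "K \<le> k"
    then have k: "1 / (real k + 1) \<le> 1 / (real K + 1)" by (intro divide_left_mono) auto
    have \<zeta>k: "\<zeta> k \<in> test_functions (ball 0 (1 / (real k + 1)))" "\<And>x. 0 \<le> \<zeta> k x" "(\<integral>x. \<zeta> k x \<partial>lebesgue) = 1"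
      using \<zeta> unfolding mollifier_def by auto
    note I = integral_reflect_eq_1[OF test_functions_smooth[OF \<zeta>k(1)] \<zeta>k(3), of x]
    have int: "integrable lebesgue (\<lambda>y. \<zeta> k (x - y) *\<^sub>R h y)" "integrable lebesgue (\<lambda>y. \<zeta> k (x - y) *\<^sub>R h x)"
      using conv_integrable[OF \<zeta>k(1) hint] I by auto
    have "h x = (\<integral>y. \<zeta> k (x - y) *\<^sub>R h x \<partial>lebesgue)" using I by simp
    then have "conv (\<zeta> k) h x - h x = (\<integral>y. \<zeta> k (x - y) *\<^sub>R h y \<partial>lebesgue) - (\<integral>y. \<zeta> k (x - y) *\<^sub>R h x \<partial>lebesgue)"
      by (simp only: conv_def)
    also have "\<dots> = (\<integral>y. \<zeta> k (x - y) *\<^sub>R h y - \<zeta> k (x - y) *\<^sub>R h x \<partial>lebesgue)"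
      by (rule Bochner_Integration.integral_diff[symmetric]) (rule int)+
    finally have "norm (conv (\<zeta> k) h x - h x) \<le> (\<integral>y. norm (\<zeta> k (x - y) *\<^sub>R h y - \<zeta> k (x - y) *\<^sub>R h x) \<partial>lebesgue)"
      using integral_norm_bound by (simp only:)
    also have "\<dots> \<le> (\<integral>y. \<zeta> k (x - y) * e \<partial>lebesgue)"
    proof (rule integral_mono')
      fix y
      show "norm (\<zeta> k (x - y) *\<^sub>R h y - \<zeta> k (x - y) *\<^sub>R h x) \<le> \<zeta> k (x - y) * e"
      proof (cases "\<zeta> k (x - y) = 0")
        case False
        then have "x - y \<in> ball 0 (1 / (real k + 1))" using test_functions_outside[OF \<zeta>k(1)] by blast
        then have "norm (x - y) < 1 / (real k + 1)" by simp
        then have "dist y x < min d 1" using k K unfolding dist_norm norm_minus_commute[of y x] by linarith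
        then have "\<zeta> k (x - y) * norm (h y - h x) \<le> \<zeta> k (x - y) * e"
          using small \<zeta>k(2) by (intro mult_left_mono) auto
        then show ?thesis using \<zeta>k(2)[of "x - y"] by (simp flip: scaleR_diff_right)
      qed simp
    qed (use \<zeta>k e I in auto)
    also have "\<dots> = e" using I by simp
    finally show "norm (conv (\<zeta> k) h x - h x) \<le> e" .
  qed
qed

text \<open>An e/3 argument through a continuous h close to v. The two errors from replacing v by h
  are each at most the distance of h from v, one of them because convolution does not increase the
  norm; the middle error is uniform on a bounded set.\<close>

theorem mollify_Lp:
  fixes v :: "real^'n \<Rightarrow> 'a::euclidean_space"
  assumes p: "1 \<le> p" and \<zeta>: "mollifier \<zeta>" and v: "v \<in> borel_measurable lebesgue" "Lp_norm p UNIV v < top"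
    and supp: "\<And>x. norm x > s \<Longrightarrow> v x = 0"
  shows "(\<lambda>k. Lp_norm p UNIV (\<lambda>x. conv (\<zeta> k) v x - v x)) \<longlonglongrightarrow> 0"
proof -
  have p0: "0 < p" using p by simp
  have vint: "integrable lebesgue v"
    by (rule integrable_of_Lp_bounded_support[OF p v supp])
  have \<zeta>k: "\<zeta> k \<in> test_functions (ball 0 (1 / (real k + 1)))" "\<And>x. 0 \<le> \<zeta> k x" "(\<integral>x. \<zeta> k x \<partial>lebesgue) = 1" for k
    using \<zeta> unfolding mollifier_def by auto
  have cm: "conv (\<zeta> k) w \<in> borel_measurable lebesgue" if "integrable lebesgue w" for k and w :: "real^'n \<Rightarrow> 'a"
    by (rule smooth_measurable[OF smooth_conv[OF \<zeta>k(1) that]])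
  have "\<forall>\<^sub>F k in sequentially. Lp_norm p UNIV (\<lambda>x. conv (\<zeta> k) v x - v x) < ennreal e" if e: "0 < e" for e
  proof -
    obtain h where h: "continuous_on UNIV h" "\<And>x. norm x > s + 1 \<Longrightarrow> h x = 0"
      and hv: "Lp_norm p UNIV (\<lambda>x. h x - v x) < ennreal (e / 3)"
      by (rule continuous_dense_Lp[OF p v supp, where e="e / 3" and thesis=thesis]) (use e that in auto)
    have hm: "h \<in> borel_measurable lebesgue"
      using borel_measurable_continuous_onI[OF h(1)] by (simp add: measurable_completion)
    have hint: "integrable lebesgue h"
      by (rule integrable_compact_support(2)[OF h(1) compact_cball[of 0 "s + 1"]]) (use h(2) in auto)
    define w :: "real^'n \<Rightarrow> real" where "w x = indicator (cball 0 (s + 2)) x *\<^sub>R 1" for x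
    have wm: "w \<in> borel_measurable lebesgue"
      unfolding w_def by (intro borel_measurable_scaleR borel_measurable_indicator) auto
    have "Lp_norm p UNIV w < top"
      by (rule Lp_norm_bounded_support[OF p0 bounded_cball[of 0 "s + 2"], where C=1]) (auto simp: w_def indicator_def)
    then obtain M where M: "Lp_norm p UNIV w = ennreal M" "0 \<le> M"
      by (cases "Lp_norm p UNIV w") auto
    \<comment> \<open>M + 1 keeps the denominator positive, and e/4 in place of e/3 leaves room for
      the strict inequality.\<close>
    define \<delta> where "\<delta> = e / 4 / (M + 1)"
    have \<delta>: "0 < \<delta>" "\<delta> * M < e / 3"
    proof -
      show "0 < \<delta>" using e M by (simp add: \<delta>_def)
      have "\<delta> * M \<le> e / 4" using e M(2) by (simp add: \<delta>_def field_simps)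
      then show "\<delta> * M < e / 3" using e by simp
    qed
    have "\<forall>\<^sub>F k in sequentially. \<forall>x. norm (conv (\<zeta> k) h x - h x) \<le> \<delta>"
      by (rule mollify_uniform[where s="s + 1", OF \<zeta>]) (use h \<delta> in auto)
    then show ?thesis
    proof eventually_elim
      fix k assume unif: "\<forall>x. norm (conv (\<zeta> k) h x - h x) \<le> \<delta>"
      have A: "Lp_norm p UNIV (\<lambda>x. conv (\<zeta> k) h x - h x) < ennreal (e / 3)"
      proof -
        have "Lp_norm p UNIV (\<lambda>x. conv (\<zeta> k) h x - h x) \<le> Lp_norm p UNIV (\<lambda>x. \<delta> *\<^sub>R w x)"
        proof (rule Lp_norm_mono[OF p0])
          fix x :: "real^'n"
          show "norm (conv (\<zeta> k) h x - h x) \<le> norm (\<delta> *\<^sub>R w x)"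
          proof (cases "norm x > s + 2")
            case True
            have "1 / (real k + 1) \<le> 1" by simp
            then have "conv (\<zeta> k) h x = 0"
              using True by (intro conv_eq_0[where s="s + 1", OF \<zeta>k(1) h(2)]) linarith+
            then show ?thesis using h(2)[of x] True by (simp add: w_def)
          next
            case False
            then show ?thesis using unif \<delta>(1) by (simp add: w_def)
          qed
        qed
        also have "\<dots> = ennreal (\<delta> * M)"
          using \<delta>(1) M by (subst Lp_norm_scaleR[OF p0]) (auto simp: wm lebesgue_on_UNIV_eq ennreal_mult)
        also have "\<dots> < ennreal (e / 3)"
          using \<delta> M by (intro ennreal_lessI) (use e in auto)
        finally show ?thesis .
      qed
      have B: "Lp_norm p UNIV (\<lambda>x. conv (\<zeta> k) v x - conv (\<zeta> k) h x) < ennreal (e / 3)"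
      proof -
        have "Lp_norm p UNIV (\<lambda>x. conv (\<zeta> k) v x - conv (\<zeta> k) h x) = Lp_norm p UNIV (conv (\<zeta> k) (\<lambda>y. v y - h y))"
          by (rule Lp_norm_cong) (simp add: conv_diff[OF \<zeta>k(1) vint hint])
        also have "\<dots> \<le> Lp_norm p UNIV (\<lambda>y. v y - h y)"
          using vint hint by (intro Lp_norm_conv[OF p \<zeta>k]) auto
        also have "\<dots> = Lp_norm p UNIV (\<lambda>y. h y - v y)"
          by (intro Lp_norm_cong) (simp add: norm_minus_commute)
        finally show ?thesis using hv by (rule le_less_trans)
      qed
      have "Lp_norm p UNIV (\<lambda>x. conv (\<zeta> k) v x - v x)
         = Lp_norm p UNIV (\<lambda>x. (conv (\<zeta> k) v x - conv (\<zeta> k) h x) + ((conv (\<zeta> k) h x - h x) + (h x - v x)))"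
        by simp
      also have "\<dots> \<le> Lp_norm p UNIV (\<lambda>x. conv (\<zeta> k) v x - conv (\<zeta> k) h x)
           + Lp_norm p UNIV (\<lambda>x. (conv (\<zeta> k) h x - h x) + (h x - v x))"
        using cm[OF vint] cm[OF hint] hm v(1) by (intro Lp_norm_triangle[OF p]) (auto simp: lebesgue_on_UNIV_eq)
      also have "\<dots> \<le> Lp_norm p UNIV (\<lambda>x. conv (\<zeta> k) v x - conv (\<zeta> k) h x)
           + (Lp_norm p UNIV (\<lambda>x. conv (\<zeta> k) h x - h x) + Lp_norm p UNIV (\<lambda>x. h x - v x))"
        using cm[OF hint] hm v(1) by (intro add_left_mono Lp_norm_triangle[OF p]) (auto simp: lebesgue_on_UNIV_eq)
      also have "\<dots> < ennreal (e / 3) + (ennreal (e / 3) + ennreal (e / 3))"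
        by (intro add_strict_mono A B hv)
      also have "\<dots> = ennreal e" using e by (simp flip: ennreal_plus)
      finally show "Lp_norm p UNIV (\<lambda>x. conv (\<zeta> k) v x - v x) < ennreal e" .
    qed
  qed
  note small = this
  show ?thesis
  proof (rule order_tendstoI)
    fix a :: ennreal assume "0 < a"
    then obtain e where "0 < e" "ennreal e \<le> a"
      by (cases a) (auto intro: that[of 1])
    then show "\<forall>\<^sub>F k in sequentially. Lp_norm p UNIV (\<lambda>x. conv (\<zeta> k) v x - v x) < a"
      using small[of e] by (auto elim!: eventually_mono)
  qed simp
qed

subsection \<open>Weak derivatives\<close>

lemma integral_lebesgue_on:
  fixes f :: "real^'n \<Rightarrow> 'a::euclidean_space"
  assumes "U \<in> sets lebesgue"
  shows "(\<integral>x. f x \<partial>lebesgue_on U) = (\<integral>x. indicator U x *\<^sub>R f x \<partial>lebesgue)"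
  using assms by (simp add: integral_restrict_space)

lemma integrable_lebesgue_on:
  fixes f :: "real^'n \<Rightarrow> 'a::euclidean_space"
  assumes "U \<in> sets lebesgue"
  shows "integrable (lebesgue_on U) f \<longleftrightarrow> integrable lebesgue (\<lambda>x. indicator U x *\<^sub>R f x)"
  using assms by (simp add: integrable_restrict_space)

lemma open_sets_lebesgue: "open U \<Longrightarrow> U \<in> sets lebesgue"
  by simp

lemma test_functions_integrable_mult:
  fixes u :: "real^'n \<Rightarrow> 'a::euclidean_space"
  assumes U: "open U" and \<psi>: "\<psi> \<in> test_functions U" and u: "locally_integrable U u"
  shows "integrable lebesgue (\<lambda>x. indicator U x *\<^sub>R (\<psi> x *\<^sub>R u x))"
proof -
  obtain K where K: "compact K" "K \<subseteq> U" "\<And>x. x \<notin> K \<Longrightarrow> \<psi> x = 0"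
    using \<psi> unfolding test_functions_iff by blast
  obtain C where C: "C > 0" "\<And>x. norm (\<psi> x) \<le> C"
    by (rule test_functions_bounded[OF \<psi>, where thesis=thesis]) (rule that)
  have [measurable]: "\<psi> \<in> borel_measurable lebesgue"
    by (rule smooth_measurable[OF test_functions_smooth[OF \<psi>]])
  have int: "integrable lebesgue (\<lambda>x. indicator K x *\<^sub>R u x)"
    using u K unfolding locally_integrable_def set_integrable_def by blast
  then have [measurable]: "(\<lambda>x. indicator K x *\<^sub>R u x) \<in> borel_measurable lebesgue" by simp
  have "integrable lebesgue (\<lambda>x. \<psi> x *\<^sub>R (indicator K x *\<^sub>R u x))"
  proof (rule Bochner_Integration.integrable_bound)
    show "integrable lebesgue (\<lambda>x. C *\<^sub>R (indicator K x *\<^sub>R u x))"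
      by (rule integrable_scaleR_right) (rule int)
    show "AE x in lebesgue. norm (\<psi> x *\<^sub>R (indicator K x *\<^sub>R u x)) \<le> norm (C *\<^sub>R (indicator K x *\<^sub>R u x))"
      using C by (intro AE_I2) (auto simp: indicator_def intro!: mult_right_mono)
  qed measurable
  also have "(\<lambda>x. \<psi> x *\<^sub>R (indicator K x *\<^sub>R u x)) = (\<lambda>x. indicator U x *\<^sub>R (\<psi> x *\<^sub>R u x))"
    using K(2,3) by (auto simp: indicator_def fun_eq_iff)
  finally show ?thesis .
qed

text \<open>The fundamental lemma of the calculus of variations. Localizing by a test function
  \<kappa> and mollifying gives integrals of h against test functions, all zero, so \<kappa> h
  vanishes almost everywhere; the statement follows because negligibility is a local
  property.\<close>

lemma AE_eq_0_of_test_integrals: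
  fixes h :: "real^'n \<Rightarrow> 'a::euclidean_space"
  assumes U: "open U" and \<zeta>: "mollifier (\<zeta> :: nat \<Rightarrow> real^'n \<Rightarrow> real)" and h: "locally_integrable U h"
    and 0: "\<And>\<psi>. \<psi> \<in> test_functions U \<Longrightarrow> (\<integral>x. \<psi> x *\<^sub>R h x \<partial>lebesgue_on U) = 0"
  shows "AE x in lebesgue_on U. h x = 0"
proof -
  have loc: "AE x in lebesgue. indicator U x *\<^sub>R (\<kappa> x *\<^sub>R h x) = 0" if \<kappa>: "\<kappa> \<in> test_functions U" for \<kappa> :: "real^'n \<Rightarrow> real"
  proof -
    let ?v = "\<lambda>x. indicator U x *\<^sub>R (\<kappa> x *\<^sub>R h x)"
    have int: "integrable lebesgue ?v" by (rule test_functions_integrable_mult[OF U \<kappa> h])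
    have \<zeta>k: "\<zeta> k \<in> test_functions (ball 0 (1 / (real k + 1)))" for k
      using \<zeta> unfolding mollifier_def by auto
    have conv0: "conv (\<zeta> k) ?v x = 0" for k x
    proof -
      \<comment> \<open>The reflected kernel may leave U; multiplication by \<kappa> makes it
        admissible.\<close>
      have "(\<lambda>y. \<zeta> k (x - y) *\<^sub>R \<kappa> y) \<in> test_functions U"
        by (intro test_functions_scaleR_right smooth_reflect test_functions_smooth[OF \<zeta>k] \<kappa>)
      from 0[OF this] show ?thesis
        unfolding conv_def integral_lebesgue_on[OF open_sets_lebesgue[OF U]]
        by (simp add: mult_ac)
    qed
    obtain K where K: "compact K" "\<And>x. x \<notin> K \<Longrightarrow> \<kappa> x = 0"
      using \<kappa> unfolding test_functions_iff by blast
    obtain s where s: "\<And>x. x \<in> K \<Longrightarrow> norm x \<le> s"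
      using compact_imp_bounded[OF K(1)] unfolding bounded_iff by blast
    have supp: "?v x = 0" if "norm x > s" for x
      using K(2)[of x] s[of x] that by (cases "x \<in> K") auto
    have meas: "?v \<in> borel_measurable lebesgue" using int by simp
    have fin: "Lp_norm 1 UNIV ?v < top"
      using int unfolding integrable_iff_bounded by (simp add: Lp_norm_lt_top_iff lebesgue_on_UNIV_eq)
    have "(\<lambda>k. Lp_norm 1 UNIV (\<lambda>x. conv (\<zeta> k) ?v x - ?v x)) \<longlonglongrightarrow> 0"
      by (rule mollify_Lp[OF _ \<zeta> meas fin, of s]) (use supp in auto)
    then have "(\<lambda>k::nat. Lp_norm 1 UNIV (\<lambda>x. - ?v x)) \<longlonglongrightarrow> 0"
      unfolding conv0 by simp
    then have "Lp_norm 1 UNIV (\<lambda>x. - ?v x) = 0"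
      by (simp add: LIMSEQ_const_iff)
    moreover have "(\<lambda>x. - ?v x) \<in> borel_measurable (lebesgue_on UNIV)"
      using meas by (simp add: lebesgue_on_UNIV_eq)
    ultimately have "AE x in lebesgue_on UNIV. - ?v x = 0"
      by (intro Lp_norm_eq_0[of 1]) auto
    then show ?thesis by (simp only: lebesgue_on_UNIV_eq neg_equal_0_iff_equal)
  qed
  let ?S = "{x \<in> U. h x \<noteq> 0}"
  have "negligible ?S"
    unfolding locally_negligible_alt[of ?S]
  proof
    fix x0 assume x0: "x0 \<in> ?S"
    then obtain r where r: "0 < r" "ball x0 r \<subseteq> U"
      using U openE by blast
    \<comment> \<open>The kernel is nonzero at some z with norm below 1/(k + 1). Moving z to
      \<open>x0\<close> can carry the support out to twice that radius.\<close>
    obtain k :: nat where k: "2 / (real k + 1) < r"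
      using reals_Archimedean[of "r / 2"] r(1) by (auto simp: field_simps)
    have \<zeta>k: "\<zeta> k \<in> test_functions (ball 0 (1 / (real k + 1)))" "(\<integral>x. \<zeta> k x \<partial>lebesgue) = 1"
      using \<zeta> unfolding mollifier_def by auto
    obtain z where z: "\<zeta> k z \<noteq> 0"
    proof (rule ccontr)
      assume "\<not> thesis"
      then have "\<zeta> k = (\<lambda>_. 0)" using that by blast
      then show False using \<zeta>k(2) by simp
    qed
    then have nz: "norm z < 1 / (real k + 1)"
      using test_functions_outside[OF \<zeta>k(1), of z] by auto
    \<comment> \<open>a translate of the mollifier that does not vanish at \<open>x0\<close>\<close>
    define \<kappa> where "\<kappa> x = \<zeta> k ((z - x0) + 1 *\<^sub>R x)" for x
    have \<kappa>: "\<kappa> \<in> test_functions U"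
      unfolding test_functions_iff
    proof (intro conjI exI)
      show "smooth \<kappa>"
        unfolding \<kappa>_def by (rule smooth_affine[OF test_functions_smooth[OF \<zeta>k(1)]])
      show "compact (cball x0 (2 / (real k + 1)))" by simp
      show "cball x0 (2 / (real k + 1)) \<subseteq> U" using k r(2) by auto
      show "\<forall>x. x \<notin> cball x0 (2 / (real k + 1)) \<longrightarrow> \<kappa> x = 0"
      proof (intro allI impI)
        fix x assume "x \<notin> cball x0 (2 / (real k + 1))"
        then have "norm (x - x0) > 2 / (real k + 1)" by (simp add: dist_norm norm_minus_commute)
        moreover have "norm (x - x0) \<le> norm ((z - x0) + x) + norm z"
          using norm_triangle_ineq4[of "(z - x0) + x" z] by (simp add: algebra_simps)
        moreover have "2 / (real k + 1) = 1 / (real k + 1) + 1 / (real k + 1)"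
          by (simp flip: add_divide_distrib)
        ultimately have "norm ((z - x0) + x) > 1 / (real k + 1)" using nz by linarith
        then show "\<kappa> x = 0"
          unfolding \<kappa>_def by (intro test_functions_outside[OF \<zeta>k(1)]) simp
      qed
    qed
    \<comment> \<open>\<open>\<kappa> x0\<close> equals \<open>\<zeta> k z\<close>, so this open set
      is a neighbourhood of \<open>x0\<close>.\<close>
    have op: "open {x. \<kappa> x \<noteq> 0}"
      using smooth_continuous[OF test_functions_smooth[OF \<kappa>], of UNIV]
      by (intro open_Collect_neq) (auto intro: continuous_on_const)
    have "AE x in lebesgue. x \<notin> ?S \<inter> {x. \<kappa> x \<noteq> 0}"
      using loc[OF \<kappa>] by eventually_elim auto
    then have "negligible (?S \<inter> {x. \<kappa> x \<noteq> 0})"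
    proof (rule AE_E)
      fix N assume N: "{x \<in> space lebesgue. \<not> x \<notin> ?S \<inter> {x. \<kappa> x \<noteq> 0}} \<subseteq> N" "emeasure lebesgue N = 0" "N \<in> sets lebesgue"
      then have "negligible N" unfolding negligible_iff_null_sets null_sets_def by blast
      moreover have "?S \<inter> {x. \<kappa> x \<noteq> 0} \<subseteq> N" using N(1) by auto
      ultimately show ?thesis by (rule negligible_subset)
    qed
    then show "\<exists>W. openin (top_of_set ?S) W \<and> x0 \<in> W \<and> negligible W"
      using op x0 z by (intro exI[of _ "?S \<inter> {x. \<kappa> x \<noteq> 0}"]) (auto simp: openin_open \<kappa>_def)
  qed
  then have "AE x in lebesgue. x \<notin> ?S"
    by (intro AE_not_in) (simp only: negligible_iff_null_sets)
  then have "AE x in lebesgue. x \<in> U \<longrightarrow> h x = 0" by eventually_elim auto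
  then show ?thesis using U by (simp add: AE_restrict_space_iff)
qed

lemma locally_integrable_diff:
  "locally_integrable U f \<Longrightarrow> locally_integrable U g \<Longrightarrow> locally_integrable U (\<lambda>x. f x - g x)"
  unfolding locally_integrable_def by (simp add: set_integral_diff)

text \<open>The mollifier in the assumptions stands for the existence of bump functions; it will be
  supplied by the cut-off function of the final theorem.\<close>

lemma weak_deriv_unique:
  fixes u :: "real^'n \<Rightarrow> 'a::euclidean_space"
  assumes U: "open U" and \<zeta>: "mollifier (\<zeta> :: nat \<Rightarrow> real^'n \<Rightarrow> real)"
    and g: "has_weak_deriv U is u g" and g': "has_weak_deriv U is u g'"
  shows "AE x in lebesgue_on U. g x = g' x"
proof -
  have li: "locally_integrable U g" "locally_integrable U g'"
    using g g' unfolding has_weak_deriv_def by auto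
  have "AE x in lebesgue_on U. g x - g' x = 0"
  proof (rule AE_eq_0_of_test_integrals[OF U \<zeta> locally_integrable_diff[OF li]])
    fix \<psi> :: "real^'n \<Rightarrow> real" assume \<psi>: "\<psi> \<in> test_functions U"
    have "integrable (lebesgue_on U) (\<lambda>x. \<psi> x *\<^sub>R g x)" "integrable (lebesgue_on U) (\<lambda>x. \<psi> x *\<^sub>R g' x)"
      using test_functions_integrable_mult[OF U \<psi>] li U by (simp_all add: integrable_lebesgue_on)
    moreover have "(\<integral>x. \<psi> x *\<^sub>R g x \<partial>lebesgue_on U) = (\<integral>x. \<psi> x *\<^sub>R g' x \<partial>lebesgue_on U)"
    proof (rule scaleR_left_imp_eq)
      show "(- 1) ^ length is *\<^sub>R (\<integral>x. \<psi> x *\<^sub>R g x \<partial>lebesgue_on U)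
          = (- 1) ^ length is *\<^sub>R (\<integral>x. \<psi> x *\<^sub>R g' x \<partial>lebesgue_on U)"
        using g g' \<psi> unfolding has_weak_deriv_def by simp
    qed simp
    ultimately show "(\<integral>x. \<psi> x *\<^sub>R (g x - g' x) \<partial>lebesgue_on U) = 0"
      by (simp add: scaleR_diff_right)
  qed
  then show ?thesis by simp
qed

text \<open>\<open>weak_deriv\<close> chooses some derivative; by uniqueness any known one may
  replace it under an integral.\<close>

lemma weak_deriv_AE:
  fixes u :: "real^'n \<Rightarrow> 'a::euclidean_space"
  assumes "open U" "mollifier (\<zeta> :: nat \<Rightarrow> real^'n \<Rightarrow> real)" "has_weak_deriv U is u g"
  shows "AE x in lebesgue_on U. weak_deriv U is u x = g x"
  using weak_deriv_unique[OF assms(1,2) _ assms(3)] someI[of "has_weak_deriv U is u", OF assms(3)]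
  unfolding weak_deriv_def by blast

lemma weak_laplacian_AE:
  fixes u :: "real^'n \<Rightarrow> 'a::euclidean_space"
  assumes "open U" "mollifier (\<zeta> :: nat \<Rightarrow> real^'n \<Rightarrow> real)" "\<And>i. has_weak_deriv U [i, i] u (g i)"
  shows "AE x in lebesgue_on U. weak_laplacian U u x = (\<Sum>i\<in>UNIV. g i x)"
proof -
  have "AE x in lebesgue_on U. \<forall>i\<in>UNIV. weak_deriv U [i, i] u x = g i x"
    using weak_deriv_AE[OF assms(1,2,3)] by (intro AE_finite_allI) auto
  then show ?thesis unfolding weak_laplacian_def by eventually_elim simp
qed

text \<open>The weak derivatives of u are tested against \<phi> \<psi> and against \<psi> times the
  first derivative of \<phi>, by way of the identity \<open>\<phi> \<psi>'' = (\<phi> \<psi>)'' - 2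
  (\<phi>' \<psi>)' + \<phi>'' \<psi>\<close>. Here \<psi> is smooth with arbitrary support: later
  it is a reflected mollifying kernel, which need not be supported in U.\<close>

lemma weak_product_rule:
  fixes u :: "real^'n \<Rightarrow> 'a::euclidean_space" and \<phi> \<psi> :: "real^'n \<Rightarrow> real"
  assumes U: "open U" and \<phi>: "\<phi> \<in> test_functions U" and \<psi>: "smooth \<psi>"
    and u1: "has_weak_deriv U [i] u u1" and u2: "has_weak_deriv U [i, i] u u2"
  shows "(\<integral>x. partials [i, i] \<psi> x *\<^sub>R (\<phi> x *\<^sub>R u x) \<partial>lebesgue_on U) =
    (\<integral>x. \<psi> x *\<^sub>R (\<phi> x *\<^sub>R u2 x + (2 * partials [i] \<phi> x) *\<^sub>R u1 x + partials [i, i] \<phi> x *\<^sub>R u x) \<partial>lebesgue_on U)"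
proof -
  note sm = test_functions_smooth[OF \<phi>]
  note test = test_functions_scaleR_left[OF \<phi> \<psi>]
    test_functions_scaleR_left[OF test_functions_partials[OF \<phi>, of "[i]"] \<psi>]
    test_functions_scaleR_left[OF test_functions_partials[OF \<phi>, of "[i, i]"] \<psi>]
  have li: "locally_integrable U u" "locally_integrable U u1" "locally_integrable U u2"
    using u1 u2 unfolding has_weak_deriv_def by auto
  have int: "integrable (lebesgue_on U) (\<lambda>x. t x *\<^sub>R w x)" if "t \<in> test_functions U" "locally_integrable U w" for t and w :: "real^'n \<Rightarrow> 'a"
    using test_functions_integrable_mult[OF U that] U by (simp add: integrable_lebesgue_on)
  let ?p1 = "\<lambda>x. partials [i] \<phi> x *\<^sub>R \<psi> x" and ?p2 = "\<lambda>x. \<phi> x *\<^sub>R \<psi> x" and ?p0 = "\<lambda>x. partials [i, i] \<phi> x *\<^sub>R \<psi> x"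
  have d1: "partials [i] ?p1 x = partials [i] \<phi> x * partials [i] \<psi> x + partials [i, i] \<phi> x * \<psi> x" for x
    using partials_scaleR[OF smooth_partials[OF sm, of "[i]"] \<psi>, of i] by (simp add: partials_pair)
  have d2: "partials [i, i] ?p2 x = \<phi> x * partials [i, i] \<psi> x + 2 * (partials [i] \<phi> x * partials [i] \<psi> x) + partials [i, i] \<phi> x * \<psi> x" for x
  proof -
    have 1: "partials [i] (\<lambda>x. \<phi> x *\<^sub>R partials [i] \<psi> x) x = \<phi> x * partials [i, i] \<psi> x + partials [i] \<phi> x * partials [i] \<psi> x"
      using partials_scaleR[OF sm smooth_partials[OF \<psi>, of "[i]"], of i] by (simp add: partials_pair)
    have "partials [i, i] ?p2 x = partials [i] (\<lambda>x. \<phi> x *\<^sub>R partials [i] \<psi> x + partials [i] \<phi> x *\<^sub>R \<psi> x) x"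
      unfolding partials_pair partials_scaleR[OF sm \<psi>] ..
    also have "\<dots> = partials [i] (\<lambda>x. \<phi> x *\<^sub>R partials [i] \<psi> x) x + partials [i] ?p1 x"
      by (rule fun_cong[OF partials_add]; rule smooth_differentiable, rule smooth_scaleR; intro sm \<psi> smooth_partials)
    finally show ?thesis by (simp only: 1 d1)
  qed
  have e2: "(\<integral>x. partials [i, i] ?p2 x *\<^sub>R u x \<partial>lebesgue_on U) = (\<integral>x. ?p2 x *\<^sub>R u2 x \<partial>lebesgue_on U)"
    using u2 test(1) unfolding has_weak_deriv_def by fastforce
  have e1: "(\<integral>x. partials [i] ?p1 x *\<^sub>R u x \<partial>lebesgue_on U) = - (\<integral>x. ?p1 x *\<^sub>R u1 x \<partial>lebesgue_on U)"
    using u1 test(2) unfolding has_weak_deriv_def by fastforce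
  have "(\<integral>x. partials [i, i] \<psi> x *\<^sub>R (\<phi> x *\<^sub>R u x) \<partial>lebesgue_on U)
      = (\<integral>x. partials [i, i] ?p2 x *\<^sub>R u x - 2 *\<^sub>R (partials [i] ?p1 x *\<^sub>R u x) + ?p0 x *\<^sub>R u x \<partial>lebesgue_on U)"
  proof (rule Bochner_Integration.integral_cong)
    fix x
    have "partials [i, i] \<psi> x * \<phi> x = partials [i, i] ?p2 x - 2 * partials [i] ?p1 x + ?p0 x"
      unfolding d1 d2 by (simp add: algebra_simps)
    then show "partials [i, i] \<psi> x *\<^sub>R (\<phi> x *\<^sub>R u x) = partials [i, i] ?p2 x *\<^sub>R u x - 2 *\<^sub>R (partials [i] ?p1 x *\<^sub>R u x) + ?p0 x *\<^sub>R u x"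
      by (simp only: scaleR_scaleR scaleR_add_left scaleR_diff_left)
  qed simp
  also have "\<dots> = (\<integral>x. partials [i, i] ?p2 x *\<^sub>R u x \<partial>lebesgue_on U) - 2 *\<^sub>R (\<integral>x. partials [i] ?p1 x *\<^sub>R u x \<partial>lebesgue_on U)
      + (\<integral>x. ?p0 x *\<^sub>R u x \<partial>lebesgue_on U)"
    using int[OF test_functions_partials[OF test(1)] li(1), of "[i, i]"] int[OF test_functions_partials[OF test(2)] li(1), of "[i]"]
      int[OF test(3) li(1)] by (simp del: scaleR_scaleR)
  also have "\<dots> = (\<integral>x. ?p2 x *\<^sub>R u2 x \<partial>lebesgue_on U) + 2 *\<^sub>R (\<integral>x. ?p1 x *\<^sub>R u1 x \<partial>lebesgue_on U)
      + (\<integral>x. ?p0 x *\<^sub>R u x \<partial>lebesgue_on U)"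
    unfolding e1 e2 by simp
  also have "\<dots> = (\<integral>x. ?p2 x *\<^sub>R u2 x + 2 *\<^sub>R (?p1 x *\<^sub>R u1 x) + ?p0 x *\<^sub>R u x \<partial>lebesgue_on U)"
    using int[OF test(1) li(3)] int[OF test(2) li(2)] int[OF test(3) li(1)] by (simp del: scaleR_scaleR)
  also have "\<dots> = (\<integral>x. \<psi> x *\<^sub>R (\<phi> x *\<^sub>R u2 x + (2 * partials [i] \<phi> x) *\<^sub>R u1 x + partials [i, i] \<phi> x *\<^sub>R u x) \<partial>lebesgue_on U)"
    by (rule Bochner_Integration.integral_cong) (auto simp: scaleR_add_right mult_ac)
  finally show ?thesis .
qed

lemma locally_integrable_test_mult:
  fixes u :: "real^'n \<Rightarrow> 'a::euclidean_space"
  assumes U: "open U" and \<psi>: "\<psi> \<in> test_functions U" and u: "locally_integrable U u"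
  shows "locally_integrable U (\<lambda>x. \<psi> x *\<^sub>R u x)"
  unfolding locally_integrable_def set_integrable_def
proof (intro allI impI)
  fix K assume K: "compact K \<and> K \<subseteq> U"
  have "integrable lebesgue (\<lambda>x. indicator K x *\<^sub>R (indicator U x *\<^sub>R (\<psi> x *\<^sub>R u x)))"
    using K by (intro integrable_mult_indicator test_functions_integrable_mult[OF U \<psi> u]) (auto simp: lmeasurable_compact fmeasurableD)
  moreover have "indicator K x *\<^sub>R (indicator U x *\<^sub>R (\<psi> x *\<^sub>R u x)) = indicator K x *\<^sub>R (\<psi> x *\<^sub>R u x)" for x
    using K by (auto simp: indicator_def)
  ultimately show "integrable lebesgue (\<lambda>x. indicator K x *\<^sub>R (\<psi> x *\<^sub>R u x))" by (simp only:)
qed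

lemma locally_integrable_add:
  "locally_integrable U f \<Longrightarrow> locally_integrable U g \<Longrightarrow> locally_integrable U (\<lambda>x. f x + g x)"
  unfolding locally_integrable_def by (simp add: set_integral_add)

lemma has_weak_deriv_product:
  fixes u :: "real^'n \<Rightarrow> 'a::euclidean_space" and \<phi> :: "real^'n \<Rightarrow> real"
  assumes U: "open U" and \<phi>: "\<phi> \<in> test_functions U"
    and u1: "has_weak_deriv U [i] u u1" and u2: "has_weak_deriv U [i, i] u u2"
  shows "has_weak_deriv U [i, i] (\<lambda>x. \<phi> x *\<^sub>R u x)
    (\<lambda>x. \<phi> x *\<^sub>R u2 x + (2 * partials [i] \<phi> x) *\<^sub>R u1 x + partials [i, i] \<phi> x *\<^sub>R u x)"
proof -
  have li: "locally_integrable U u" "locally_integrable U u1" "locally_integrable U u2"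
    using u1 u2 unfolding has_weak_deriv_def by auto
  have t1: "(\<lambda>x. 2 * partials [i] \<phi> x) \<in> test_functions U"
    using test_functions_scaleR_right[OF smooth_const[of 2] test_functions_partials[OF \<phi>, of "[i]"]] by simp
  show ?thesis
    unfolding has_weak_deriv_def
    using weak_product_rule[OF U \<phi> _ u1 u2] test_functions_smooth
    by (auto intro!: locally_integrable_add locally_integrable_test_mult[OF U] \<phi> t1 li test_functions_partials)
qed

lemma integration_by_parts_test_functions:
  fixes w :: "real^'n \<Rightarrow> 'a::euclidean_space"
  assumes \<psi>: "\<psi> \<in> test_functions U" and w: "w \<in> test_functions V"
  shows "(\<integral>x. partials [i] \<psi> x *\<^sub>R w x \<partial>lebesgue) = - (\<integral>x. \<psi> x *\<^sub>R partials [i] w x \<partial>lebesgue)"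
proof -
  note sm = test_functions_smooth[OF \<psi>] test_functions_smooth[OF w]
  have "0 = (\<integral>x. partials [i] (\<lambda>x. \<psi> x *\<^sub>R w x) x \<partial>lebesgue)"
    using test_functions_integral_partials[OF test_functions_scaleR_left[OF \<psi> sm(2)]] by simp
  also have "\<dots> = (\<integral>x. \<psi> x *\<^sub>R partials [i] w x \<partial>lebesgue) + (\<integral>x. partials [i] \<psi> x *\<^sub>R w x \<partial>lebesgue)"
    unfolding partials_scaleR[OF sm]
    by (intro Bochner_Integration.integral_add test_functions_integrable(2)[OF test_functions_scaleR_left[OF \<psi> smooth_partials[OF sm(2)]]]
       test_functions_integrable(2)[OF test_functions_scaleR_left[OF test_functions_partials[OF \<psi>] sm(2)]])
  finally show ?thesis by (simp add: eq_neg_iff_add_eq_0 add.commute)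
qed

lemma test_functions_locally_integrable:
  fixes w :: "real^'n \<Rightarrow> 'a::euclidean_space"
  assumes "w \<in> test_functions V"
  shows "locally_integrable U w"
  unfolding locally_integrable_def set_integrable_def
  using test_functions_integrable(2)[OF assms]
  by (auto intro!: integrable_mult_indicator simp: lmeasurable_compact fmeasurableD)

lemma has_weak_deriv_test_functions:
  fixes w :: "real^'n \<Rightarrow> 'a::euclidean_space"
  assumes U: "open U" and w: "w \<in> test_functions U"
  shows "has_weak_deriv U [] w w" "has_weak_deriv U [i] w (partials [i] w)"
proof -
  show "has_weak_deriv U [] w w"
    using test_functions_locally_integrable[OF w] by (simp add: has_weak_deriv_def)
  have "(\<integral>x. partials [i] \<psi> x *\<^sub>R w x \<partial>lebesgue_on U) = - (\<integral>x. \<psi> x *\<^sub>R partials [i] w x \<partial>lebesgue_on U)"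
    if "\<psi> \<in> test_functions U" for \<psi>
  proof -
    have "indicator U x *\<^sub>R (partials [i] \<psi> x *\<^sub>R w x) = partials [i] \<psi> x *\<^sub>R w x"
      "indicator U x *\<^sub>R (\<psi> x *\<^sub>R partials [i] w x) = \<psi> x *\<^sub>R partials [i] w x" for x
      using test_functions_outside[OF w, of x] test_functions_outside[OF that, of x] by (auto simp: indicator_def)
    then show ?thesis
      using integration_by_parts_test_functions[OF that w, of i] by (simp only: integral_lebesgue_on[OF open_sets_lebesgue[OF U]])
  qed
  then show "has_weak_deriv U [i] w (partials [i] w)"
    using test_functions_locally_integrable[OF w] test_functions_locally_integrable[OF test_functions_partials[OF w]]
    by (simp add: has_weak_deriv_def)
qed

subsection \<open>The Sobolev inequality for test functions\<close>

definition grad_length :: "(real^'n \<Rightarrow> 'a::real_normed_vector) \<Rightarrow> real^'n \<Rightarrow> real" where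
  "grad_length w x = sqrt (\<Sum>i\<in>UNIV. (norm (partials [i] w x))\<^sup>2)"

lemma grad_length_nonneg: "0 \<le> grad_length w x"
  by (simp add: grad_length_def sum_nonneg)

lemma grad_length_power2: "(grad_length w x)\<^sup>2 = (\<Sum>i\<in>UNIV. (norm (partials [i] w x))\<^sup>2)"
  by (simp add: grad_length_def sum_nonneg)

lemma grad_length_continuous: "smooth w \<Longrightarrow> continuous_on S (grad_length w)"
  unfolding grad_length_def
  by (intro continuous_intros smooth_continuous smooth_partials)

lemma grad_length_measurable:
  assumes "smooth w"
  shows "grad_length w \<in> borel_measurable lebesgue"
proof -
  have "grad_length w \<in> borel_measurable borel"
    by (intro borel_measurable_continuous_onI grad_length_continuous assms)
  then show ?thesis by (simp add: measurable_completion)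
qed

lemma grad_length_scaleR:
  assumes "smooth w"
  shows "grad_length (\<lambda>x. c *\<^sub>R w x) x = \<bar>c\<bar> * grad_length w x"
proof -
  have "partials [i] (\<lambda>x. c *\<^sub>R w x) x = c *\<^sub>R partials [i] w x" for i
    by (rule fun_cong[OF bounded_linear.partials_linear[OF bounded_linear_scaleR_right smooth_differentiable[OF assms]]])
  then show ?thesis
    by (simp add: grad_length_def power_mult_distrib real_sqrt_mult flip: sum_distrib_left)
qed

lemma borel_measurable_lebesgue_onI: "f \<in> borel_measurable lebesgue \<Longrightarrow> f \<in> borel_measurable (lebesgue_on U)"
  by (simp add: measurable_restrict_space1)

lemma Lp_norm_test_function_finite:
  fixes f :: "real^'n \<Rightarrow> 'b::euclidean_space"
  assumes p: "0 < p" and f: "continuous_on UNIV f" and K: "compact K" "\<And>x. x \<notin> K \<Longrightarrow> f x = 0" and U: "U \<in> sets lebesgue"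
  shows "Lp_norm p U f < top"
proof -
  have "compact (f ` K)" by (intro compact_continuous_image continuous_on_subset[OF f] K) auto
  then obtain C where C: "\<And>x. x \<in> K \<Longrightarrow> norm (f x) \<le> C"
    using compact_imp_bounded[of "f ` K"] unfolding bounded_iff by blast
  have "norm (f x) \<le> max C 0" for x
    using C[of x] K(2)[of x] by (cases "x \<in> K") auto
  then have "Lp_norm p UNIV f < top"
    by (intro Lp_norm_bounded_support[OF p compact_imp_bounded[OF K(1)]]) (use K in auto)
  then show ?thesis using Lp_norm_subset[OF p U, of UNIV f] by (auto intro: le_less_trans)
qed

lemma test_functions_Lp_space:
  fixes w :: "real^'n \<Rightarrow> 'a::euclidean_space"
  assumes "0 < p" "w \<in> test_functions V" "U \<in> sets lebesgue"
  shows "w \<in> Lp_space p U"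
proof -
  obtain K where "compact K" "\<And>x. x \<notin> K \<Longrightarrow> w x = 0"
    using assms(2) unfolding test_functions_iff by blast
  then have "Lp_norm p U w < top"
    using assms test_functions_smooth smooth_continuous by (intro Lp_norm_test_function_finite) blast+
  then show ?thesis
    unfolding Lp_space_def using borel_measurable_lebesgue_onI[OF smooth_measurable[OF test_functions_smooth[OF assms(2)]]] by simp
qed

lemma grad_length_Lp_finite:
  fixes w :: "real^'n \<Rightarrow> 'a::euclidean_space"
  assumes "0 < p" "w \<in> test_functions V" "U \<in> sets lebesgue"
  shows "Lp_norm p U (grad_length w) < top"
proof -
  obtain K where K: "compact K" "\<And>x. x \<notin> K \<Longrightarrow> w x = 0"
    using assms(2) unfolding test_functions_iff by blast
  then have "grad_length w x = 0" if "x \<notin> K" for x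
    using partials_eq_0_off_closed[OF compact_imp_closed[OF K(1)] K(2) that] by (simp add: grad_length_def)
  then show ?thesis
    using K(1) assms by (intro Lp_norm_test_function_finite grad_length_continuous test_functions_smooth) auto
qed

lemma weak_grad_length_test_functions:
  fixes w :: "real^'n \<Rightarrow> 'a::euclidean_space"
  assumes "open U" "mollifier (\<zeta> :: nat \<Rightarrow> real^'n \<Rightarrow> real)" "w \<in> test_functions U"
  shows "AE x in lebesgue_on U. weak_grad_length U w x = grad_length w x"
proof -
  have "AE x in lebesgue_on U. \<forall>i\<in>UNIV. weak_deriv U [i] w x = partials [i] w x"
    using weak_deriv_AE[OF assms(1,2) has_weak_deriv_test_functions(2)[OF assms(1,3)]] by (intro AE_finite_allI) auto
  then show ?thesis unfolding weak_grad_length_def grad_length_def by eventually_elim simp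
qed

lemma test_functions_zero: "(\<lambda>x. 0) \<in> test_functions U"
  unfolding test_functions_iff using smooth_const[of 0] by blast

lemma test_functions_sobolev_H10:
  fixes w :: "real^'n \<Rightarrow> 'a::euclidean_space"
  assumes U: "open U" and \<zeta>: "mollifier (\<zeta> :: nat \<Rightarrow> real^'n \<Rightarrow> real)" and w: "w \<in> test_functions U"
  shows "w \<in> sobolev_H10 U"
proof -
  have "w \<in> sobolev 1 2 U"
  proof -
    have "\<exists>g\<in>Lp_space 2 U. has_weak_deriv U is w g" if "length is \<le> 1" for "is"
    proof (cases "is")
      case Nil
      then show ?thesis
        using has_weak_deriv_test_functions(1)[OF U w] test_functions_Lp_space[of 2 w U U] w U by auto
    next
      case (Cons i js)
      then have "is = [i]" using that by simp
      then show ?thesis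
        using has_weak_deriv_test_functions(2)[OF U w] test_functions_Lp_space[of 2 "partials [i] w" U U] test_functions_partials[OF w] U by auto
    qed
    then show ?thesis
      unfolding sobolev_def using test_functions_Lp_space[of 2 w U U] w U by auto
  qed
  \<comment> \<open>w is its own approximation. What remains is that the representative chosen by
    \<open>weak_deriv\<close> for the zero function vanishes almost everywhere.\<close>
  moreover have "Lp_norm 2 U (\<lambda>x. w x - w x) + Lp_norm 2 U (weak_grad_length U (\<lambda>x. w x - w x)) < ennreal \<epsilon>" if "0 < \<epsilon>" for \<epsilon>
  proof -
    have "AE x in lebesgue_on U. weak_grad_length U (\<lambda>x. 0 :: 'a) x = grad_length (\<lambda>x. 0 :: 'a) x"
      by (rule weak_grad_length_test_functions[OF U \<zeta> test_functions_zero])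
    moreover have "grad_length (\<lambda>x. 0 :: 'a) x = 0" for x :: "real^'n"
      using grad_length_scaleR[OF smooth_const[of "0::'a"], of 0 x] by simp
    ultimately have "AE x in lebesgue_on U. weak_grad_length U (\<lambda>x. 0 :: 'a) x = 0" by simp
    then have "Lp_norm 2 U (weak_grad_length U (\<lambda>x. 0 :: 'a)) = 0" by (intro Lp_norm_0) auto
    moreover have "Lp_norm 2 U (\<lambda>x. 0 :: 'a) = 0" by (intro Lp_norm_0) auto
    ultimately show ?thesis using that by simp
  qed
  ultimately show ?thesis
    unfolding sobolev_H10_def using w by blast
qed

text \<open>Continuity turns vanishing almost everywhere into vanishing, so w is constant, and it is
  0 off a compact set. This settles the case in which w cannot be normalized by its
  gradient.\<close>

lemma grad_length_AE_0:
  fixes w :: "real^'n \<Rightarrow> 'a::euclidean_space"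
  assumes U: "open U" and w: "w \<in> test_functions U" and 0: "AE x in lebesgue_on U. grad_length w x = 0"
  shows "w x = 0"
proof -
  note sm = test_functions_smooth[OF w]
  have "open {x. grad_length w x \<noteq> 0}"
    using grad_length_continuous[OF sm, of UNIV] by (intro open_Collect_neq) (auto intro: continuous_on_const)
  then have op: "open (U \<inter> {x. grad_length w x \<noteq> 0})" using U by auto
  have "AE x in lebesgue. x \<in> U \<longrightarrow> grad_length w x = 0"
    using 0 U by (simp add: AE_restrict_space_iff)
  then have "AE x in lebesgue. x \<notin> U \<inter> {x. grad_length w x \<noteq> 0}" by eventually_elim auto
  then have "negligible (U \<inter> {x. grad_length w x \<noteq> 0})"
    using op by (simp only: negligible_iff_null_sets) (subst AE_iff_null_sets, auto)
  then have emp: "U \<inter> {x. grad_length w x \<noteq> 0} = {}"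
    using op open_not_negligible by blast
  have "partials [i] w y = 0" for i y
  proof (cases "y \<in> U")
    case True
    then have "(grad_length w y)\<^sup>2 = 0" using emp by auto
    then show ?thesis unfolding grad_length_power2 by (subst (asm) sum_nonneg_eq_0_iff) auto
  next
    case False
    then show ?thesis using test_functions_outside[OF test_functions_partials[OF w]] by blast
  qed
  then have d: "(w has_derivative (\<lambda>h. 0)) (at y)" for y
    using has_derivative_partials[OF smooth_differentiable[OF sm], of y] by simp
  obtain K where K: "compact K" "\<And>x. x \<notin> K \<Longrightarrow> w x = 0"
    using w unfolding test_functions_iff by blast
  have "K \<noteq> UNIV" using K(1) not_compact_UNIV by auto
  then obtain y where "y \<notin> K" by blast
  then have "w y = 0" by (rule K(2))
  moreover have "w x = w y"
    by (rule has_derivative_zero_unique[of UNIV w]) (use d in auto)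
  ultimately show ?thesis by simp
qed

text \<open>By homogeneity: w divided by the norm X of its gradient competes in the
  supremum.\<close>

lemma sobolev_test_functions:
  fixes w :: "real^'n \<Rightarrow> 'a::euclidean_space" and U :: "(real^'n) set"
  assumes U: "open U" and \<zeta>: "mollifier (\<zeta> :: nat \<Rightarrow> real^'n \<Rightarrow> real)" and w: "w \<in> test_functions U" and q: "0 < q"
  shows "Lp_norm q U w \<le> (SUP w \<in> {w :: real^'n \<Rightarrow> 'a. w \<in> sobolev_H10 U \<and>
    Lp_norm 2 U (weak_grad_length U w) = 1}. Lp_norm q U w) * Lp_norm 2 U (grad_length w)" (is "_ \<le> ?\<sigma> * ?X")
proof -
  note sm = test_functions_smooth[OF w]
  have Um: "U \<in> sets lebesgue" using U by simp
  have gm: "grad_length w \<in> borel_measurable (lebesgue_on U)"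
    by (intro borel_measurable_lebesgue_onI grad_length_measurable sm)
  have wm: "w \<in> borel_measurable (lebesgue_on U)"
    by (intro borel_measurable_lebesgue_onI smooth_measurable sm)
  obtain X where X: "?X = ennreal X" "0 \<le> X"
    using grad_length_Lp_finite[OF _ w Um, of 2] by (cases ?X) auto
  show ?thesis
  proof (cases "X = 0")
    case True
    then have "AE x in lebesgue_on U. grad_length w x = 0"
      using X by (intro Lp_norm_eq_0[OF _ gm, of 2]) auto
    then have "w x = 0" for x using grad_length_AE_0[OF U w] by blast
    then have "Lp_norm q U w = 0" using q by (intro Lp_norm_0) auto
    then show ?thesis by simp
  next
    case False
    then have Xp: "0 < X" using X by simp
    let ?w = "\<lambda>x. (1 / X) *\<^sub>R w x"
    have tw: "?w \<in> test_functions U" by (rule test_functions_scaleR_right[OF smooth_const w])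
    have "Lp_norm 2 U (weak_grad_length U ?w) = Lp_norm 2 U (grad_length ?w)"
      using weak_grad_length_test_functions[OF U \<zeta> tw] by (intro Lp_norm_cong_AE) (auto elim: eventually_mono)
    also have "\<dots> = Lp_norm 2 U (\<lambda>x. (1 / X) *\<^sub>R grad_length w x)"
      by (rule Lp_norm_cong) (simp add: grad_length_scaleR[OF sm] abs_mult)
    also have "\<dots> = ennreal (1 / X) * ennreal X"
      using Xp X(1) by (subst Lp_norm_scaleR[OF _ gm]) auto
    also have "\<dots> = 1" using Xp by (simp flip: ennreal_mult)
    finally have "Lp_norm q U ?w \<le> ?\<sigma>"
      using test_functions_sobolev_H10[OF U \<zeta> tw] by (intro SUP_upper) auto
    moreover have "Lp_norm q U ?w = ennreal (1 / X) * Lp_norm q U w"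
      using Xp by (subst Lp_norm_scaleR[OF q wm]) auto
    ultimately have "ennreal X * (ennreal (1 / X) * Lp_norm q U w) \<le> ennreal X * ?\<sigma>"
      by (intro mult_left_mono) auto
    moreover have "ennreal X * (ennreal (1 / X) * Lp_norm q U w) = Lp_norm q U w"
      using Xp by (simp add: mult.assoc[symmetric] flip: ennreal_mult)
    ultimately show ?thesis unfolding X(1) by (simp add: mult.commute)
  qed
qed

section \<open>Energy identity and the bound by the Laplacian\<close>

lemma inner_laplacian_integrable:
  fixes w :: "real^'n \<Rightarrow> 'a::euclidean_space"
  assumes "w \<in> test_functions U"
  shows "integrable lebesgue (\<lambda>x. w x \<bullet> laplacian w x)"
  unfolding laplacian_def inner_sum_right
  by (intro Bochner_Integration.integrable_sum test_functions_integrable(2)[OF test_functions_inner_left[OF assms]]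
        smooth_partials test_functions_smooth[OF assms])

text \<open>The integral of the i-th derivative of \<open>w x \<bullet> partials [i] w x\<close> is
  0; the product rule and summation over i give the formula.\<close>

lemma Green_identity:
  fixes w :: "real^'n \<Rightarrow> 'a::euclidean_space"
  assumes w: "w \<in> test_functions U"
  shows "integrable lebesgue (\<lambda>x. (grad_length w x)\<^sup>2)"
    "(\<integral>x. (grad_length w x)\<^sup>2 \<partial>lebesgue) = - (\<integral>x. w x \<bullet> laplacian w x \<partial>lebesgue)"
proof -
  note sm = test_functions_smooth[OF w]
  have int1: "integrable lebesgue (\<lambda>x. partials [i] w x \<bullet> partials [i] w x)" for i
    by (intro test_functions_integrable(2)[OF test_functions_inner_left[OF test_functions_partials[OF w]]] smooth_partials sm)
  have int2: "integrable lebesgue (\<lambda>x. w x \<bullet> partials [i, i] w x)" for i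
    by (intro test_functions_integrable(2)[OF test_functions_inner_left[OF w]] smooth_partials sm)
  have eq: "(\<integral>x. partials [i] w x \<bullet> partials [i] w x \<partial>lebesgue) = - (\<integral>x. w x \<bullet> partials [i, i] w x \<partial>lebesgue)" for i
  proof -
    have "0 = (\<integral>x. partials [i] (\<lambda>x. w x \<bullet> partials [i] w x) x \<partial>lebesgue)"
      using test_functions_integral_partials[OF test_functions_inner_left[OF w smooth_partials[OF sm, of "[i]"]]] by simp
    also have "\<dots> = (\<integral>x. w x \<bullet> partials [i, i] w x + partials [i] w x \<bullet> partials [i] w x \<partial>lebesgue)"
      unfolding partials_inner[OF sm smooth_partials[OF sm]] partials_pair ..
    also have "\<dots> = (\<integral>x. w x \<bullet> partials [i, i] w x \<partial>lebesgue) + (\<integral>x. partials [i] w x \<bullet> partials [i] w x \<partial>lebesgue)"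
      by (rule Bochner_Integration.integral_add[OF int2 int1])
    finally show ?thesis by simp
  qed
  show "integrable lebesgue (\<lambda>x. (grad_length w x)\<^sup>2)"
    unfolding grad_length_power2 power2_norm_eq_inner by (intro Bochner_Integration.integrable_sum int1)
  have "(\<integral>x. (grad_length w x)\<^sup>2 \<partial>lebesgue) = (\<Sum>i\<in>UNIV. \<integral>x. partials [i] w x \<bullet> partials [i] w x \<partial>lebesgue)"
    unfolding grad_length_power2 power2_norm_eq_inner by (intro Bochner_Integration.integral_sum int1)
  also have "\<dots> = - (\<Sum>i\<in>UNIV. \<integral>x. w x \<bullet> partials [i, i] w x \<partial>lebesgue)"
    unfolding eq by (rule sum_negf)
  also have "(\<Sum>i\<in>UNIV. \<integral>x. w x \<bullet> partials [i, i] w x \<partial>lebesgue) = (\<integral>x. w x \<bullet> laplacian w x \<partial>lebesgue)"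
    unfolding laplacian_def inner_sum_right by (intro Bochner_Integration.integral_sum[symmetric] int2)
  finally show "(\<integral>x. (grad_length w x)\<^sup>2 \<partial>lebesgue) = - (\<integral>x. w x \<bullet> laplacian w x \<partial>lebesgue)" .
qed

lemma ennreal_integral_le_nn_integral:
  assumes "integrable M f"
  shows "ennreal (\<integral>x. f x \<partial>M) \<le> (\<integral>\<^sup>+x. ennreal (f x) \<partial>M)"
proof -
  have int: "integrable M (\<lambda>x. max 0 (f x))" using assms by auto
  have "ennreal (\<integral>x. f x \<partial>M) \<le> ennreal (\<integral>x. max 0 (f x) \<partial>M)"
    using assms int by (intro ennreal_leI integral_mono) auto
  also have "\<dots> = (\<integral>\<^sup>+x. ennreal (max 0 (f x)) \<partial>M)"
    by (rule nn_integral_eq_integral[OF int, symmetric]) simp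
  also have "\<dots> = (\<integral>\<^sup>+x. ennreal (f x) \<partial>M)"
    by (intro nn_integral_cong) (auto simp: max_def ennreal_neg)
  finally show ?thesis .
qed

lemma Lp_norm_1: "Lp_norm 1 U f = (\<integral>\<^sup>+x. ennreal (norm (f x)) \<partial>lebesgue_on U)"
  by (simp add: Lp_norm_def ennpowr_1)

lemma Lp_norm_2_power2:
  "ennpowr (Lp_norm 2 U f) 2 = (\<integral>\<^sup>+x. ennreal ((norm (f x))\<^sup>2) \<partial>lebesgue_on U)"
  by (simp add: Lp_norm_powr)

text \<open>Green's identity as an inequality, because \<open>ennreal\<close> keeps only the
  positive part of the integrand on the right. In this form pointwise upper bounds can be
  inserted.\<close>

lemma grad_length_energy:
  fixes w :: "real^'n \<Rightarrow> 'a::euclidean_space"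
  assumes U: "U \<in> sets lebesgue" and w: "w \<in> test_functions U"
  shows "ennpowr (Lp_norm 2 U (grad_length w)) 2 \<le> (\<integral>\<^sup>+x. ennreal (- (w x \<bullet> laplacian w x)) \<partial>lebesgue_on U)"
proof -
  have "ennpowr (Lp_norm 2 U (grad_length w)) 2 \<le> (\<integral>\<^sup>+x. ennreal ((grad_length w x)\<^sup>2) \<partial>lebesgue)"
  proof -
    have "Lp_norm 2 U (grad_length w) \<le> Lp_norm 2 UNIV (grad_length w)"
      using U by (intro Lp_norm_subset) auto
    then have "ennpowr (Lp_norm 2 U (grad_length w)) 2 \<le> ennpowr (Lp_norm 2 UNIV (grad_length w)) 2"
      by (intro ennpowr_mono) auto
    then show ?thesis unfolding Lp_norm_2_power2 by (simp add: lebesgue_on_UNIV_eq)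
  qed
  also have "\<dots> = ennreal (\<integral>x. - (w x \<bullet> laplacian w x) \<partial>lebesgue)"
    using Green_identity[OF w] by (simp add: nn_integral_eq_integral)
  also have "\<dots> \<le> (\<integral>\<^sup>+x. ennreal (- (w x \<bullet> laplacian w x)) \<partial>lebesgue)"
    using inner_laplacian_integrable[OF w] by (intro ennreal_integral_le_nn_integral) simp
  also have "\<dots> = (\<integral>\<^sup>+x. ennreal (- (w x \<bullet> laplacian w x)) * indicator U x \<partial>lebesgue)"
    using test_functions_outside[OF w] by (intro nn_integral_cong) (auto simp: indicator_def)
  also have "\<dots> = (\<integral>\<^sup>+x. ennreal (- (w x \<bullet> laplacian w x)) \<partial>lebesgue_on U)"
    using U by (simp add: nn_integral_restrict_space)
  finally show ?thesis .
qed

lemma laplacian_measurable: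
  fixes w :: "real^'n \<Rightarrow> 'a::euclidean_space"
  assumes "smooth w"
  shows "laplacian w \<in> borel_measurable lebesgue"
  unfolding laplacian_def[abs_def]
  by (intro borel_measurable_sum smooth_measurable smooth_partials assms)

text \<open>With X and L the norms of gradient and Laplacian, energy and Holder give X^2 \<le> s X
  L, hence X \<le> s L. A second use of the Sobolev inequality accounts for the square of s.\<close>

lemma sobolev_laplacian:
  fixes w :: "real^'n \<Rightarrow> 'a::euclidean_space"
  assumes U: "U \<in> sets lebesgue" and w: "w \<in> test_functions U"
    and pq: "0 < p" "0 < q" "1 / p + 1 / q = 1" and s: "0 \<le> s"
    and sob: "Lp_norm q U w \<le> ennreal s * Lp_norm 2 U (grad_length w)"
  shows "Lp_norm q U w \<le> ennreal (s\<^sup>2) * Lp_norm p U (laplacian w)"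
proof -
  note sm = test_functions_smooth[OF w]
  have m: "w \<in> borel_measurable (lebesgue_on U)" "laplacian w \<in> borel_measurable (lebesgue_on U)"
    by (intro borel_measurable_lebesgue_onI smooth_measurable laplacian_measurable sm)+
  obtain X where X: "Lp_norm 2 U (grad_length w) = ennreal X" "0 \<le> X"
    using grad_length_Lp_finite[OF _ w U, of 2] by (cases "Lp_norm 2 U (grad_length w)") auto
  show ?thesis
  proof (cases "Lp_norm p U (laplacian w)")
    case (real L)
    have "ennreal (X\<^sup>2) = ennpowr (ennreal X) 2" using X by (simp add: ennpowr_ennreal)
    also have "\<dots> \<le> (\<integral>\<^sup>+x. ennreal (- (w x \<bullet> laplacian w x)) \<partial>lebesgue_on U)"
      using grad_length_energy[OF U w] X by simp
    also have "\<dots> \<le> (\<integral>\<^sup>+x. ennreal (norm (w x \<bullet> laplacian w x)) \<partial>lebesgue_on U)"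
      by (intro nn_integral_mono ennreal_leI) simp
    also have "\<dots> = Lp_norm 1 U (\<lambda>x. w x \<bullet> laplacian w x)" by (simp add: Lp_norm_1)
    also have "\<dots> \<le> Lp_norm q U w * Lp_norm p U (laplacian w)"
      using pq by (intro Lp_norm_Holder m AE_I2) (auto simp: Cauchy_Schwarz_ineq2)
    also have "\<dots> \<le> (ennreal s * ennreal X) * ennreal L"
      using sob X real by (intro mult_mono) auto
    also have "\<dots> = ennreal (s * X * L)" using s X real by (simp add: ennreal_mult)
    finally have "X\<^sup>2 \<le> s * X * L" using s X real by (subst (asm) ennreal_le_iff) auto
    then have "X \<le> s * L" using X s real by (cases "X = 0") (auto simp: power2_eq_square mult_ac)
    have "Lp_norm q U w \<le> ennreal s * ennreal X" using sob X by simp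
    also have "\<dots> \<le> ennreal s * ennreal (s * L)" using \<open>X \<le> s * L\<close> by (intro mult_left_mono ennreal_leI) auto
    also have "\<dots> = ennreal (s\<^sup>2) * ennreal L" using s real by (simp add: power2_eq_square mult_ac flip: ennreal_mult)
    finally show ?thesis using real by simp
  next
    case top
    show ?thesis
    \<comment> \<open>Since 0 times \<infinity> is 0, an infinite Laplacian norm makes the
      right-hand side infinite only for s > 0; otherwise \<open>sob\<close> already gives norm
      0.\<close>
    proof (cases "s = 0")
      case True
      then show ?thesis using sob by simp
    next
      case False
      then show ?thesis using top by (simp add: ennreal_mult_top)
    qed
  qed
qed

subsection \<open>The Caccioppoli inequality\<close>

lemma partials_product_pointwise:
  fixes \<psi> :: "real^'n \<Rightarrow> real" and V :: "real^'n \<Rightarrow> 'a::euclidean_space"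
  assumes "smooth \<psi>" "smooth V"
  shows "partials [i] (\<lambda>x. \<psi> x *\<^sub>R V x) x = \<psi> x *\<^sub>R partials [i] V x + partials [i] \<psi> x *\<^sub>R V x"
  using partials_scaleR[OF assms] by simp

lemma sum_mult_le_grad_length:
  fixes \<psi> :: "real^'n \<Rightarrow> real" and W :: "real^'n \<Rightarrow> 'a::real_normed_vector"
  shows "(\<Sum>i\<in>UNIV. \<bar>partials [i] \<psi> x\<bar> * norm (partials [i] W x)) \<le> grad_length \<psi> x * grad_length W x"
proof -
  have "(\<Sum>i\<in>UNIV. \<bar>partials [i] \<psi> x\<bar> * norm (partials [i] W x))
      \<le> sqrt ((\<Sum>i\<in>UNIV. \<bar>partials [i] \<psi> x\<bar>\<^sup>2) * (\<Sum>i\<in>UNIV. (norm (partials [i] W x))\<^sup>2))"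
    by (intro real_le_rsqrt Cauchy_Schwarz_ineq_sum)
  then show ?thesis by (simp add: grad_length_def real_sqrt_mult)
qed

text \<open>The Laplacian of W = \<psi> V is expanded and \<psi> times the gradient of V is
  rewritten as the gradient of W minus V times the gradient of \<psi>. Thus only the gradient of W
  survives, with a coefficient small enough to be absorbed.\<close>

lemma Caccioppoli_pointwise:
  fixes V :: "real^'n \<Rightarrow> 'a::{real_normed_field, euclidean_space}" and \<psi> :: "real^'n \<Rightarrow> real"
  assumes \<psi>: "smooth \<psi>" "0 \<le> \<psi> x" "\<psi> x \<le> 1" "grad_length \<psi> x \<le> G" "\<bar>laplacian \<psi> x\<bar> \<le> G\<^sup>2" and V: "smooth V"
  shows "- ((\<psi> x *\<^sub>R V x) \<bullet> laplacian (\<lambda>x. \<psi> x *\<^sub>R V x) x)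
    \<le> norm (\<psi> x *\<^sub>R V x) * norm (laplacian V x + q * V x) + norm q * norm (\<psi> x *\<^sub>R V x) * norm (\<psi> x *\<^sub>R V x)
      + (grad_length (\<lambda>x. \<psi> x *\<^sub>R V x) x)\<^sup>2 / 8 + 11 * G\<^sup>2 * (norm (V x))\<^sup>2"
proof -
  define W where "W = (\<lambda>x. \<psi> x *\<^sub>R V x)"
  define F where "F = laplacian V x + q * V x"
  define S where "S = (\<Sum>i\<in>UNIV. partials [i] \<psi> x * (V x \<bullet> partials [i] W x))"
  let ?g = "grad_length \<psi> x" and ?gW = "grad_length W x" and ?v = "norm (V x)"
  have g0: "0 \<le> ?g" by (rule grad_length_nonneg)
  have dW: "\<psi> x *\<^sub>R partials [i] V x = partials [i] W x - partials [i] \<psi> x *\<^sub>R V x" for i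
    unfolding W_def partials_product_pointwise[OF \<psi>(1) V] by simp
  have "W x \<bullet> (\<Sum>i\<in>UNIV. partials [i] \<psi> x *\<^sub>R partials [i] V x)
      = (\<Sum>i\<in>UNIV. partials [i] \<psi> x * (V x \<bullet> (\<psi> x *\<^sub>R partials [i] V x)))"
    by (simp add: W_def inner_sum_right sum_distrib_left mult_ac)
  also have "\<dots> = S - ?g\<^sup>2 * ?v\<^sup>2"
    unfolding dW grad_length_power2 S_def
    by (simp add: inner_diff_right algebra_simps sum_subtractf power2_norm_eq_inner[symmetric] sum_distrib_left)
       (simp add: power2_eq_square mult_ac sum_distrib_left)
  finally have 1: "W x \<bullet> (\<Sum>i\<in>UNIV. partials [i] \<psi> x *\<^sub>R partials [i] V x) = S - ?g\<^sup>2 * ?v\<^sup>2" .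
  have 2: "W x \<bullet> (\<psi> x *\<^sub>R laplacian V x) = \<psi> x * (W x \<bullet> F) - W x \<bullet> (q * W x)"
    unfolding F_def by (simp add: W_def algebra_simps inner_add_right)
  have "W x \<bullet> laplacian W x = \<psi> x * (W x \<bullet> F) - W x \<bullet> (q * W x) + 2 * (S - ?g\<^sup>2 * ?v\<^sup>2) + W x \<bullet> (laplacian \<psi> x *\<^sub>R V x)"
    using laplacian_scaleR[OF \<psi>(1) V, of x] unfolding W_def[symmetric] by (simp add: inner_add_right 1 2[unfolded inner_scaleR_right])
  then have eq: "- (W x \<bullet> laplacian W x) = - (\<psi> x * (W x \<bullet> F)) + W x \<bullet> (q * W x) - 2 * S + 2 * (?g\<^sup>2 * ?v\<^sup>2) - \<psi> x * laplacian \<psi> x * ?v\<^sup>2"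
    by (simp add: W_def power2_norm_eq_inner mult_ac)
  have b1: "- (\<psi> x * (W x \<bullet> F)) \<le> norm (W x) * norm F"
  proof -
    have "\<bar>\<psi> x * (W x \<bullet> F)\<bar> \<le> 1 * (norm (W x) * norm F)"
      unfolding abs_mult using \<psi>(2,3) by (intro mult_mono Cauchy_Schwarz_ineq2) auto
    then show ?thesis by linarith
  qed
  have b2: "W x \<bullet> (q * W x) \<le> norm q * norm (W x) * norm (W x)"
    using norm_cauchy_schwarz[of "W x" "q * W x"] by (simp add: norm_mult mult_ac)
  \<comment> \<open>Young's inequality in the form 2ab \<le> a^2/8 + 8b^2; the weight 1/8 is chosen
    for the absorption in \<open>Caccioppoli\<close>.\<close>
  have b3: "- 2 * S \<le> ?gW\<^sup>2 / 8 + 8 * (G\<^sup>2 * ?v\<^sup>2)"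
  proof -
    have "\<bar>S\<bar> \<le> (\<Sum>i\<in>UNIV. \<bar>partials [i] \<psi> x * (V x \<bullet> partials [i] W x)\<bar>)"
      unfolding S_def by (rule sum_abs)
    also have "\<dots> \<le> (\<Sum>i\<in>UNIV. ?v * (\<bar>partials [i] \<psi> x\<bar> * norm (partials [i] W x)))"
    proof (rule sum_mono)
      fix i
      have "\<bar>partials [i] \<psi> x\<bar> * \<bar>V x \<bullet> partials [i] W x\<bar> \<le> \<bar>partials [i] \<psi> x\<bar> * (?v * norm (partials [i] W x))"
        by (intro mult_left_mono Cauchy_Schwarz_ineq2) auto
      then show "\<bar>partials [i] \<psi> x * (V x \<bullet> partials [i] W x)\<bar> \<le> ?v * (\<bar>partials [i] \<psi> x\<bar> * norm (partials [i] W x))"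
        by (simp add: abs_mult mult_ac)
    qed
    also have "\<dots> \<le> ?v * (?g * ?gW)"
      unfolding sum_distrib_left[symmetric] by (intro mult_left_mono sum_mult_le_grad_length) auto
    also have "\<dots> \<le> ?v * (G * ?gW)"
      using \<psi>(4) grad_length_nonneg[of W x] by (intro mult_left_mono mult_right_mono) auto
    finally have "\<bar>S\<bar> \<le> (G * ?v) * ?gW" by (simp add: mult_ac)
    moreover have "2 * ((G * ?v) * ?gW) \<le> ?gW\<^sup>2 / 8 + 8 * (G * ?v)\<^sup>2"
      using zero_le_power2[of "?gW - 8 * (G * ?v)"] by (simp add: power2_diff power_mult_distrib mult_ac)
    ultimately show ?thesis by (simp add: power_mult_distrib)
  qed
  have b4: "2 * (?g\<^sup>2 * ?v\<^sup>2) \<le> 2 * (G\<^sup>2 * ?v\<^sup>2)"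
    using \<psi>(4) g0 by (intro mult_left_mono mult_right_mono power_mono) auto
  have b5: "- (\<psi> x * laplacian \<psi> x * ?v\<^sup>2) \<le> G\<^sup>2 * ?v\<^sup>2"
  proof -
    have "\<bar>\<psi> x * laplacian \<psi> x\<bar> \<le> 1 * G\<^sup>2"
      unfolding abs_mult using \<psi>(2,3,5) by (intro mult_mono) auto
    then have "- (\<psi> x * laplacian \<psi> x) \<le> G\<^sup>2" by linarith
    then have "- (\<psi> x * laplacian \<psi> x) * ?v\<^sup>2 \<le> G\<^sup>2 * ?v\<^sup>2" by (intro mult_right_mono) auto
    then show ?thesis by simp
  qed
  \<comment> \<open>11 = 8 + 2 + 1 collects the constants of \<open>b3\<close>, \<open>b4\<close>
    and \<open>b5\<close>.\<close>
  have "- (W x \<bullet> laplacian W x) \<le> norm (W x) * norm F + norm q * norm (W x) * norm (W x) + ?gW\<^sup>2 / 8 + 11 * (G\<^sup>2 * ?v\<^sup>2)"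
    unfolding eq using b1 b2 b3 b4 b5 by linarith
  then show ?thesis unfolding W_def F_def by simp
qed

lemma Lp_cballD:
  assumes "q \<in> Lp_cball r U c"
  shows "q \<in> borel_measurable (lebesgue_on U)" "Lp_norm r U q \<le> ennreal c"
  using assms by (auto simp: Lp_cball_def Lp_space_def)

text \<open>For r = n/2 this shows why the p'-norm of a function governs its potential term in the
  p-norm.\<close>

lemma Lp_norm_potential:
  fixes f :: "real^'n \<Rightarrow> 'a::{real_normed_field, euclidean_space}"
  assumes q: "q \<in> Lp_cball r U \<theta>" and f: "f \<in> borel_measurable (lebesgue_on U)"
    and ex: "0 < p" "0 < p'" "0 < r" "1 / p = 1 / r + 1 / p'"
  shows "Lp_norm p U (\<lambda>x. q x * f x) \<le> ennreal \<theta> * Lp_norm p' U f"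
proof -
  have "Lp_norm p U (\<lambda>x. q x * f x) \<le> Lp_norm r U q * Lp_norm p' U f"
    using ex Lp_cballD(1)[OF q] f by (intro Lp_norm_Holder AE_I2) (auto simp: norm_mult)
  also have "\<dots> \<le> ennreal \<theta> * Lp_norm p' U f"
    by (intro mult_right_mono Lp_cballD(2)[OF q]) auto
  finally show ?thesis .
qed

text \<open>The pointwise bound is integrated and the multiples of X^2 are absorbed, X being the
  norm of the gradient of W: the potential contributes 1/2, the cross term 1/8 and the source term
  1/8, so a quarter of X^2 is left.\<close>

lemma Caccioppoli:
  fixes V q :: "real^'n \<Rightarrow> 'a::{real_normed_field, euclidean_space}" and \<psi> :: "real^'n \<Rightarrow> real"
  assumes B: "B \<in> sets lebesgue" and S: "S \<in> sets lebesgue" "S \<subseteq> B"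
    and V: "V \<in> test_functions B" and \<psi>: "\<psi> \<in> test_functions S" "\<And>x. 0 \<le> \<psi> x" "\<And>x. \<psi> x \<le> 1"
    and G: "\<And>x. grad_length \<psi> x \<le> G" "\<And>x. \<bar>laplacian \<psi> x\<bar> \<le> G\<^sup>2"
    and q: "q \<in> Lp_cball r B \<theta>" and ex: "1 \<le> p" "0 < p'" "0 < r" "1 / p = 1 / r + 1 / p'" "1 / p + 1 / p' = 1"
    and s: "0 \<le> s" "0 \<le> \<theta>" "\<theta> * s\<^sup>2 \<le> 1 / 2"
    and sob: "\<And>w :: real^'n \<Rightarrow> 'a. w \<in> test_functions B \<Longrightarrow> Lp_norm p' B w \<le> ennreal s * Lp_norm 2 B (grad_length w)"
  shows "Lp_norm 2 B (grad_length (\<lambda>x. \<psi> x *\<^sub>R V x))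
    \<le> ennreal (3 * s) * Lp_norm p S (\<lambda>x. laplacian V x + q x * V x) + ennreal (7 * G) * Lp_norm 2 S V"
proof -
  define W where "W = (\<lambda>x. \<psi> x *\<^sub>R V x)"
  define F where "F = (\<lambda>x. laplacian V x + q x * V x)"
  \<comment> \<open>Cutting F and V down to S lets every norm be taken over B while recording only
    values on S.\<close>
  define FS where "FS = (\<lambda>x. indicator S x *\<^sub>R F x)"
  define VS where "VS = (\<lambda>x. indicator S x *\<^sub>R V x)"
  note smV = test_functions_smooth[OF V] and sm\<psi> = test_functions_smooth[OF \<psi>(1)]
  have p0: "0 < p" using ex by simp
  have G0: "0 \<le> G" using G(1)[of 0] grad_length_nonneg[of \<psi> 0] by linarith
  have W: "W \<in> test_functions B" unfolding W_def by (rule test_functions_scaleR_right[OF sm\<psi> V])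
  have WS: "W x = 0" if "x \<notin> S" for x using test_functions_outside[OF \<psi>(1) that] by (simp add: W_def)
  have m: "W \<in> borel_measurable (lebesgue_on B)" "V \<in> borel_measurable (lebesgue_on B)"
    "laplacian V \<in> borel_measurable (lebesgue_on B)" "grad_length W \<in> borel_measurable (lebesgue_on B)"
    by (intro borel_measurable_lebesgue_onI smooth_measurable laplacian_measurable grad_length_measurable
        test_functions_smooth[OF W] smV)+
  have mi: "indicator S \<in> borel_measurable (lebesgue_on B)"
    using S by (intro borel_measurable_lebesgue_onI borel_measurable_indicator)
  note mq = Lp_cballD(1)[OF q]
  have mF: "F \<in> borel_measurable (lebesgue_on B)" "FS \<in> borel_measurable (lebesgue_on B)" "VS \<in> borel_measurable (lebesgue_on B)"
    unfolding F_def FS_def VS_def using m mq mi by (auto intro!: borel_measurable_add borel_measurable_times borel_measurable_scaleR)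
  have nFS: "Lp_norm p B FS = Lp_norm p S F" and nVS: "Lp_norm 2 B VS = Lp_norm 2 S V"
    unfolding FS_def VS_def using S B p0 by (simp_all add: Lp_norm_indicator Int_absorb2)
  obtain X where X: "Lp_norm 2 B (grad_length W) = ennreal X" "0 \<le> X"
    using grad_length_Lp_finite[OF _ W B, of 2] by (cases "Lp_norm 2 B (grad_length W)") auto
  have "Lp_norm 2 S V < top"
    using test_functions_Lp_space[OF _ V S(1), of 2] by (simp add: Lp_space_def)
  then obtain b where b: "Lp_norm 2 S V = ennreal b" "0 \<le> b"
    by (cases "Lp_norm 2 S V") auto
  have sobW: "Lp_norm p' B W \<le> ennreal (s * X)"
    using sob[OF W] X s by (simp add: ennreal_mult)
  show ?thesis
  proof (cases "Lp_norm p S F")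
    case (real a)
    have "ennreal (X\<^sup>2) = ennpowr (ennreal X) 2" using X by (simp add: ennpowr_ennreal)
    also have "\<dots> \<le> (\<integral>\<^sup>+x. ennreal (- (W x \<bullet> laplacian W x)) \<partial>lebesgue_on B)"
      using grad_length_energy[OF B W] X by simp
    also have "\<dots> \<le> (\<integral>\<^sup>+x. (ennreal (norm (norm (W x) * norm (FS x))) + ennreal (norm (norm (q x * W x) * norm (W x))))
        + (ennreal (1 / 8) * ennreal ((norm (grad_length W x))\<^sup>2) + ennreal (11 * G\<^sup>2) * ennreal ((norm (VS x))\<^sup>2)) \<partial>lebesgue_on B)"
    proof (rule nn_integral_mono)
      fix x
      have "- (W x \<bullet> laplacian W x) \<le> (norm (W x) * norm (FS x) + norm (q x * W x) * norm (W x))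
          + ((1 / 8) * (grad_length W x)\<^sup>2 + 11 * G\<^sup>2 * (norm (VS x))\<^sup>2)"
      proof (cases "x \<in> S")
        case True
        then show ?thesis
          using Caccioppoli_pointwise[OF sm\<psi> \<psi>(2,3) G smV, of x "q x"]
          by (simp add: W_def F_def FS_def VS_def norm_mult mult_ac)
      qed (use WS in simp)
      then show "ennreal (- (W x \<bullet> laplacian W x)) \<le> (ennreal (norm (norm (W x) * norm (FS x))) + ennreal (norm (norm (q x * W x) * norm (W x))))
        + (ennreal (1 / 8) * ennreal ((norm (grad_length W x))\<^sup>2) + ennreal (11 * G\<^sup>2) * ennreal ((norm (VS x))\<^sup>2))"
        by (simp add: ennreal_leI flip: ennreal_mult ennreal_plus)
    qed
    also have "\<dots> = (Lp_norm 1 B (\<lambda>x. norm (W x) * norm (FS x)) + Lp_norm 1 B (\<lambda>x. norm (q x * W x) * norm (W x)))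
        + (ennreal (1 / 8) * ennpowr (Lp_norm 2 B (grad_length W)) 2 + ennreal (11 * G\<^sup>2) * ennpowr (Lp_norm 2 B VS) 2)"
      unfolding Lp_norm_1 Lp_norm_2_power2 using m mF mq
      by (simp add: nn_integral_add nn_integral_cmult)
    also have "\<dots> \<le> (ennreal (s * X) * ennreal a + (ennreal \<theta> * ennreal (s * X)) * ennreal (s * X))
        + (ennreal (1 / 8) * ennreal (X\<^sup>2) + ennreal (11 * G\<^sup>2) * ennreal (b\<^sup>2))"
    proof (intro add_mono)
      have "Lp_norm 1 B (\<lambda>x. norm (W x) * norm (FS x)) \<le> Lp_norm p' B W * Lp_norm p B FS"
        using ex p0 m mF by (intro Lp_norm_Holder AE_I2) auto
      also have "\<dots> \<le> ennreal (s * X) * ennreal a"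
        using sobW real nFS by (intro mult_mono) auto
      finally show "Lp_norm 1 B (\<lambda>x. norm (W x) * norm (FS x)) \<le> ennreal (s * X) * ennreal a" .
      have "Lp_norm 1 B (\<lambda>x. norm (q x * W x) * norm (W x)) \<le> Lp_norm p B (\<lambda>x. q x * W x) * Lp_norm p' B W"
        using ex p0 m mq by (intro Lp_norm_Holder AE_I2) auto
      also have "\<dots> \<le> (ennreal \<theta> * ennreal (s * X)) * ennreal (s * X)"
        using sobW order_trans[OF Lp_norm_potential[OF q m(1) p0 ex(2-4)] mult_left_mono[OF sobW]]
        by (intro mult_mono) auto
      finally show "Lp_norm 1 B (\<lambda>x. norm (q x * W x) * norm (W x)) \<le> (ennreal \<theta> * ennreal (s * X)) * ennreal (s * X)" .
    qed (use X b nVS in \<open>simp_all add: ennpowr_ennreal\<close>)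
    also have "\<dots> = ennreal ((s * X * a + \<theta> * (s * X) * (s * X)) + (1 / 8 * X\<^sup>2 + 11 * G\<^sup>2 * b\<^sup>2))"
      using s X real b G0 by (simp flip: ennreal_mult ennreal_plus)
    finally have "X\<^sup>2 \<le> (s * X * a + \<theta> * (s * X) * (s * X)) + (1 / 8 * X\<^sup>2 + 11 * G\<^sup>2 * b\<^sup>2)"
      using s X real b G0 by (subst (asm) ennreal_le_iff) auto
    \<comment> \<open>This is where smallness of the potential is used.\<close>
    moreover have "\<theta> * (s * X) * (s * X) \<le> 1 / 2 * X\<^sup>2"
      using mult_right_mono[OF s(3), of "X\<^sup>2"] by (simp add: power2_eq_square mult_ac)
    moreover have "s * X * a \<le> 1 / 8 * X\<^sup>2 + 2 * (s * a)\<^sup>2"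
      using zero_le_power2[of "X - 4 * (s * a)"] by (simp add: power2_diff power_mult_distrib mult_ac)
    \<comment> \<open>The constants 2 and 11 are multiplied by 4. Next 8 \<le> 3^2 and 44 \<le> 7^2
      allow the square root to be taken.\<close>
    ultimately have "X\<^sup>2 \<le> 8 * (s * a)\<^sup>2 + 44 * (G * b)\<^sup>2"
      by (simp add: power_mult_distrib)
    also have "\<dots> \<le> (3 * (s * a) + 7 * (G * b))\<^sup>2"
      using s real b G0 by (simp add: power2_sum power_mult_distrib)
    finally have "X \<le> 3 * (s * a) + 7 * (G * b)"
      by (rule power2_le_imp_le) (use s real b G0 in auto)
    then have "ennreal X \<le> ennreal (3 * s) * ennreal a + ennreal (7 * G) * ennreal b"
      using s real b G0 by (simp add: ennreal_leI mult_ac flip: ennreal_mult ennreal_plus)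
    then show ?thesis using X b real unfolding W_def F_def by simp
  next
    case top
    show ?thesis
    \<comment> \<open>For s = 0 the infinite norm is multiplied by 0 and gives no bound. In that
      case the Sobolev inequality forces W = 0 almost everywhere, and the energy bound makes its
      gradient vanish.\<close>
    proof (cases "s = 0")
      case True
      then have "Lp_norm p' B W = 0" using sobW by simp
      then have "AE x in lebesgue_on B. W x = 0" by (rule Lp_norm_eq_0[OF ex(2) m(1)])
      then have "AE x in lebesgue_on B. - (W x \<bullet> laplacian W x) = 0" by eventually_elim simp
      then have "(\<integral>\<^sup>+x. ennreal (- (W x \<bullet> laplacian W x)) \<partial>lebesgue_on B) = (\<integral>\<^sup>+x. 0 \<partial>lebesgue_on B)"
        by (intro nn_integral_cong_AE) (auto elim: eventually_mono)
      then have "ennpowr (ennreal X) 2 \<le> 0" using grad_length_energy[OF B W] X by simp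
      then have "X = 0" using X by (simp add: ennpowr_ennreal)
      then show ?thesis using X unfolding W_def by simp
    next
      case False
      then show ?thesis using top s unfolding F_def by (simp add: ennreal_mult_top)
    qed
  qed
qed

subsection \<open>Cut-off functions\<close>

lemma partials_cong_open:
  fixes f g :: "real^'n \<Rightarrow> 'b::real_normed_vector"
  assumes "smooth f" "open S" "\<And>x. x \<in> S \<Longrightarrow> f x = g x" "x \<in> S"
  shows "partials is f x = partials is g x"
  using assms(4)
proof (induction "is" arbitrary: x)
  case (Cons i "is")
  have "(partials is f has_derivative frechet_derivative (partials is f) (at x)) (at x)"
    using assms(1) unfolding smooth_def frechet_derivative_works by blast
  then have "(partials is g has_derivative frechet_derivative (partials is f) (at x)) (at x)"
    by (rule has_derivative_transform_within_open[OF _ assms(2) Cons.prems]) (rule Cons.IH)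
  then show ?case by (simp add: partials.simps(2) flip: frechet_derivative_at)
qed (use assms in auto)

lemma partials_const: "partials (i # is) (\<lambda>x. c) = (\<lambda>x. 0)"
proof (induction "is" arbitrary: i)
  case Nil
  show ?case by (rule ext) (rule partials_single[OF has_derivative_const])
next
  case (Cons j "is")
  have "partials (i # j # is) (\<lambda>x. c) = partials [i] (partials (j # is) (\<lambda>x. c))"
    using partials_append[of "[i]" "j # is"] by simp
  also have "\<dots> = (\<lambda>x. 0)"
    unfolding Cons by (rule ext) (rule partials_single[OF has_derivative_const])
  finally show ?case .
qed

lemma partials_const_minus:
  fixes f :: "real^'n \<Rightarrow> 'b::real_normed_vector"
  assumes "smooth f"
  shows "partials [i] (\<lambda>x. c - f x) = (\<lambda>x. - partials [i] f x)"
proof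
  fix x
  have "(f has_derivative frechet_derivative f (at x)) (at x)"
    using smooth_differentiable[OF assms] frechet_derivative_works by blast
  then have "((\<lambda>x. c - f x) has_derivative (\<lambda>h. 0 - frechet_derivative f (at x) h)) (at x)"
    by (intro has_derivative_diff has_derivative_const)
  from partials_single[OF this] show "partials [i] (\<lambda>x. c - f x) x = - partials [i] f x"
    by (simp add: frechet_derivative_axis)
qed

lemma grad_length_const_minus: "smooth f \<Longrightarrow> grad_length (\<lambda>x. c - f x) x = grad_length f x"
  unfolding grad_length_def by (simp add: partials_const_minus)

lemma laplacian_const_minus:
  fixes f :: "real^'n \<Rightarrow> 'b::real_normed_vector"
  assumes "smooth f"
  shows "laplacian (\<lambda>x. c - f x) x = - laplacian f x"
proof -
  have "partials [i, i] (\<lambda>x. c - f x) x = - partials [i, i] f x" for i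
    using partials_const_minus[OF smooth_partials[OF assms, of "[i]"], of i 0]
    by (simp add: partials_pair partials_const_minus[OF assms])
  then show ?thesis by (simp add: laplacian_def sum_negf)
qed

definition dilate :: "real \<Rightarrow> (real^'n \<Rightarrow> 'b) \<Rightarrow> real^'n \<Rightarrow> 'b" where
  "dilate h f x = f ((1 / h) *\<^sub>R x)"

lemma smooth_dilate: "smooth f \<Longrightarrow> smooth (dilate h f)"
  for f :: "real^'n \<Rightarrow> 'b::real_normed_vector"
  using smooth_affine[of f 0 "1 / h"] by (simp add: dilate_def[abs_def])

lemma partials_dilate:
  fixes f :: "real^'n \<Rightarrow> 'b::real_normed_vector"
  assumes "smooth f"
  shows "partials [i] (dilate h f) x = (1 / h) *\<^sub>R partials [i] f ((1 / h) *\<^sub>R x)"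
    "partials [i, i] (dilate h f) x = (1 / h)\<^sup>2 *\<^sub>R partials [i, i] f ((1 / h) *\<^sub>R x)"
proof -
  have 1: "partials [i] (dilate h f) = (\<lambda>x. (1 / h) *\<^sub>R partials [i] f ((1 / h) *\<^sub>R x))"
    using partials_affine[OF smooth_differentiable[OF assms], of i 0 "1 / h"] by (simp add: dilate_def[abs_def])
  then show "partials [i] (dilate h f) x = (1 / h) *\<^sub>R partials [i] f ((1 / h) *\<^sub>R x)" by simp
  have "partials [i, i] (dilate h f) = partials [i] (\<lambda>x. (1 / h) *\<^sub>R partials [i] f (0 + (1 / h) *\<^sub>R x))"
    by (simp add: partials_pair 1)
  also have "\<dots> = (\<lambda>x. (1 / h) *\<^sub>R partials [i] (\<lambda>x. partials [i] f (0 + (1 / h) *\<^sub>R x)) x)"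
    by (intro bounded_linear.partials_linear[OF bounded_linear_scaleR_right] smooth_differentiable smooth_affine smooth_partials assms)
  also have "\<dots> = (\<lambda>x. (1 / h) *\<^sub>R (1 / h) *\<^sub>R partials [i] (partials [i] f) (0 + (1 / h) *\<^sub>R x))"
    by (subst partials_affine[OF smooth_differentiable[OF smooth_partials[OF assms]]]) simp
  finally show "partials [i, i] (dilate h f) x = (1 / h)\<^sup>2 *\<^sub>R partials [i, i] f ((1 / h) *\<^sub>R x)"
    by (simp add: partials_pair power2_eq_square)
qed

lemma grad_length_dilate:
  fixes f :: "real^'n \<Rightarrow> 'b::real_normed_vector"
  assumes "smooth f" "0 < h"
  shows "grad_length (dilate h f) x = (1 / h) * grad_length f ((1 / h) *\<^sub>R x)"
proof -
  have "(\<Sum>i\<in>UNIV. (norm (partials [i] (dilate h f) x))\<^sup>2)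
      = (1 / h)\<^sup>2 * (\<Sum>i\<in>UNIV. (norm (partials [i] f ((1 / h) *\<^sub>R x)))\<^sup>2)"
    unfolding partials_dilate[OF assms(1)] sum_distrib_left by (simp only: norm_scaleR power_mult_distrib power2_abs)
  then show ?thesis using assms(2) by (simp add: grad_length_def real_sqrt_mult)
qed

lemma laplacian_dilate:
  fixes f :: "real^'n \<Rightarrow> 'b::real_normed_vector"
  assumes "smooth f"
  shows "laplacian (dilate h f) x = (1 / h)\<^sup>2 *\<^sub>R laplacian f ((1 / h) *\<^sub>R x)"
  unfolding laplacian_def partials_dilate[OF assms] scaleR_sum_right ..

lemma test_functions_dilate:
  fixes f :: "real^'n \<Rightarrow> 'b::real_normed_vector"
  assumes f: "f \<in> test_functions (ball 0 1)" and h: "0 < h"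
  shows "dilate h f \<in> test_functions (ball 0 h)"
proof -
  obtain K where K: "compact K" "K \<subseteq> ball 0 1" "\<And>x. x \<notin> K \<Longrightarrow> f x = 0"
    using f unfolding test_functions_iff by blast
  let ?K = "(\<lambda>x. h *\<^sub>R x) ` K"
  have "compact ?K" using K(1) by (rule compact_scaling)
  moreover have "?K \<subseteq> ball 0 h"
    using K(2) h by (auto simp: mult_less_cancel_left2)
  moreover have "dilate h f x = 0" if "x \<notin> ?K" for x
  proof -
    have "(1 / h) *\<^sub>R x \<notin> K"
    proof
      assume "(1 / h) *\<^sub>R x \<in> K"
      then have "h *\<^sub>R ((1 / h) *\<^sub>R x) \<in> ?K" by (rule imageI)
      then show False using that h by simp
    qed
    then show ?thesis using K(3) by (simp add: dilate_def)
  qed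
  ultimately show ?thesis
    unfolding test_functions_iff using smooth_dilate[OF test_functions_smooth[OF f]] by blast
qed

text \<open>One K serves both orders: dilation by h turns the bounds into \<open>K / h\<close> and
  \<open>(K / h)\<^sup>2\<close>, the shape expected of G in \<open>Caccioppoli\<close>. K \<ge> 1
  lets the square dominate the bound on the Laplacian.\<close>

lemma cutoff_bounds:
  fixes \<phi> :: "real^'n \<Rightarrow> real"
  assumes "\<phi> \<in> test_functions U"
  obtains K where "1 \<le> K" "\<And>x. grad_length \<phi> x \<le> K" "\<And>x. \<bar>laplacian \<phi> x\<bar> \<le> K\<^sup>2"
proof -
  have "\<exists>C. \<forall>x. norm (partials is \<phi> x) \<le> C" for "is"
    by (rule test_functions_bounded[OF test_functions_partials[OF assms, of "is"]]) blast
  then obtain C where C: "\<And>is x. norm (partials is \<phi> x) \<le> C is" by metis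
  have C0: "0 \<le> C is" for "is" using C[of "is" 0] norm_ge_zero order_trans by blast
  let ?A = "\<Sum>i\<in>UNIV. C [i]" and ?L = "\<Sum>i\<in>UNIV. C [i, i]"
  have A0: "0 \<le> ?A" and L0: "0 \<le> ?L" by (auto intro: sum_nonneg C0)
  have g: "grad_length \<phi> x \<le> ?A" for x
  proof -
    have "grad_length \<phi> x = L2_set (\<lambda>i. norm (partials [i] \<phi> x)) UNIV"
      by (simp add: grad_length_def L2_set_def)
    also have "\<dots> \<le> (\<Sum>i\<in>UNIV. norm (partials [i] \<phi> x))" by (rule L2_set_le_sum) auto
    also have "\<dots> \<le> ?A" by (intro sum_mono C)
    finally show ?thesis .
  qed
  have l: "\<bar>laplacian \<phi> x\<bar> \<le> ?L" for x
    unfolding laplacian_def using C[of _ x] by (intro order_trans[OF sum_abs] sum_mono) simp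
  let ?K = "1 + ?A + ?L"
  show thesis
  proof (rule that[of ?K])
    show "1 \<le> ?K" using A0 L0 by simp
    show "grad_length \<phi> x \<le> ?K" for x using g[of x] L0 by linarith
    have "?L \<le> ?K * 1" using A0 by simp
    also have "\<dots> \<le> ?K * ?K" using A0 L0 by (intro mult_left_mono) auto
    finally have "?L \<le> ?K\<^sup>2" by (simp only: power2_eq_square)
    then show "\<bar>laplacian \<phi> x\<bar> \<le> ?K\<^sup>2" for x using l[of x] by linarith
  qed
qed

text \<open>The L^n norm of the constant 1 on the unit ball; on a ball of radius r this norm is r
  times as large.\<close>

definition ball_const :: "'n itself \<Rightarrow> real" where
  "ball_const _ = unit_ball_vol (real CARD('n)) powr (1 / real CARD('n))"

lemma ball_const_pos: "0 < ball_const TYPE('n)"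
proof -
  have "0 < unit_ball_vol (real CARD('n))" by simp
  then show ?thesis unfolding ball_const_def powr_gt_zero by linarith
qed

text \<open>Holder against the constant 1 in L^n. It is used for the pairs (p, 2) and (2, p'), and
  the factor r is what balances the derivatives of the cut-off.\<close>

lemma Lp_norm_subset_ball:
  fixes f :: "real^'n \<Rightarrow> 'a::euclidean_space"
  assumes S: "S \<in> sets lebesgue" "S \<subseteq> ball 0 r" and r: "0 \<le> r" and f: "f \<in> borel_measurable (lebesgue_on S)"
    and ab: "0 < a" "0 < b" "1 / a = 1 / real CARD('n) + 1 / b"
  shows "Lp_norm a S f \<le> ennreal (ball_const TYPE('n) * r) * Lp_norm b S f"
proof -
  let ?n = "real CARD('n)"
  have n0: "0 < ?n" by simp
  have "(\<integral>\<^sup>+x. ennreal (norm (1 :: real) powr ?n) \<partial>lebesgue_on S) = emeasure lebesgue S"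
    using S(1) by (simp add: emeasure_restrict_space)
  also have "\<dots> \<le> emeasure lebesgue (ball (0 :: real^'n) r)"
    using S by (intro emeasure_mono) auto
  also have "\<dots> = ennreal (unit_ball_vol ?n * r ^ CARD('n))"
    using emeasure_ball[OF r, of "0 :: real^'n"] by simp
  also have "unit_ball_vol ?n * r ^ CARD('n) = (ball_const TYPE('n) * r) powr ?n"
    using r by (simp add: ball_const_def powr_mult powr_powr powr_realpow')
  finally have "Lp_norm ?n S (\<lambda>x. 1 :: real) \<le> ennreal (ball_const TYPE('n) * r)"
    using ball_const_pos[where 'n='n] r by (subst Lp_norm_le_iff) auto
  moreover have "Lp_norm a S f \<le> Lp_norm ?n S (\<lambda>x. 1 :: real) * Lp_norm b S f"
    using ab f by (intro Lp_norm_Holder) auto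
  ultimately show ?thesis by (meson mult_right_mono order_trans zero_le)
qed

lemma Lp_norm_le_scaled:
  assumes "0 < p" "f \<in> borel_measurable (lebesgue_on U)" "Lp_norm p U f \<le> ennreal a" "0 \<le> c"
  shows "Lp_norm p U (\<lambda>x. c *\<^sub>R f x) \<le> ennreal (c * a)"
  using assms mult_left_mono[OF assms(3), of "ennreal c"]
  by (simp add: Lp_norm_scaleR ennreal_mult')

lemma Lp_norm_triangle_le:
  assumes "1 \<le> p" "f \<in> borel_measurable (lebesgue_on U)" "g \<in> borel_measurable (lebesgue_on U)"
    "Lp_norm p U f \<le> ennreal a" "Lp_norm p U g \<le> ennreal b" "0 \<le> a" "0 \<le> b"
  shows "Lp_norm p U (\<lambda>x. f x + g x) \<le> ennreal (a + b)"
  using Lp_norm_triangle[OF assms(1-3)] add_mono[OF assms(4,5)] assms(6,7) by (auto intro: order_trans)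

subsection \<open>The estimate for test functions\<close>

text \<open>V will be a mollification of \<open>\<phi> u\<close>. The residual is kept as two norms,
  over the ball of radius 1/2 and over B, because in the limit they become the residuals of
  \<open>u\<close> and of \<open>\<phi> u\<close>.\<close>

lemma main_estimate:
  fixes V q :: "real^'n \<Rightarrow> 'a::{real_normed_field, euclidean_space}" and \<phi> :: "real^'n \<Rightarrow> real"
  defines "N \<equiv> real CARD('n)" and "\<omega> \<equiv> ball_const TYPE('n)" and "B \<equiv> ball (0::real^'n) 1"
  assumes \<phi>: "\<phi> \<in> test_functions (ball 0 1)" "\<And>x. 0 \<le> \<phi> x" "\<And>x. \<phi> x \<le> 1" "\<And>x. x \<in> ball 0 (1 / 2) \<Longrightarrow> \<phi> x = 1"
    and K: "1 \<le> K" "\<And>x. grad_length \<phi> x \<le> K" "\<And>x. \<bar>laplacian \<phi> x\<bar> \<le> K\<^sup>2"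
    and V: "V \<in> test_functions B" and q: "q \<in> Lp_cball (N / 2) B \<theta>"
    and ex: "1 \<le> p" "0 < p'" "1 / p = 1 / (N / 2) + 1 / p'" "1 / p + 1 / p' = 1" "1 / p = 1 / N + 1 / 2" "1 / 2 = 1 / N + 1 / p'"
    and s: "0 \<le> s" "0 \<le> \<theta>" "\<theta> * s\<^sup>2 \<le> 1 / 2"
    and sob: "\<And>w :: real^'n \<Rightarrow> 'a. w \<in> test_functions B \<Longrightarrow> Lp_norm p' B w \<le> ennreal s * Lp_norm 2 B (grad_length w)"
    and \<kappa>: "0 < \<kappa>" and \<tau>: "0 < \<tau>"
    and carleman: "\<And>u. u \<in> test_functions (B - {0}) \<Longrightarrow> Lp_norm p' B (\<lambda>x. norm x powr (- \<tau>) *\<^sub>R u x)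
                \<le> ennreal \<kappa> * Lp_norm p B (\<lambda>x. norm x powr (- \<tau>) *\<^sub>R (laplacian u x + q x * u x))"
    and \<eta>: "0 < \<eta>" "\<eta> < \<rho> / 4" and \<rho>: "\<rho> < 1 / 2"
  shows "Lp_norm 2 (ball 0 (\<rho> / 2)) V \<le> ennreal (1 + \<omega> * \<kappa> * (3 + 6 * K * \<omega> * s + 8 * K\<^sup>2 * \<omega>)) *
     (ennreal (\<eta> powr (- \<tau>)) * Lp_norm p (ball 0 (1 / 2)) (\<lambda>x. laplacian V x + q x * V x)
      + ennreal (2 powr (- (\<tau> + 1))) * Lp_norm p B (\<lambda>x. laplacian V x + q x * V x)
      + ennreal (\<eta> powr (- (\<tau> + 1))) * Lp_norm 2 (ball 0 (2 * \<eta>)) V)"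
proof -
  define F where "F = (\<lambda>x. laplacian V x + q x * V x)"
  define C where "C = 1 + \<omega> * \<kappa> * (3 + 6 * K * \<omega> * s + 8 * K\<^sup>2 * \<omega>)"
  have \<rho>0: "0 < \<rho>" using \<eta> by linarith
  have \<omega>: "0 < \<omega>" unfolding \<omega>_def by (rule ball_const_pos)
  have C: "0 < C" unfolding C_def using \<omega> \<kappa> s K(1) by (intro add_pos_nonneg) auto
  have p0: "0 < p" using ex by simp
  have N0: "0 < N" unfolding N_def by simp
  have B: "B \<in> sets lebesgue" unfolding B_def by simp
  have sb: "ball 0 r \<subseteq> B" if "r \<le> 1" for r using that unfolding B_def by auto
  note smV = test_functions_smooth[OF V] and sm\<phi> = test_functions_smooth[OF \<phi>(1)]
  have mV: "V \<in> borel_measurable lebesgue" and mL: "laplacian V \<in> borel_measurable lebesgue"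
    by (intro smooth_measurable laplacian_measurable smV)+
  have mF: "F \<in> borel_measurable (lebesgue_on B)"
    unfolding F_def using borel_measurable_lebesgue_onI[OF mV] borel_measurable_lebesgue_onI[OF mL] Lp_cballD(1)[OF q]
    by (intro borel_measurable_add borel_measurable_times)
  show ?thesis
  proof (cases "Lp_norm p B F")
    \<comment> \<open>The second term on the right is then infinite with a positive
      coefficient.\<close>
    case top
    then show ?thesis using C unfolding F_def C_def[symmetric] by (simp add: ennreal_mult_top)
  next
    case f2: (real f2)
    have "Lp_norm p (ball 0 (1 / 2)) F \<le> Lp_norm p B F"
      using p0 B sb[of "1 / 2"] by (intro Lp_norm_subset) auto
    then obtain f1 where f1: "Lp_norm p (ball 0 (1 / 2)) F = ennreal f1" "0 \<le> f1"
      using f2 by (cases "Lp_norm p (ball 0 (1 / 2)) F") (auto simp: top_unique)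
    have "Lp_norm 2 (ball 0 (2 * \<eta>)) V < top"
      using test_functions_Lp_space[OF _ V, of 2 "ball 0 (2 * \<eta>)"] by (simp add: Lp_space_def)
    then obtain b where b: "Lp_norm 2 (ball 0 (2 * \<eta>)) V = ennreal b" "0 \<le> b"
      by (cases "Lp_norm 2 (ball 0 (2 * \<eta>)) V") auto

    \<comment> \<open>\<psi> is 1 on the ball of radius \<eta>, which contains the commutator terms,
      and supported in the ball of radius 2\<eta>. W agrees with V on the smaller ball, so a bound
      on the gradient of W controls that of V there.\<close>
    define \<psi> where "\<psi> = dilate (2 * \<eta>) \<phi>"
    define W where "W = (\<lambda>x. \<psi> x *\<^sub>R V x)"
    have \<psi>: "\<psi> \<in> test_functions (ball 0 (2 * \<eta>))"
      unfolding \<psi>_def using \<eta> by (intro test_functions_dilate \<phi>) auto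
    note sm\<psi> = test_functions_smooth[OF \<psi>]
    have smW: "smooth W" unfolding W_def by (rule smooth_scaleR[OF sm\<psi> smV])
    define X where "X = 3 * s * f1 + 7 * (K / (2 * \<eta>)) * b"
    have X0: "0 \<le> X" unfolding X_def using s f1 b K(1) \<eta> by auto
    have nW: "Lp_norm 2 B (grad_length W) \<le> ennreal X"
    proof -
      have G: "grad_length \<psi> x \<le> K / (2 * \<eta>)" "\<bar>laplacian \<psi> x\<bar> \<le> (K / (2 * \<eta>))\<^sup>2" for x
      proof -
        show "grad_length \<psi> x \<le> K / (2 * \<eta>)"
          unfolding \<psi>_def using K(2) \<eta> by (subst grad_length_dilate[OF sm\<phi>]) (auto intro: divide_right_mono)
        have "(1 / (2 * \<eta>))\<^sup>2 * \<bar>laplacian \<phi> ((1 / (2 * \<eta>)) *\<^sub>R x)\<bar> \<le> (1 / (2 * \<eta>))\<^sup>2 * K\<^sup>2"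
          by (intro mult_left_mono K) auto
        then show "\<bar>laplacian \<psi> x\<bar> \<le> (K / (2 * \<eta>))\<^sup>2"
          unfolding \<psi>_def laplacian_dilate[OF sm\<phi>] by (simp add: abs_mult power_divide)
      qed
      have "Lp_norm 2 B (grad_length W)
          \<le> ennreal (3 * s) * Lp_norm p (ball 0 (2 * \<eta>)) F + ennreal (7 * (K / (2 * \<eta>))) * Lp_norm 2 (ball 0 (2 * \<eta>)) V"
        unfolding W_def F_def
      proof (rule Caccioppoli[OF B _ _ V \<psi> _ _ G q ex(1,2) _ ex(3,4) s sob])
        show "ball 0 (2 * \<eta>) \<subseteq> B" using \<eta> \<rho> by (intro sb) auto
      qed (use \<phi> N0 in \<open>auto simp: \<psi>_def dilate_def\<close>)
      also have "\<dots> \<le> ennreal (3 * s) * ennreal f1 + ennreal (7 * (K / (2 * \<eta>))) * ennreal b"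
      proof (intro add_mono mult_left_mono)
        have "Lp_norm p (ball 0 (2 * \<eta>)) F \<le> Lp_norm p (ball 0 (1 / 2)) F"
          using p0 \<eta> \<rho> by (intro Lp_norm_subset) auto
        then show "Lp_norm p (ball 0 (2 * \<eta>)) F \<le> ennreal f1" using f1 by simp
      qed (use b in auto)
      also have "\<dots> = ennreal X"
        unfolding X_def using s f1 b K(1) \<eta> by (simp flip: ennreal_mult ennreal_plus)
      finally show ?thesis .
    qed
    have gWV: "grad_length W x = grad_length V x" if "norm x < \<eta>" for x
    proof -
      have eq: "W y = V y" if "y \<in> ball 0 \<eta>" for y
        using that \<phi>(4)[of "(1 / (2 * \<eta>)) *\<^sub>R y"] \<eta> by (simp add: W_def \<psi>_def dilate_def field_simps)
      have "partials [i] W x = partials [i] V x" for i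
        by (rule partials_cong_open[of W "ball 0 \<eta>", OF smW open_ball eq]) (use that in auto)
      then show ?thesis by (simp add: grad_length_def)
    qed

    \<comment> \<open>\<xi> is 0 on the ball of radius \<eta>/2 and 1 outside the ball of radius
      \<eta>; its derivatives live between them.\<close>
    define \<xi> where "\<xi> = (\<lambda>x. 1 - dilate \<eta> \<phi> x)"
    have tc: "dilate \<eta> \<phi> \<in> test_functions (ball 0 \<eta>)" by (rule test_functions_dilate[OF \<phi>(1) \<eta>(1)])
    note smc = test_functions_smooth[OF tc]
    have sm\<xi>: "smooth \<xi>" unfolding \<xi>_def by (rule smooth_diff[OF smooth_const smc])
    have \<xi>01: "0 \<le> \<xi> x" "\<xi> x \<le> 1" for x using \<phi>(2,3) by (auto simp: \<xi>_def dilate_def)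
    have g\<xi>: "grad_length \<xi> x = grad_length (dilate \<eta> \<phi>) x" and l\<xi>: "laplacian \<xi> x = - laplacian (dilate \<eta> \<phi>) x" for x
      unfolding \<xi>_def by (simp_all only: grad_length_const_minus[OF smc] laplacian_const_minus[OF smc])
    have g\<xi>_le: "grad_length \<xi> x \<le> K / \<eta>" for x
      unfolding g\<xi> using K(2) \<eta> by (subst grad_length_dilate[OF sm\<phi>]) (auto intro: divide_right_mono)
    have l\<xi>_le: "\<bar>laplacian \<xi> x\<bar> \<le> (K / \<eta>)\<^sup>2" for x
    proof -
      have "(1 / \<eta>)\<^sup>2 * \<bar>laplacian \<phi> ((1 / \<eta>) *\<^sub>R x)\<bar> \<le> (1 / \<eta>)\<^sup>2 * K\<^sup>2"
        by (intro mult_left_mono K) auto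
      then show ?thesis
        unfolding l\<xi> laplacian_dilate[OF sm\<phi>] by (simp add: abs_mult power_divide)
    qed
    have outer: "\<xi> x = 1" "grad_length \<xi> x = 0" "laplacian \<xi> x = 0" if "norm x \<ge> \<eta>" for x
    proof -
      have x: "x \<notin> ball 0 \<eta>" using that by simp
      have "partials is (dilate \<eta> \<phi>) x = 0" for "is"
        using test_functions_outside[OF test_functions_partials[OF tc] x] .
      then show "grad_length \<xi> x = 0" "laplacian \<xi> x = 0"
        unfolding g\<xi> l\<xi> by (simp_all add: grad_length_def laplacian_def)
      show "\<xi> x = 1" using test_functions_outside[OF tc x] by (simp add: \<xi>_def)
    qed
    have \<xi>in: "\<xi> x = 0" if "x \<in> ball 0 (\<eta> / 2)" for x
      using that \<phi>(4)[of "(1 / \<eta>) *\<^sub>R x"] \<eta> by (simp add: \<xi>_def dilate_def field_simps)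
    have inner: "grad_length \<xi> x = 0" "laplacian \<xi> x = 0" if "x \<in> ball 0 (\<eta> / 2)" for x
    proof -
      have "partials (i # is) \<xi> x = 0" for i "is"
        using partials_cong_open[of \<xi> "ball 0 (\<eta> / 2)" "\<lambda>x. 0" x "i # is", OF sm\<xi> open_ball \<xi>in that] by (simp add: partials_const)
      then show "grad_length \<xi> x = 0" "laplacian \<xi> x = 0"
        by (simp_all add: grad_length_def laplacian_def)
    qed
    define u where "u = (\<lambda>x. \<xi> x *\<^sub>R V x)"
    have u: "u \<in> test_functions (B - {0})"
    proof -
      obtain M where M: "compact M" "M \<subseteq> B" "\<And>x. x \<notin> M \<Longrightarrow> V x = 0"
        using V unfolding test_functions_iff by blast
      \<comment> \<open>Removing the ball on which \<xi> vanishes keeps the support away from the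
        origin, as the punctured ball requires.\<close>
      have "compact (M - ball 0 (\<eta> / 2))" using M(1) by (rule compact_diff) simp
      moreover have "M - ball 0 (\<eta> / 2) \<subseteq> B - {0}" using M(2) \<eta> by auto
      moreover have "u x = 0" if "x \<notin> M - ball 0 (\<eta> / 2)" for x
        using that M(3)[of x] \<xi>in[of x] by (auto simp: u_def)
      moreover have "smooth u" unfolding u_def by (rule smooth_scaleR[OF sm\<xi> smV])
      ultimately show ?thesis unfolding test_functions_iff by blast
    qed

    \<comment> \<open>The largest value of the weight on the support of \<xi>, attained at radius
      \<eta>/2.\<close>
    define e where "e = (\<eta> / 2) powr (- \<tau>)"
    have e0: "0 < e" unfolding e_def using \<eta> by simp
    define H where "H = (\<lambda>x. norm x powr (- \<tau>) *\<^sub>R (laplacian u x + q x * u x))"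
    \<comment> \<open>\<open>g1\<close> and \<open>g2\<close> bound the weighted residual inside and
      outside the ball of radius 1/2; \<open>g3\<close> and \<open>g4\<close> bound the commutator
      terms with the first and second derivatives of \<xi>.\<close>
    define g1 where "g1 = (\<lambda>x. e *\<^sub>R (indicator (ball 0 (1 / 2)) x *\<^sub>R norm (F x)))"
    define g2 where "g2 = (\<lambda>x. (2 powr \<tau>) *\<^sub>R norm (F x))"
    define g3 where "g3 = (\<lambda>x. (e * (2 * (K / \<eta>))) *\<^sub>R (indicator (ball 0 \<eta>) x *\<^sub>R grad_length W x))"
    define g4 where "g4 = (\<lambda>x. (e * (K / \<eta>)\<^sup>2) *\<^sub>R (indicator (ball 0 \<eta>) x *\<^sub>R norm (V x)))"
    have mi: "(\<lambda>x. indicator (ball 0 r) x :: real) \<in> borel_measurable (lebesgue_on B)" for r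
      by (intro borel_measurable_lebesgue_onI borel_measurable_indicator) simp
    have mgW: "grad_length W \<in> borel_measurable (lebesgue_on B)"
      by (intro borel_measurable_lebesgue_onI grad_length_measurable smW)
    have mVB: "V \<in> borel_measurable (lebesgue_on B)" by (rule borel_measurable_lebesgue_onI[OF mV])
    have mb: "(\<lambda>x. indicator (ball 0 (1 / 2)) x *\<^sub>R norm (F x)) \<in> borel_measurable (lebesgue_on B)"
      "(\<lambda>x. norm (F x)) \<in> borel_measurable (lebesgue_on B)"
      "(\<lambda>x. indicator (ball 0 \<eta>) x *\<^sub>R grad_length W x) \<in> borel_measurable (lebesgue_on B)"
      "(\<lambda>x. indicator (ball 0 \<eta>) x *\<^sub>R norm (V x)) \<in> borel_measurable (lebesgue_on B)"
      using mi mF mgW mVB by (auto intro!: borel_measurable_scaleR)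
    have mg: "g1 \<in> borel_measurable (lebesgue_on B)" "g2 \<in> borel_measurable (lebesgue_on B)"
      "g3 \<in> borel_measurable (lebesgue_on B)" "g4 \<in> borel_measurable (lebesgue_on B)"
      unfolding g1_def g2_def g3_def g4_def using mb by (auto intro!: borel_measurable_scaleR)
    have Hpt: "norm (H x) \<le> norm (g1 x + (g2 x + (g3 x + g4 x)))" if xB: "x \<in> B" for x
    proof -
      have g0: "0 \<le> g1 x" "0 \<le> g2 x" "0 \<le> g3 x" "0 \<le> g4 x"
        unfolding g1_def g2_def g3_def g4_def using e0 K(1) \<eta> grad_length_nonneg[of W x] by auto
      let ?S = "\<Sum>i\<in>UNIV. partials [i] \<xi> x *\<^sub>R partials [i] V x"
      have Lu: "laplacian u x + q x * u x = \<xi> x *\<^sub>R F x + 2 *\<^sub>R ?S + laplacian \<xi> x *\<^sub>R V x"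
        unfolding u_def laplacian_scaleR[OF sm\<xi> smV] F_def by (simp add: algebra_simps)
      have S: "norm ?S \<le> grad_length \<xi> x * grad_length V x"
        by (rule order_trans[OF norm_sum]) (use sum_mult_le_grad_length[of \<xi> x V] in simp)
      have nL: "norm (laplacian u x + q x * u x) \<le> \<xi> x * norm (F x) + 2 * (grad_length \<xi> x * grad_length V x) + \<bar>laplacian \<xi> x\<bar> * norm (V x)"
        unfolding Lu using S \<xi>01[of x]
        by (intro order_trans[OF norm_triangle_ineq] add_mono order_trans[OF norm_triangle_ineq]) auto
      show ?thesis
      proof (cases "norm x < \<eta> / 2")
        case True
        then have "norm (laplacian u x + q x * u x) \<le> 0"
          using nL \<xi>in[of x] inner[of x] by simp
        then have "H x = 0" unfolding H_def by simp
        then show ?thesis by simp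
      next
        case False
        have w: "norm x powr (- \<tau>) \<le> e"
          unfolding e_def using False \<eta> \<tau> by (intro powr_mono2') auto
        have first: "norm x powr (- \<tau>) * (\<xi> x * norm (F x)) \<le> g1 x + g2 x"
        proof (cases "norm x < 1 / 2")
          case True
          have "norm x powr (- \<tau>) * (\<xi> x * norm (F x)) \<le> e * (1 * norm (F x))"
            using w \<xi>01 e0 by (intro mult_mono) auto
          then show ?thesis using True g0(2) by (simp add: g1_def)
        next
          case False
          have "norm x powr (- \<tau>) \<le> (1 / 2) powr (- \<tau>)"
            using False \<tau> by (intro powr_mono2') auto
          also have "\<dots> = 2 powr \<tau>" by (simp add: powr_minus powr_divide)
          finally have "norm x powr (- \<tau>) * (\<xi> x * norm (F x)) \<le> 2 powr \<tau> * (1 * norm (F x))"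
            using \<xi>01 by (intro mult_mono) auto
          then show ?thesis using g0(1) by (simp add: g2_def)
        qed
        have second: "norm x powr (- \<tau>) * (2 * (grad_length \<xi> x * grad_length V x) + \<bar>laplacian \<xi> x\<bar> * norm (V x)) \<le> g3 x + g4 x"
        proof (cases "norm x < \<eta>")
          case True
          have "norm x powr (- \<tau>) * (2 * (grad_length \<xi> x * grad_length V x) + \<bar>laplacian \<xi> x\<bar> * norm (V x))
              \<le> e * (2 * ((K / \<eta>) * grad_length V x) + (K / \<eta>)\<^sup>2 * norm (V x))"
            using w e0 g\<xi>_le[of x] l\<xi>_le[of x] grad_length_nonneg[of \<xi> x] grad_length_nonneg[of V x] K(1) \<eta>(1)
            by (intro mult_mono add_mono mult_right_mono mult_left_mono add_nonneg_nonneg mult_nonneg_nonneg) auto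
          also have "\<dots> = g3 x + g4 x"
            using True gWV[OF True] by (simp add: g3_def g4_def algebra_simps)
          finally show ?thesis .
        next
          case False
          then show ?thesis using outer[of x] g0 by simp
        qed
        have "norm (H x) = norm x powr (- \<tau>) * norm (laplacian u x + q x * u x)"
          unfolding H_def by simp
        also have "\<dots> \<le> norm x powr (- \<tau>) * (\<xi> x * norm (F x) + (2 * (grad_length \<xi> x * grad_length V x) + \<bar>laplacian \<xi> x\<bar> * norm (V x)))"
          using nL by (intro mult_left_mono) auto
        also have "\<dots> \<le> (g1 x + g2 x) + (g3 x + g4 x)"
          unfolding distrib_left[of "norm x powr (- \<tau>)"] using first second by (simp add: distrib_left)
        also have "\<dots> = norm (g1 x + (g2 x + (g3 x + g4 x)))"
          using g0 by simp
        finally show ?thesis .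
      qed
    qed
    have n1: "Lp_norm p B g1 \<le> ennreal (e * f1)"
      unfolding g1_def
    proof (rule Lp_norm_le_scaled[OF p0 mb(1)])
      have "Lp_norm p B (\<lambda>x. indicator (ball 0 (1 / 2)) x *\<^sub>R norm (F x)) = Lp_norm p (ball 0 (1 / 2)) (\<lambda>x. norm (F x))"
        using p0 B sb[of "1 / 2"] by (subst Lp_norm_indicator) (auto simp: Int_absorb2)
      also have "\<dots> = ennreal f1" unfolding f1(1)[symmetric] by (rule Lp_norm_cong) simp
      finally show "Lp_norm p B (\<lambda>x. indicator (ball 0 (1 / 2)) x *\<^sub>R norm (F x)) \<le> ennreal f1" by simp
    qed (use e0 in simp)
    have n2: "Lp_norm p B g2 \<le> ennreal (2 powr \<tau> * f2)"
      unfolding g2_def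
    proof (rule Lp_norm_le_scaled[OF p0 mb(2)])
      have "Lp_norm p B (\<lambda>x. norm (F x)) = Lp_norm p B F" by (rule Lp_norm_cong) simp
      then show "Lp_norm p B (\<lambda>x. norm (F x)) \<le> ennreal f2" using f2 by simp
    qed simp
    have \<eta>B: "ball 0 \<eta> \<subseteq> B" using \<eta> \<rho> by (intro sb) auto
    \<comment> \<open>Passing from exponent p to 2 on the ball of radius \<eta> gains a factor
      \<eta>, which cancels the factor 1/\<eta> from the gradient of \<xi>.\<close>
    have n3: "Lp_norm p B g3 \<le> ennreal (e * (2 * (K / \<eta>)) * (\<omega> * \<eta> * X))"
      unfolding g3_def
    proof (rule Lp_norm_le_scaled[OF p0 mb(3)])
      have "Lp_norm p B (\<lambda>x. indicator (ball 0 \<eta>) x *\<^sub>R grad_length W x) = Lp_norm p (ball 0 \<eta>) (grad_length W)"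
        using p0 B \<eta>B by (subst Lp_norm_indicator) (auto simp: Int_absorb2)
      also have "\<dots> \<le> ennreal (\<omega> * \<eta>) * Lp_norm 2 (ball 0 \<eta>) (grad_length W)"
        unfolding \<omega>_def using \<eta> p0 ex(5)
        by (intro Lp_norm_subset_ball borel_measurable_lebesgue_onI grad_length_measurable smW) (auto simp: N_def)
      also have "\<dots> \<le> ennreal (\<omega> * \<eta>) * ennreal X"
        using nW Lp_norm_subset[of 2 "ball 0 \<eta>" B "grad_length W"] B \<eta>B by (intro mult_left_mono) auto
      also have "\<dots> = ennreal (\<omega> * \<eta> * X)" using \<omega> \<eta> X0 by (simp flip: ennreal_mult)
      finally show "Lp_norm p B (\<lambda>x. indicator (ball 0 \<eta>) x *\<^sub>R grad_length W x) \<le> ennreal (\<omega> * \<eta> * X)" .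
    qed (use e0 K(1) \<eta> in simp)
    have V\<eta>: "Lp_norm 2 (ball 0 \<eta>) V \<le> ennreal b"
      using Lp_norm_subset[of 2 "ball 0 \<eta>" "ball 0 (2 * \<eta>)" V] subset_ball[of \<eta> "2 * \<eta>" 0] \<eta> b by simp
    have n4: "Lp_norm p B g4 \<le> ennreal (e * (K / \<eta>)\<^sup>2 * (\<omega> * \<eta> * b))"
      unfolding g4_def
    proof (rule Lp_norm_le_scaled[OF p0 mb(4)])
      have "Lp_norm p B (\<lambda>x. indicator (ball 0 \<eta>) x *\<^sub>R norm (V x)) = Lp_norm p (ball 0 \<eta>) (\<lambda>x. norm (V x))"
        using p0 B \<eta>B by (subst Lp_norm_indicator) (auto simp: Int_absorb2)
      also have "\<dots> = Lp_norm p (ball 0 \<eta>) V" by (rule Lp_norm_cong) simp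
      also have "\<dots> \<le> ennreal (\<omega> * \<eta>) * Lp_norm 2 (ball 0 \<eta>) V"
        unfolding \<omega>_def using \<eta> p0 ex(5)
        by (intro Lp_norm_subset_ball borel_measurable_lebesgue_onI mV) (auto simp: N_def)
      also have "\<dots> \<le> ennreal (\<omega> * \<eta>) * ennreal b"
        using V\<eta> by (intro mult_left_mono) auto
      also have "\<dots> = ennreal (\<omega> * \<eta> * b)" using \<omega> \<eta> b by (simp flip: ennreal_mult)
      finally show "Lp_norm p B (\<lambda>x. indicator (ball 0 \<eta>) x *\<^sub>R norm (V x)) \<le> ennreal (\<omega> * \<eta> * b)" .
    qed (use e0 K(1) \<eta> in simp)
    define h where "h = e * f1 + (2 powr \<tau> * f2 + (e * (2 * (K / \<eta>)) * (\<omega> * \<eta> * X) + e * (K / \<eta>)\<^sup>2 * (\<omega> * \<eta> * b)))"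
    have h0: "0 \<le> e * f1" "0 \<le> 2 powr \<tau> * f2" "0 \<le> e * (2 * (K / \<eta>)) * (\<omega> * \<eta> * X)" "0 \<le> e * (K / \<eta>)\<^sup>2 * (\<omega> * \<eta> * b)"
      using e0 f1 f2 K(1) \<eta> \<omega> X0 b by auto
    then have hnn: "0 \<le> h" unfolding h_def by simp
    have nH: "Lp_norm p B H \<le> ennreal h"
    proof -
      have "Lp_norm p B H \<le> Lp_norm p B (\<lambda>x. g1 x + (g2 x + (g3 x + g4 x)))"
        by (rule Lp_norm_mono[OF p0 Hpt])
      also have "\<dots> \<le> ennreal h"
        unfolding h_def using mg n1 n2 n3 n4 h0 ex(1)
        by (intro Lp_norm_triangle_le) (auto intro!: borel_measurable_add)
      finally show ?thesis .
    qed

    let ?A = "ball (0::real^'n) (\<rho> / 2) - ball 0 \<eta>"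
    \<comment> \<open>On the annulus the weight is at least
      \<open>(\<rho> / 2) powr (- \<tau>)\<close> and u equals V, so multiplication by
      \<open>?T\<close> removes the weight.\<close>
    let ?T = "(\<rho> / 2) powr \<tau>"
    have As: "?A \<in> sets lebesgue" "?A \<subseteq> B" using sb[of "\<rho> / 2"] \<rho> by auto
    have nA: "Lp_norm 2 ?A V \<le> ennreal (\<omega> * (?T * (\<kappa> * h)))"
    proof -
      have mu: "(\<lambda>x. norm x powr (- \<tau>) *\<^sub>R u x) \<in> borel_measurable (lebesgue_on B)"
      proof (intro borel_measurable_lebesgue_onI borel_measurable_scaleR)
        have "(\<lambda>x :: real^'n. norm x powr (- \<tau>)) \<in> borel_measurable borel" by measurable
        then show "(\<lambda>x :: real^'n. norm x powr (- \<tau>)) \<in> borel_measurable lebesgue"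
          by (simp add: measurable_completion)
        show "u \<in> borel_measurable lebesgue"
          by (intro smooth_measurable test_functions_smooth[OF u])
      qed
      have "Lp_norm p' ?A V \<le> Lp_norm p' ?A (\<lambda>x. ?T *\<^sub>R (norm x powr (- \<tau>) *\<^sub>R u x))"
      proof (rule Lp_norm_mono[OF ex(2)])
        fix x assume x: "x \<in> ?A"
        then have x0: "0 < norm x" using \<eta>(1) by auto
        have "(\<rho> / 2) powr (- \<tau>) \<le> norm x powr (- \<tau>)"
          using x x0 \<tau> by (intro powr_mono2') auto
        then have "?T * (\<rho> / 2) powr (- \<tau>) \<le> ?T * norm x powr (- \<tau>)"
          by (intro mult_left_mono) auto
        moreover have "?T * (\<rho> / 2) powr (- \<tau>) = 1" using \<rho>0 by (simp flip: powr_add)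
        ultimately have "1 \<le> ?T * norm x powr (- \<tau>)" by simp
        then have "1 * norm (V x) \<le> (?T * norm x powr (- \<tau>)) * norm (V x)"
          by (intro mult_right_mono) auto
        then show "norm (V x) \<le> norm (?T *\<^sub>R (norm x powr (- \<tau>) *\<^sub>R u x))"
          using outer(1)[of x] x by (simp add: u_def mult_ac)
      qed
      also have "\<dots> \<le> Lp_norm p' B (\<lambda>x. ?T *\<^sub>R (norm x powr (- \<tau>) *\<^sub>R u x))"
        using As B ex(2) by (intro Lp_norm_subset) auto
      also have "\<dots> \<le> ennreal (?T * (\<kappa> * h))"
      proof (rule Lp_norm_le_scaled[OF ex(2) mu])
        have "Lp_norm p' B (\<lambda>x. norm x powr (- \<tau>) *\<^sub>R u x) \<le> ennreal \<kappa> * Lp_norm p B H"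
          using carleman[OF u] unfolding H_def .
        also have "\<dots> \<le> ennreal \<kappa> * ennreal h" by (intro mult_left_mono nH) auto
        finally show "Lp_norm p' B (\<lambda>x. norm x powr (- \<tau>) *\<^sub>R u x) \<le> ennreal (\<kappa> * h)"
          using \<kappa> hnn by (simp add: ennreal_mult)
      qed simp
      finally have A: "Lp_norm p' ?A V \<le> ennreal (?T * (\<kappa> * h))" .
      \<comment> \<open>The Carleman inequality controls the p'-norm; the unit ball as a bounding
        set turns it into the 2-norm.\<close>
      have "Lp_norm 2 ?A V \<le> ennreal (\<omega> * 1) * Lp_norm p' ?A V"
        unfolding \<omega>_def using As ex(2,6) unfolding B_def
        by (intro Lp_norm_subset_ball borel_measurable_lebesgue_onI mV) (auto simp: N_def)
      also have "\<dots> \<le> ennreal \<omega> * ennreal (?T * (\<kappa> * h))"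
        using A by (simp add: mult_left_mono)
      finally show ?thesis using \<omega> \<kappa> hnn by (simp add: ennreal_mult)
    qed
    \<comment> \<open>On the inner ball, where u differs from V, the crude bound b suffices.\<close>
    have nV: "Lp_norm 2 (ball 0 (\<rho> / 2)) V \<le> ennreal (b + \<omega> * (?T * (\<kappa> * h)))"
    proof -
      have "Lp_norm 2 (ball 0 (\<rho> / 2)) V
          = Lp_norm 2 (ball 0 (\<rho> / 2)) (\<lambda>x. indicator (ball 0 \<eta>) x *\<^sub>R V x + indicator ?A x *\<^sub>R V x)"
        by (rule Lp_norm_cong) (auto simp: indicator_def)
      also have "\<dots> \<le> ennreal (b + \<omega> * (?T * (\<kappa> * h)))"
      proof (rule Lp_norm_triangle_le)
        show "Lp_norm 2 (ball 0 (\<rho> / 2)) (\<lambda>x. indicator (ball 0 \<eta>) x *\<^sub>R V x) \<le> ennreal b"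
          using V\<eta> \<eta> \<rho>0 by (subst Lp_norm_indicator) (auto simp: Int_absorb2 subset_ball)
        show "Lp_norm 2 (ball 0 (\<rho> / 2)) (\<lambda>x. indicator ?A x *\<^sub>R V x) \<le> ennreal (\<omega> * (?T * (\<kappa> * h)))"
          using nA by (subst Lp_norm_indicator) (auto simp: Int_absorb2)
        have "(\<lambda>x. indicator S x *\<^sub>R V x) \<in> borel_measurable (lebesgue_on (ball 0 (\<rho> / 2)))" if "S \<in> sets lebesgue" for S
          using that mV by (intro borel_measurable_lebesgue_onI borel_measurable_scaleR borel_measurable_indicator)
        then show "(\<lambda>x. indicator (ball 0 \<eta>) x *\<^sub>R V x) \<in> borel_measurable (lebesgue_on (ball 0 (\<rho> / 2)))"
          "(\<lambda>x. indicator ?A x *\<^sub>R V x) \<in> borel_measurable (lebesgue_on (ball 0 (\<rho> / 2)))"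
          using As by auto
      qed (use b \<omega> \<kappa> hnn in auto)
      finally show ?thesis .
    qed

    define E where "E = \<eta> powr (- \<tau>)"
    define D where "D = 2 powr (- (\<tau> + 1) :: real)"
    have E1: "1 \<le> E" unfolding E_def using \<eta> \<rho> \<tau> powr_mono2'[of "- \<tau>" \<eta> 1] by simp
    have D0: "0 < D" unfolding D_def by simp
    have EE: "\<eta> powr (- (\<tau> + 1)) = E / \<eta>"
      unfolding E_def using \<eta> by (simp add: powr_diff flip: powr_minus_divide)
    \<comment> \<open>The powers of 2 cancel: the product is
      \<open>\<rho> powr \<tau> * \<eta> powr (- \<tau>)\<close>.\<close>
    have P: "?T * e \<le> E"
    proof -
      have "?T * e = \<rho> powr \<tau> * E"
        unfolding e_def E_def using \<rho>0 \<eta> by (simp add: powr_divide powr_minus field_simps)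
      moreover have "\<rho> powr \<tau> \<le> 1" using \<rho> \<rho>0 \<tau> by (intro powr_le1) auto
      ultimately show ?thesis using E1 mult_right_mono[of "\<rho> powr \<tau>" 1 E] by simp
    qed
    \<comment> \<open>The product is \<open>\<rho> powr \<tau>\<close>; the condition \<rho> < 1/2
      gives the decaying coefficient of the second term, with factor 2.\<close>
    have Q: "?T * 2 powr \<tau> \<le> 2 * D"
    proof -
      have "?T * 2 powr \<tau> = \<rho> powr \<tau>" using \<rho>0 by (simp add: powr_divide)
      also have "\<dots> \<le> (1 / 2) powr \<tau>" using \<rho> \<rho>0 \<tau> by (intro powr_mono2) auto
      also have "\<dots> = 2 powr (- \<tau>)" by (simp add: powr_divide powr_minus inverse_eq_divide)
      also have "\<dots> = 2 powr 1 * 2 powr (- (\<tau> + 1))" by (simp only: powr_add[symmetric]) simp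
      also have "\<dots> = 2 * D" by (simp add: D_def)
      finally show ?thesis .
    qed
    have "?T * h = (?T * e) * (f1 + 2 * K * \<omega> * X + K\<^sup>2 * \<omega> * (b / \<eta>)) + (?T * 2 powr \<tau>) * f2"
      unfolding h_def using \<eta> by (simp add: field_simps power2_eq_square)
    also have "\<dots> \<le> E * (f1 + 2 * K * \<omega> * X + K\<^sup>2 * \<omega> * (b / \<eta>)) + (2 * D) * f2"
      using P Q f1 f2 K(1) \<omega> X0 b \<eta> by (intro add_mono mult_right_mono) auto
    \<comment> \<open>Inserting X, \<open>2 * K * \<omega> * (3 * s)\<close> yields the coefficient
      6, while \<open>2 * K * \<omega> * (7 * K / (2 * \<eta>))\<close> and the last term add up to
      8 = 7 + 1.\<close>
    also have "\<dots> = E * f1 * (1 + 6 * K * \<omega> * s) + 2 * (D * f2) + 8 * K\<^sup>2 * \<omega> * (E / \<eta> * b)"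
      unfolding X_def using \<eta> by (simp add: field_simps power2_eq_square)
    finally have Th: "?T * h \<le> E * f1 * (1 + 6 * K * \<omega> * s) + 2 * (D * f2) + 8 * K\<^sup>2 * \<omega> * (E / \<eta> * b)" .
    define Y where "Y = E * f1 + D * f2 + E / \<eta> * b"
    have Y0: "0 \<le> E * f1" "0 \<le> D * f2" "0 \<le> E / \<eta> * b" using E1 D0 f1 f2 b \<eta> by auto
    have KK: "0 \<le> 6 * K * \<omega> * s" "0 \<le> 8 * K\<^sup>2 * \<omega>" using K(1) \<omega> s by auto
    have "?T * h \<le> (3 + 6 * K * \<omega> * s + 8 * K\<^sup>2 * \<omega>) * Y"
    proof -
      have "E * f1 * (1 + 6 * K * \<omega> * s) \<le> E * f1 * (3 + 6 * K * \<omega> * s + 8 * K\<^sup>2 * \<omega>)"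
        "(D * f2) * 2 \<le> (D * f2) * (3 + 6 * K * \<omega> * s + 8 * K\<^sup>2 * \<omega>)"
        "(E / \<eta> * b) * (8 * K\<^sup>2 * \<omega>) \<le> (E / \<eta> * b) * (3 + 6 * K * \<omega> * s + 8 * K\<^sup>2 * \<omega>)"
        using Y0 KK by (intro mult_left_mono; simp)+
      then show ?thesis using Th unfolding Y_def by (simp add: algebra_simps)
    qed
    then have "\<omega> * \<kappa> * (?T * h) \<le> \<omega> * \<kappa> * ((3 + 6 * K * \<omega> * s + 8 * K\<^sup>2 * \<omega>) * Y)"
      using \<omega> \<kappa> by (intro mult_left_mono) auto
    \<comment> \<open>The contribution b of the inner ball is absorbed here and accounts for the
      summand 1 in C.\<close>
    moreover have "b \<le> Y"
    proof -
      have "1 \<le> E / \<eta>" using E1 \<eta> \<rho> by (simp add: field_simps)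
      then have "b \<le> E / \<eta> * b" using b mult_right_mono[of 1 "E / \<eta>" b] by simp
      then show ?thesis using Y0 unfolding Y_def by linarith
    qed
    ultimately have "b + \<omega> * (?T * (\<kappa> * h)) \<le> C * Y"
      unfolding C_def by (simp add: algebra_simps)
    then have "Lp_norm 2 (ball 0 (\<rho> / 2)) V \<le> ennreal (C * Y)"
      using nV by (meson ennreal_leI order_trans)
    also have "ennreal (C * Y) = ennreal C * (ennreal E * ennreal f1 + ennreal D * ennreal f2 + ennreal (E / \<eta>) * ennreal b)"
      unfolding Y_def using C Y0 E1 D0 f1 f2 b \<eta> by (simp flip: ennreal_mult ennreal_plus)
    finally show ?thesis
      unfolding F_def[symmetric] C_def[symmetric] EE f1(1) f2(1) b(1) E_def[symmetric] D_def[symmetric] using f2 by simp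
  qed
qed

subsection \<open>Passage to the limit\<close>

lemma Lp_space_add:
  assumes "1 \<le> p" "f \<in> Lp_space p U" "g \<in> Lp_space p U"
  shows "(\<lambda>x. f x + g x) \<in> Lp_space p U"
  using assms Lp_norm_triangle[OF assms(1), of f U g] unfolding Lp_space_def
  by (auto intro!: borel_measurable_add elim!: le_less_trans)

lemma Lp_space_sum:
  fixes f :: "'i \<Rightarrow> real^'n \<Rightarrow> 'a::euclidean_space"
  assumes "1 \<le> p" "finite I" "\<And>i. i \<in> I \<Longrightarrow> f i \<in> Lp_space p U"
  shows "(\<lambda>x. \<Sum>i\<in>I. f i x) \<in> Lp_space p U"
  using assms(2,3)
proof (induction I)
  case empty
  have "Lp_norm p U (\<lambda>x. 0 :: 'a) = 0" using assms(1) by (intro Lp_norm_0) auto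
  then show ?case by (simp add: Lp_space_def)
next
  case (insert i I)
  then show ?case by (simp add: Lp_space_add[OF assms(1)])
qed

lemma Lp_space_test_mult:
  fixes f :: "real^'n \<Rightarrow> 'a::euclidean_space"
  assumes p: "0 < p" and t: "t \<in> test_functions V" and f: "f \<in> Lp_space p U"
  shows "(\<lambda>x. t x *\<^sub>R f x) \<in> Lp_space p U"
proof -
  obtain C where C: "C > 0" "\<And>x. norm (t x) \<le> C"
    by (rule test_functions_bounded[OF t, where thesis=thesis]) (rule that)
  have f': "f \<in> borel_measurable (lebesgue_on U)" "Lp_norm p U f < \<infinity>" using f by (auto simp: Lp_space_def)
  have "Lp_norm p U (\<lambda>x. t x *\<^sub>R f x) \<le> Lp_norm p U (\<lambda>x. C *\<^sub>R f x)"
    using C by (intro Lp_norm_mono[OF p]) (auto intro!: mult_right_mono)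
  also have "\<dots> < \<infinity>"
    using f' p by (simp add: Lp_norm_scaleR ennreal_mult_less_top)
  finally show ?thesis
    unfolding Lp_space_def
    using borel_measurable_scaleR[OF borel_measurable_lebesgue_onI[OF smooth_measurable[OF test_functions_smooth[OF t]]] f'(1)]
    by simp
qed

lemma Lp_space_extend:
  fixes f :: "real^'n \<Rightarrow> 'a::euclidean_space"
  assumes p: "0 < p" and U: "U \<in> sets lebesgue" and f: "f \<in> Lp_space p U"
  shows "(\<lambda>x. indicator U x *\<^sub>R f x) \<in> borel_measurable lebesgue" "Lp_norm p UNIV (\<lambda>x. indicator U x *\<^sub>R f x) < top"
  using f p U unfolding Lp_space_def by (auto simp: borel_measurable_restrict_space_iff Lp_norm_indicator)

lemma laplacian_diff:
  fixes f g :: "real^'n \<Rightarrow> 'b::real_normed_vector"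
  assumes "smooth f" "smooth g"
  shows "laplacian (\<lambda>x. f x - g x) x = laplacian f x - laplacian g x"
proof -
  have add: "partials [i] (\<lambda>x. a x - b x) = (\<lambda>x. partials [i] a x - partials [i] b x)"
    if "smooth a" "smooth b" for i and a b :: "real^'n \<Rightarrow> 'b"
    using partials_add[OF smooth_differentiable[OF that(1)] smooth_differentiable[OF smooth_minus[OF that(2)]], of i]
      partials_const_minus[OF that(2), of i 0] by simp
  have "partials [i, i] (\<lambda>x. f x - g x) x = partials [i, i] f x - partials [i, i] g x" for i
    unfolding partials_pair add[OF assms] add[OF smooth_partials[OF assms(1)] smooth_partials[OF assms(2)]] ..
  then show ?thesis by (simp add: laplacian_def sum_subtractf)
qed

lemma conv_sum:
  fixes f :: "'i \<Rightarrow> real^'n \<Rightarrow> 'a::euclidean_space"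
  assumes "\<zeta> \<in> test_functions U" "\<And>i. i \<in> I \<Longrightarrow> integrable lebesgue (f i)"
  shows "conv \<zeta> (\<lambda>y. \<Sum>i\<in>I. f i y) x = (\<Sum>i\<in>I. conv \<zeta> (f i) x)"
  unfolding conv_def scaleR_sum_right
  by (intro Bochner_Integration.integral_sum conv_integrable[OF assms(1)] assms(2))

text \<open>The Leibniz formula for the second weak derivative of \<open>\<phi> u\<close> in
  direction i, with \<open>u1\<close> and \<open>u2\<close> in the role of the weak derivatives of
  u; compare \<open>has_weak_deriv_product\<close>.\<close>

definition product_deriv2 ::
  "(real^'n \<Rightarrow> real) \<Rightarrow> (real^'n \<Rightarrow> 'a::real_vector) \<Rightarrow> ('n \<Rightarrow> real^'n \<Rightarrow> 'a) \<Rightarrow> ('n \<Rightarrow> real^'n \<Rightarrow> 'a) \<Rightarrow> 'n \<Rightarrow> real^'n \<Rightarrow> 'a" where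
  "product_deriv2 \<phi> u u1 u2 i x = \<phi> x *\<^sub>R u2 i x + (2 * partials [i] \<phi> x) *\<^sub>R u1 i x + partials [i, i] \<phi> x *\<^sub>R u x"

lemma partials_reflect:
  fixes \<zeta> :: "real^'n \<Rightarrow> real"
  assumes "smooth \<zeta>"
  shows "partials [i, i] (\<lambda>y. \<zeta> (x - y)) y = partials [i, i] \<zeta> (x - y)"
proof -
  have 1: "partials [i] (\<lambda>y. h (x - y)) = (\<lambda>y. 0 - partials [i] h (x - y))" if "smooth h" for h :: "real^'n \<Rightarrow> real"
    using partials_affine[OF smooth_differentiable[OF that], of i x "-1"] by simp
  note sp = smooth_partials[OF assms, of "[i]"]
  show ?thesis
    unfolding partials_pair 1[OF assms] partials_const_minus[OF smooth_reflect[OF sp]] 1[OF sp] by simp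
qed

text \<open>Mollification commutes with the Laplacian: the derivatives fall on the kernel, are
  rewritten in the integration variable and moved to \<open>\<phi> u\<close> by
  \<open>weak_product_rule\<close>. As \<phi> has compact support in U, no boundary term
  arises.\<close>

lemma laplacian_conv_product:
  fixes u :: "real^'n \<Rightarrow> 'a::euclidean_space" and \<phi> :: "real^'n \<Rightarrow> real"
  assumes U: "open U" and \<zeta>: "\<zeta> \<in> test_functions W" and \<phi>: "\<phi> \<in> test_functions U"
    and u1: "\<And>i. has_weak_deriv U [i] u (u1 i)" and u2: "\<And>i. has_weak_deriv U [i, i] u (u2 i)"
  shows "laplacian (conv \<zeta> (\<lambda>x. indicator U x *\<^sub>R (\<phi> x *\<^sub>R u x))) x
    = conv \<zeta> (\<lambda>x. indicator U x *\<^sub>R (\<Sum>i\<in>UNIV. product_deriv2 \<phi> u u1 u2 i x)) x"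
proof -
  note sm = test_functions_smooth[OF \<zeta>]
  have li: "locally_integrable U u" "locally_integrable U (u1 i)" "locally_integrable U (u2 i)" for i
    using u1[of i] u2[of i] unfolding has_weak_deriv_def by auto
  have int: "integrable lebesgue (\<lambda>x. indicator U x *\<^sub>R (\<phi> x *\<^sub>R u x))"
    by (rule test_functions_integrable_mult[OF U \<phi> li(1)])
  have t1: "(\<lambda>x. 2 * partials [i] \<phi> x) \<in> test_functions U" for i
    using test_functions_scaleR_right[OF smooth_const[of 2] test_functions_partials[OF \<phi>, of "[i]"]] by simp
  have intG: "integrable lebesgue (\<lambda>x. indicator U x *\<^sub>R product_deriv2 \<phi> u u1 u2 i x)" for i
    unfolding product_deriv2_def scaleR_add_right
    by (intro Bochner_Integration.integrable_add test_functions_integrable_mult[OF U] \<phi> t1 test_functions_partials li)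
  have Us: "U \<in> sets lebesgue" using U by simp
  have "partials [i, i] (conv \<zeta> (\<lambda>x. indicator U x *\<^sub>R (\<phi> x *\<^sub>R u x))) x
      = conv \<zeta> (\<lambda>x. indicator U x *\<^sub>R product_deriv2 \<phi> u u1 u2 i x) x" for i
  proof -
    have "partials [i, i] (conv \<zeta> (\<lambda>x. indicator U x *\<^sub>R (\<phi> x *\<^sub>R u x))) x
        = (\<integral>y. partials [i, i] (\<lambda>y. \<zeta> (x - y)) y *\<^sub>R (\<phi> y *\<^sub>R u y) \<partial>lebesgue_on U)"
      unfolding partials_conv[OF \<zeta> int] conv_def partials_reflect[OF sm] integral_lebesgue_on[OF Us]
      by (simp add: mult_ac)
    also have "\<dots> = (\<integral>y. \<zeta> (x - y) *\<^sub>R product_deriv2 \<phi> u u1 u2 i y \<partial>lebesgue_on U)"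
      unfolding product_deriv2_def by (rule weak_product_rule[OF U \<phi> smooth_reflect[OF sm] u1 u2])
    also have "\<dots> = conv \<zeta> (\<lambda>x. indicator U x *\<^sub>R product_deriv2 \<phi> u u1 u2 i x) x"
      unfolding conv_def integral_lebesgue_on[OF Us] by (simp add: mult_ac)
    finally show ?thesis .
  qed
  then show ?thesis
    unfolding laplacian_def scaleR_sum_right by (simp only: conv_sum[OF \<zeta> intG])
qed

lemma tendsto_ennreal_0I:
  fixes f :: "nat \<Rightarrow> ennreal"
  assumes "\<And>e. 0 < e \<Longrightarrow> \<forall>\<^sub>F k in sequentially. f k \<le> ennreal e"
  shows "f \<longlonglongrightarrow> 0"
proof (rule order_tendstoI)
  fix a :: ennreal assume "0 < a"
  then obtain e where e: "0 < e" "ennreal e < a"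
    using dense[of 0 a] by (metis ennreal_cases ennreal_less_zero_iff less_irrefl not_less_iff_gr_or_eq top.extremum_strict)
  show "\<forall>\<^sub>F k in sequentially. f k < a"
    using assms[OF e(1)] by eventually_elim (use e(2) in \<open>auto intro: le_less_trans\<close>)
qed simp

text \<open>The Laplacians converge in the \<open>p\<close>-norm; the Sobolev inequality turns this into convergence of
  the functions themselves in the \<open>p'\<close>-norm, although \<open>v\<close> is only known to lie in \<open>L\<^sup>p\<close>.\<close>

lemma sobolev_convergence:
  fixes V :: "nat \<Rightarrow> real^'n \<Rightarrow> 'a::euclidean_space"
  assumes B: "B \<in> sets lebesgue" and p: "1 \<le> p" "0 < p'" and S: "0 \<le> S"
    and sob: "\<And>w :: real^'n \<Rightarrow> 'a. w \<in> test_functions B \<Longrightarrow> Lp_norm p' B w \<le> ennreal S * Lp_norm p B (laplacian w)"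
    and V: "\<And>k. k0 \<le> k \<Longrightarrow> V k \<in> test_functions B" and sm: "\<And>k. smooth (V k)"
    and v: "v \<in> borel_measurable (lebesgue_on B)" and g: "g \<in> borel_measurable (lebesgue_on B)"
    and limV: "(\<lambda>k. Lp_norm p B (\<lambda>x. V k x - v x)) \<longlonglongrightarrow> 0"
    and limL: "(\<lambda>k. Lp_norm p B (\<lambda>x. laplacian (V k) x - g x)) \<longlonglongrightarrow> 0"
  shows "(\<lambda>k. Lp_norm p' B (\<lambda>x. V k x - v x)) \<longlonglongrightarrow> 0"
proof (rule tendsto_ennreal_0I)
  fix \<epsilon> :: real assume \<epsilon>: "0 < \<epsilon>"
  \<comment> \<open>Two Laplacian errors of size e enter the difference of two members of the
    sequence; S + 1 keeps the denominator positive.\<close>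
  define e where "e = \<epsilon> / (S + 1) / 2"
  have e: "0 < e" "S * (e + e) \<le> \<epsilon>"
  proof -
    show "0 < e" using \<epsilon> S by (simp add: e_def)
    have "e + e = \<epsilon> / (S + 1)" unfolding e_def by (rule field_sum_of_halves)
    then show "S * (e + e) \<le> \<epsilon>" using \<epsilon> S \<open>0 < e\<close> by (simp add: field_simps)
  qed
  have p0: "0 < p" using p by simp
  have mV: "V k \<in> borel_measurable (lebesgue_on B)" "laplacian (V k) \<in> borel_measurable (lebesgue_on B)" for k
    by (intro borel_measurable_lebesgue_onI smooth_measurable laplacian_measurable sm)+
  obtain J where J: "\<And>k. J \<le> k \<Longrightarrow> Lp_norm p B (\<lambda>x. laplacian (V k) x - g x) < ennreal e"
    using order_tendstoD(2)[OF limL, of "ennreal e"] e(1) unfolding eventually_sequentially by auto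
  obtain r :: "nat \<Rightarrow> nat" where r: "strict_mono r" "AE x in lebesgue_on B. (\<lambda>j. V (r j) x - v x) \<longlonglongrightarrow> 0"
    by (rule Lp_norm_tendsto_AE_subseq[OF p0 _ limV]) (use mV v in auto)
  define M where "M = max J k0"
  \<comment> \<open>Shifted by M, the subsequence lies beyond both thresholds, so its members are
    test functions with Laplacians close to g.\<close>
  have big: "M \<le> r (j + M)" for j using seq_suble[OF r(1), of "j + M"] by simp
  show "\<forall>\<^sub>F k in sequentially. Lp_norm p' B (\<lambda>x. V k x - v x) \<le> ennreal \<epsilon>"
    unfolding eventually_sequentially
  proof (intro exI[of _ M] allI impI)
    fix k assume k: "M \<le> k"
    show "Lp_norm p' B (\<lambda>x. V k x - v x) \<le> ennreal \<epsilon>"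
    \<comment> \<open>The differences of two members are test functions with small p'-norm. Fatou's
      lemma along the subsequence transfers the bound to \<open>V k - v\<close>.\<close>
    proof (rule Lp_norm_Fatou[OF p(2)])
      show "(\<lambda>x. V k x - V (r (j + M)) x) \<in> borel_measurable (lebesgue_on B)" for j
        using mV by (intro borel_measurable_diff) auto
      show "AE x in lebesgue_on B. (\<lambda>j. V k x - V (r (j + M)) x) \<longlonglongrightarrow> V k x - v x"
        using r(2)
      proof eventually_elim
        fix x assume "(\<lambda>j. V (r j) x - v x) \<longlonglongrightarrow> 0"
        then have "(\<lambda>j. V (r j) x) \<longlonglongrightarrow> v x" by (simp add: LIM_zero_iff)
        then have "(\<lambda>j. V (r (j + M)) x) \<longlonglongrightarrow> v x" by (rule LIMSEQ_ignore_initial_segment)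
        then show "(\<lambda>j. V k x - V (r (j + M)) x) \<longlonglongrightarrow> V k x - v x" by (intro tendsto_intros)
      qed
      fix j
      let ?W = "V (r (j + M))"
      have t: "V k \<in> test_functions B" "?W \<in> test_functions B"
        using k big[of j] by (auto intro!: V simp: M_def)
      have "Lp_norm p' B (\<lambda>x. V k x - ?W x) \<le> ennreal S * Lp_norm p B (laplacian (\<lambda>x. V k x - ?W x))"
        by (rule sob[OF test_functions_diff[OF t]])
      also have "Lp_norm p B (laplacian (\<lambda>x. V k x - ?W x))
          = Lp_norm p B (\<lambda>x. (laplacian (V k) x - g x) + (- 1) *\<^sub>R (laplacian ?W x - g x))"
        by (rule Lp_norm_cong) (simp add: laplacian_diff[OF sm sm])
      also have "\<dots> \<le> ennreal (e + 1 * e)"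
      proof (rule Lp_norm_triangle_le[OF p(1)])
        show "Lp_norm p B (\<lambda>x. laplacian (V k) x - g x) \<le> ennreal e"
          using J[of k] k by (simp add: M_def less_imp_le)
        have "Lp_norm p B (\<lambda>x. (- 1) *\<^sub>R (laplacian ?W x - g x)) = Lp_norm p B (\<lambda>x. laplacian ?W x - g x)"
          by (rule Lp_norm_cong) (simp add: norm_minus_commute)
        then show "Lp_norm p B (\<lambda>x. (- 1) *\<^sub>R (laplacian ?W x - g x)) \<le> ennreal (1 * e)"
          using J[of "r (j + M)"] big[of j] by (simp add: M_def less_imp_le)
      qed (use mV g e in \<open>auto intro!: borel_measurable_diff borel_measurable_scaleR\<close>)
      finally have "Lp_norm p' B (\<lambda>x. V k x - ?W x) \<le> ennreal S * ennreal (e + e)"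
        by (simp add: mult_left_mono)
      also have "\<dots> \<le> ennreal \<epsilon>" using S e by (simp add: ennreal_leI flip: ennreal_mult)
      finally show "Lp_norm p' B (\<lambda>x. V k x - ?W x) \<le> ennreal \<epsilon>" .
    qed
  qed
qed

text \<open>Replacing \<open>V k\<close> by v changes residual norms by at most \<open>a k\<close>,
  the Laplacian error plus \<theta> times the p'-error, and the 2-norms by at most
  \<open>b k\<close>, which is \<omega> times the p'-error. Both tend to 0 and all coefficients are
  finite.\<close>

lemma estimate_limit:
  fixes V :: "nat \<Rightarrow> real^'n \<Rightarrow> 'a::{real_normed_field, euclidean_space}"
  assumes B: "B \<in> sets lebesgue" and S: "S1 \<in> sets lebesgue" "S2 \<in> sets lebesgue" "S3 \<in> sets lebesgue" "S1 \<subseteq> B" "S2 \<subseteq> B" "S3 \<subseteq> B"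
    and p: "1 \<le> p" "0 < p'" "0 < r" "1 / p = 1 / r + 1 / p'" and q: "q \<in> Lp_cball r B \<theta>"
    and V: "\<And>k. smooth (V k)" "\<And>k. k0 \<le> k \<Longrightarrow> Lp_norm 2 S1 (V k) \<le> ennreal C * (ennreal E * Lp_norm p S2 (\<lambda>x. laplacian (V k) x + q x * V k x)
      + ennreal D * Lp_norm p B (\<lambda>x. laplacian (V k) x + q x * V k x) + ennreal E' * Lp_norm 2 S3 (V k))"
    and v: "v \<in> borel_measurable (lebesgue_on B)" and g: "g \<in> borel_measurable (lebesgue_on B)"
    and \<omega>: "\<And>f :: real^'n \<Rightarrow> 'a. f \<in> borel_measurable (lebesgue_on B) \<Longrightarrow> Lp_norm 2 B f \<le> ennreal \<omega> * Lp_norm p' B f"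
    and limV: "(\<lambda>k. Lp_norm p' B (\<lambda>x. V k x - v x)) \<longlonglongrightarrow> 0"
    and limL: "(\<lambda>k. Lp_norm p B (\<lambda>x. laplacian (V k) x - g x)) \<longlonglongrightarrow> 0"
  shows "Lp_norm 2 S1 v \<le> ennreal C * (ennreal E * Lp_norm p S2 (\<lambda>x. g x + q x * v x)
      + ennreal D * Lp_norm p B (\<lambda>x. g x + q x * v x) + ennreal E' * Lp_norm 2 S3 v)"
proof -
  have p0: "0 < p" using p by simp
  define a where "a k = Lp_norm p B (\<lambda>x. laplacian (V k) x - g x) + ennreal \<theta> * Lp_norm p' B (\<lambda>x. V k x - v x)" for k
  define b where "b k = ennreal \<omega> * Lp_norm p' B (\<lambda>x. V k x - v x)" for k
  have mB: "V k \<in> borel_measurable (lebesgue_on B)" "laplacian (V k) \<in> borel_measurable (lebesgue_on B)" for k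
    by (intro borel_measurable_lebesgue_onI smooth_measurable laplacian_measurable V)+
  note mq = Lp_cballD(1)[OF q]
  let ?F = "\<lambda>x. g x + q x * v x" and ?Fk = "\<lambda>k x. laplacian (V k) x + q x * V k x"
  have mF: "?F \<in> borel_measurable (lebesgue_on B)" "?Fk k \<in> borel_measurable (lebesgue_on B)" for k
    using mB mq v g by (auto intro!: borel_measurable_add borel_measurable_times)
  have sub: "f \<in> borel_measurable (lebesgue_on T)" if "f \<in> borel_measurable (lebesgue_on B)" "T \<subseteq> B" for f :: "real^'n \<Rightarrow> 'a" and T
    using that measurable_restrict_mono by blast
  have dF: "Lp_norm p B (\<lambda>x. ?Fk k x - ?F x) \<le> a k" for k
  proof -
    have "Lp_norm p B (\<lambda>x. ?Fk k x - ?F x) = Lp_norm p B (\<lambda>x. (laplacian (V k) x - g x) + q x * (V k x - v x))"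
      by (rule Lp_norm_cong) (simp add: algebra_simps)
    also have "\<dots> \<le> Lp_norm p B (\<lambda>x. laplacian (V k) x - g x) + Lp_norm p B (\<lambda>x. q x * (V k x - v x))"
      using mB mq v g by (intro Lp_norm_triangle[OF p(1)] borel_measurable_diff borel_measurable_times)
    also have "\<dots> \<le> a k"
      unfolding a_def using mB v by (intro add_left_mono Lp_norm_potential[OF q _ p0 p(2-4)] borel_measurable_diff)
    finally show ?thesis .
  qed
  \<comment> \<open>The error is measured over all of B, so one null sequence serves all
    subsets.\<close>
  have up: "Lp_norm s T h \<le> Lp_norm s T f + Lp_norm s B (\<lambda>x. h x - f x)"
    if "1 \<le> s" "T \<in> sets lebesgue" "T \<subseteq> B" "f \<in> borel_measurable (lebesgue_on B)" "h \<in> borel_measurable (lebesgue_on B)"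
    for s T and f h :: "real^'n \<Rightarrow> 'a"
  proof -
    have "Lp_norm s T h = Lp_norm s T (\<lambda>x. f x + (h x - f x))" by simp
    also have "\<dots> \<le> Lp_norm s T f + Lp_norm s T (\<lambda>x. h x - f x)"
      using sub that by (intro Lp_norm_triangle borel_measurable_diff)
    also have "\<dots> \<le> Lp_norm s T f + Lp_norm s B (\<lambda>x. h x - f x)"
      using that B by (intro add_left_mono Lp_norm_subset) auto
    finally show ?thesis .
  qed
  have d2: "Lp_norm 2 B (\<lambda>x. V k x - v x) \<le> b k" for k
    unfolding b_def using mB v by (intro \<omega> borel_measurable_diff)
  have ev: "Lp_norm 2 S1 v \<le> ennreal C * (ennreal E * (Lp_norm p S2 ?F + a k)
      + ennreal D * (Lp_norm p B ?F + a k) + ennreal E' * (Lp_norm 2 S3 v + b k)) + b k" if k: "k0 \<le> k" for k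
  proof -
    have "Lp_norm 2 S1 v \<le> Lp_norm 2 S1 (V k) + Lp_norm 2 B (\<lambda>x. v x - V k x)"
      using S v mB by (intro up) auto
    also have "Lp_norm 2 B (\<lambda>x. v x - V k x) = Lp_norm 2 B (\<lambda>x. V k x - v x)"
      by (rule Lp_norm_cong) (simp add: norm_minus_commute)
    also have "Lp_norm 2 S1 (V k) + \<dots> \<le> ennreal C * (ennreal E * Lp_norm p S2 (?Fk k)
      + ennreal D * Lp_norm p B (?Fk k) + ennreal E' * Lp_norm 2 S3 (V k)) + b k"
      by (intro add_mono V(2)[OF k] d2)
    also have "\<dots> \<le> ennreal C * (ennreal E * (Lp_norm p S2 ?F + a k)
      + ennreal D * (Lp_norm p B ?F + a k) + ennreal E' * (Lp_norm 2 S3 v + b k)) + b k"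
    proof (intro add_right_mono mult_left_mono add_mono)
      show "Lp_norm p S2 (?Fk k) \<le> Lp_norm p S2 ?F + a k"
        using order_trans[OF up[OF p(1) S(2,5) mF] add_left_mono[OF dF]] .
      show "Lp_norm p B (?Fk k) \<le> Lp_norm p B ?F + a k"
        using order_trans[OF up[OF p(1) B order_refl mF] add_left_mono[OF dF]] .
      show "Lp_norm 2 S3 (V k) \<le> Lp_norm 2 S3 v + b k"
        using order_trans[OF up[OF _ S(3,6) v mB(1)] add_left_mono[OF d2]] by simp
    qed auto
    finally show ?thesis .
  qed
  have la: "a \<longlonglongrightarrow> 0 + ennreal \<theta> * 0" and lb: "b \<longlonglongrightarrow> ennreal \<omega> * 0"
    unfolding a_def[abs_def] b_def[abs_def] using limV limL by (intro tendsto_intros ennreal_tendsto_cmult; simp)+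
  have "(\<lambda>k. ennreal C * (ennreal E * (Lp_norm p S2 ?F + a k)
      + ennreal D * (Lp_norm p B ?F + a k) + ennreal E' * (Lp_norm 2 S3 v + b k)) + b k)
    \<longlonglongrightarrow> ennreal C * (ennreal E * (Lp_norm p S2 ?F + (0 + ennreal \<theta> * 0))
      + ennreal D * (Lp_norm p B ?F + (0 + ennreal \<theta> * 0)) + ennreal E' * (Lp_norm 2 S3 v + ennreal \<omega> * 0)) + ennreal \<omega> * 0"
    by (intro tendsto_add tendsto_const ennreal_tendsto_cmult la lb ennreal_less_top)
  then have "Lp_norm 2 S1 v \<le> ennreal C * (ennreal E * (Lp_norm p S2 ?F + (0 + ennreal \<theta> * 0))
      + ennreal D * (Lp_norm p B ?F + (0 + ennreal \<theta> * 0)) + ennreal E' * (Lp_norm 2 S3 v + ennreal \<omega> * 0)) + ennreal \<omega> * 0"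
    by (rule tendsto_lowerbound) (use ev in \<open>auto simp: eventually_sequentially\<close>)
  then show ?thesis by simp
qed

lemma AE_lebesgue_on_subset:
  assumes "AE x in lebesgue_on B. P x" "S \<subseteq> B" "S \<in> sets lebesgue" "B \<in> sets lebesgue"
  shows "AE x in lebesgue_on S. P x"
  using assms by (auto simp: AE_restrict_space_iff elim!: eventually_mono)

text \<open>The estimate is applied to mollifications of v = \<open>\<phi> u\<close>. On balls of
  radius at most 1/2 v is u, and on the ball of radius 1/2 the derivatives of \<phi> vanish, so
  there the limiting Laplacian is that of u.\<close>

lemma sobolev_limit_estimate:
  fixes u q :: "real^'n \<Rightarrow> 'a::{real_normed_field, euclidean_space}" and \<phi> :: "real^'n \<Rightarrow> real"
  assumes B: "B = ball 0 1" and N: "N = real CARD('n)" and \<zeta>: "mollifier (\<zeta> :: nat \<Rightarrow> real^'n \<Rightarrow> real)"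
    and \<phi>: "\<phi> \<in> test_functions B" "\<And>x. x \<in> ball 0 (1 / 2) \<Longrightarrow> \<phi> x = 1"
    and u: "u \<in> sobolev 2 p B" and q: "q \<in> Lp_cball (N / 2) B \<theta>"
    and ex: "1 \<le> p" "0 < p'" "1 / p = 1 / (N / 2) + 1 / p'" "1 / p + 1 / p' = 1" "1 / 2 = 1 / N + 1 / p'"
    and s: "0 \<le> s"
    and sob: "\<And>w :: real^'n \<Rightarrow> 'a. w \<in> test_functions B \<Longrightarrow> Lp_norm p' B w \<le> ennreal s * Lp_norm 2 B (grad_length w)"
    and r: "r1 \<le> 1 / 2" "r3 \<le> 1 / 2"
    and est: "\<And>V. V \<in> test_functions B \<Longrightarrow> Lp_norm 2 (ball 0 r1) V \<le> ennreal C *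
      (ennreal E * Lp_norm p (ball 0 (1 / 2)) (\<lambda>x. laplacian V x + q x * V x)
       + ennreal D * Lp_norm p B (\<lambda>x. laplacian V x + q x * V x) + ennreal E' * Lp_norm 2 (ball 0 r3) V)"
  shows "Lp_norm 2 (ball 0 r1) u \<le> ennreal C *
      (ennreal E * Lp_norm p B (\<lambda>x. weak_laplacian B u x + q x * u x)
       + ennreal D * Lp_norm p B (\<lambda>x. weak_laplacian B (\<lambda>y. \<phi> y *\<^sub>R u y) x + q x * (\<phi> x *\<^sub>R u x))
       + ennreal E' * Lp_norm 2 (ball 0 r3) u)"
proof -
  have Bo: "open B" and Bs: "B \<in> sets lebesgue" using B by auto
  have p0: "0 < p" using ex by simp
  have N0: "0 < N" using N by simp
  have half: "ball 0 t \<subseteq> B" if "t \<le> 1 / 2" for t using that B by auto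
  have uL: "u \<in> Lp_space p B" using u by (simp add: sobolev_def)
  have wd: "\<exists>g\<in>Lp_space p B. has_weak_deriv B is u g" if "length is \<le> 2" for "is"
    using u that by (simp add: sobolev_def)
  have "\<exists>g\<in>Lp_space p B. has_weak_deriv B [i] u g" "\<exists>g\<in>Lp_space p B. has_weak_deriv B [i, i] u g" for i
    by (rule wd; simp)+
  then obtain u1 u2 where u1: "\<And>i. u1 i \<in> Lp_space p B" "\<And>i. has_weak_deriv B [i] u (u1 i)"
    and u2: "\<And>i. u2 i \<in> Lp_space p B" "\<And>i. has_weak_deriv B [i, i] u (u2 i)" by metis
  let ?G = "\<lambda>x. \<Sum>i\<in>UNIV. product_deriv2 \<phi> u u1 u2 i x"
  have t1: "(\<lambda>x. 2 * partials [i] \<phi> x) \<in> test_functions B" for i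
    using test_functions_scaleR_right[OF smooth_const[of 2] test_functions_partials[OF \<phi>(1), of "[i]"]] by simp
  have GL: "?G \<in> Lp_space p B"
    unfolding product_deriv2_def
    by (intro Lp_space_sum[OF ex(1)] Lp_space_add[OF ex(1)] Lp_space_test_mult[OF p0 \<phi>(1)] Lp_space_test_mult[OF p0 t1]
        Lp_space_test_mult[OF p0 test_functions_partials[OF \<phi>(1)]] u1 u2 uL finite)
  have \<phi>uL: "(\<lambda>x. \<phi> x *\<^sub>R u x) \<in> Lp_space p B" by (rule Lp_space_test_mult[OF p0 \<phi>(1) uL])
  define v where "v = (\<lambda>x. indicator B x *\<^sub>R (\<phi> x *\<^sub>R u x))"
  define g where "g = (\<lambda>x. indicator B x *\<^sub>R ?G x)"
  have mv: "v \<in> borel_measurable lebesgue" "Lp_norm p UNIV v < top"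
    unfolding v_def by (rule Lp_space_extend[OF p0 Bs \<phi>uL])+
  have mg: "g \<in> borel_measurable lebesgue" "Lp_norm p UNIV g < top"
    unfolding g_def by (rule Lp_space_extend[OF p0 Bs GL])+
  obtain M where M: "compact M" "M \<subseteq> B" "\<And>x. x \<notin> M \<Longrightarrow> \<phi> x = 0"
    using \<phi>(1) unfolding test_functions_iff by blast
  \<comment> \<open>On a compact subset of the open unit ball the norm attains a maximum below
    1.\<close>
  obtain t where t: "t < 1" "\<And>x. x \<in> M \<Longrightarrow> norm x \<le> t"
  proof (cases "M = {}")
    case True
    then show thesis using that[of 0] by simp
  next
    case False
    then obtain y where "y \<in> M" "\<And>x. x \<in> M \<Longrightarrow> norm x \<le> norm y"
      using continuous_attains_sup[OF M(1) False, of norm] by (auto intro: continuous_intros)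
    then show thesis using that[of "norm y"] M(2) B by auto
  qed
  have supp: "v x = 0" if "norm x > t" for x
  proof -
    have "x \<notin> M" using t(2)[of x] that by auto
    then show ?thesis using M(3) by (simp add: v_def)
  qed
  have v_int: "integrable lebesgue v" by (rule integrable_of_Lp_bounded_support[OF ex(1) mv supp])
  have \<zeta>k: "\<zeta> k \<in> test_functions (ball 0 (1 / (real k + 1)))" for k using \<zeta> unfolding mollifier_def by blast
  define V where "V k = conv (\<zeta> k) v" for k
  have smV: "smooth (V k)" for k unfolding V_def by (rule smooth_conv[OF \<zeta>k v_int])
  \<comment> \<open>From \<open>k0\<close> on the mollification radius fits into the gap between t
    and 1, so the support stays inside B.\<close>
  obtain k0 :: nat where k0: "1 / (real k0 + 1) < 1 - t"
    using reals_Archimedean[of "1 - t"] t(1) by (auto simp: inverse_eq_divide add.commute)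
  have VT: "V k \<in> test_functions B" if "k0 \<le> k" for k
    unfolding V_def B
  proof (rule test_functions_conv[OF \<zeta>k v_int supp])
    have "1 / (real k + 1) \<le> 1 / (real k0 + 1)" using that by (intro divide_left_mono) auto
    then show "t + 1 / (real k + 1) < 1" using k0 by linarith
  qed
  have LV: "laplacian (V k) x = conv (\<zeta> k) g x" for k x
    unfolding V_def v_def g_def by (rule laplacian_conv_product[OF Bo \<zeta>k \<phi>(1) u1(2) u2(2)])
  have to_B: "(\<lambda>k. Lp_norm p B (f k)) \<longlonglongrightarrow> 0" if "(\<lambda>k. Lp_norm p UNIV (f k)) \<longlonglongrightarrow> 0" for f :: "nat \<Rightarrow> real^'n \<Rightarrow> 'a"
    by (rule tendsto_sandwich[OF _ _ tendsto_const that]) (auto intro!: always_eventually Lp_norm_subset[OF p0 Bs])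
  have limV: "(\<lambda>k. Lp_norm p B (\<lambda>x. V k x - v x)) \<longlonglongrightarrow> 0"
    unfolding V_def by (rule to_B[OF mollify_Lp[OF ex(1) \<zeta> mv supp]])
  have limL: "(\<lambda>k. Lp_norm p B (\<lambda>x. laplacian (V k) x - g x)) \<longlonglongrightarrow> 0"
    unfolding LV
  proof (rule to_B[OF mollify_Lp[OF ex(1) \<zeta> mg, of 1]])
    show "g x = 0" if "1 < norm x" for x using that B by (simp add: g_def)
  qed
  have vB: "v \<in> borel_measurable (lebesgue_on B)" and gB: "g \<in> borel_measurable (lebesgue_on B)"
    by (intro borel_measurable_lebesgue_onI mv mg)+
  \<comment> \<open>\<open>sobolev_laplacian\<close> supplies the required inequality with constant
    the square of s.\<close>
  have limV': "(\<lambda>k. Lp_norm p' B (\<lambda>x. V k x - v x)) \<longlonglongrightarrow> 0"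
  proof (rule sobolev_convergence[OF Bs ex(1,2) _ _ VT smV vB gB limV limL])
    show "Lp_norm p' B w \<le> ennreal (s\<^sup>2) * Lp_norm p B (laplacian w)" if "w \<in> test_functions B" for w :: "real^'n \<Rightarrow> 'a"
      by (rule sobolev_laplacian[OF Bs that p0 ex(2,4) s sob[OF that]])
  qed auto
  have "Lp_norm 2 (ball 0 r1) v \<le> ennreal C * (ennreal E * Lp_norm p (ball 0 (1 / 2)) (\<lambda>x. g x + q x * v x)
      + ennreal D * Lp_norm p B (\<lambda>x. g x + q x * v x) + ennreal E' * Lp_norm 2 (ball 0 r3) v)"
  proof (rule estimate_limit[OF Bs _ _ _ _ _ _ ex(1,2) _ ex(3) q smV est[OF VT] vB gB _ limV' limL])
    show "Lp_norm 2 B f \<le> ennreal (ball_const TYPE('n) * 1) * Lp_norm p' B f" if "f \<in> borel_measurable (lebesgue_on B)" for f :: "real^'n \<Rightarrow> 'a"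
      using that ex(2,5) B N by (intro Lp_norm_subset_ball) auto
  qed (use half r N0 in auto)
  moreover have "Lp_norm 2 (ball 0 t) v = Lp_norm 2 (ball 0 t) u" if "t \<le> 1 / 2" for t
    using half[OF that] \<phi>(2) that by (intro Lp_norm_cong) (auto simp: v_def subset_iff)
  moreover have "Lp_norm p B (\<lambda>x. g x + q x * v x)
      = Lp_norm p B (\<lambda>x. weak_laplacian B (\<lambda>y. \<phi> y *\<^sub>R u y) x + q x * (\<phi> x *\<^sub>R u x))"
  proof (rule Lp_norm_cong_AE)
    have "AE x in lebesgue_on B. weak_laplacian B (\<lambda>y. \<phi> y *\<^sub>R u y) x = ?G x"
      unfolding product_deriv2_def
      by (rule weak_laplacian_AE[OF Bo \<zeta>]) (rule has_weak_deriv_product[OF Bo \<phi>(1) u1(2) u2(2)])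
    moreover have "AE x in lebesgue_on B. x \<in> B" using Bs by (intro AE_I2) auto
    ultimately show "AE x in lebesgue_on B. norm (g x + q x * v x)
        = norm (weak_laplacian B (\<lambda>y. \<phi> y *\<^sub>R u y) x + q x * (\<phi> x *\<^sub>R u x))"
      by eventually_elim (simp add: g_def v_def)
  qed
  \<comment> \<open>Only this term is restricted to the ball of radius 1/2. It is compared with u
    there and then enlarged to B.\<close>
  moreover have "Lp_norm p (ball 0 (1 / 2)) (\<lambda>x. g x + q x * v x) \<le> Lp_norm p B (\<lambda>x. weak_laplacian B u x + q x * u x)"
  proof -
    have "AE x in lebesgue_on B. weak_laplacian B u x = (\<Sum>i\<in>UNIV. u2 i x)"
      by (rule weak_laplacian_AE[OF Bo \<zeta> u2(2)])
    then have "AE x in lebesgue_on (ball 0 (1 / 2)). weak_laplacian B u x = (\<Sum>i\<in>UNIV. u2 i x)"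
      by (rule AE_lebesgue_on_subset) (use half Bs in auto)
    moreover have "AE x in lebesgue_on (ball 0 (1 / 2)). x \<in> ball (0 :: real^'n) (1 / 2)" by (intro AE_I2) auto
    ultimately have "AE x in lebesgue_on (ball 0 (1 / 2)). norm (g x + q x * v x) = norm (weak_laplacian B u x + q x * u x)"
    proof eventually_elim
      fix x :: "real^'n" assume x: "x \<in> ball 0 (1 / 2)" and W: "weak_laplacian B u x = (\<Sum>i\<in>UNIV. u2 i x)"
      have "partials (i # is) \<phi> x = 0" for i "is"
        using partials_cong_open[of \<phi> "ball 0 (1 / 2)" "\<lambda>x. 1" x "i # is", OF test_functions_smooth[OF \<phi>(1)] open_ball \<phi>(2) x]
        by (simp add: partials_const)
      then have "product_deriv2 \<phi> u u1 u2 i x = u2 i x" for i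
        using \<phi>(2)[OF x] by (simp add: product_deriv2_def)
      moreover have "x \<in> B" using half[of "1 / 2"] x by auto
      ultimately show "norm (g x + q x * v x) = norm (weak_laplacian B u x + q x * u x)"
        using \<phi>(2)[OF x] W by (simp add: g_def v_def)
    qed
    then have "Lp_norm p (ball 0 (1 / 2)) (\<lambda>x. g x + q x * v x) = Lp_norm p (ball 0 (1 / 2)) (\<lambda>x. weak_laplacian B u x + q x * u x)"
      by (rule Lp_norm_cong_AE)
    also have "\<dots> \<le> Lp_norm p B (\<lambda>x. weak_laplacian B u x + q x * u x)"
      using half Bs by (intro Lp_norm_subset[OF p0]) auto
    finally show ?thesis .
  qed
  ultimately show ?thesis
    using r by (auto elim!: order_trans intro!: mult_left_mono add_mono)
qed

theorem theorem1p1: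
  fixes n :: nat and p p' rs r0 \<theta> :: real and \<sigma> :: ennreal
    and B :: "(real^'n) set"
    and Q :: "(real^'n \<Rightarrow> 'a::{real_normed_field, euclidean_space}) set"
  assumes n: "n = CARD('n)" "n \<ge> 3"
    and p: "p = 2 * real n / (real n + 2)"
    and p': "p' = 2 * real n / (real n - 2)"
    and B: "B = ball 0 1"
    and rs: "rs > 0"
      "\<forall>r. 0 < r \<and> r < rs \<longrightarrow>
         (\<exists>\<kappa>>0. \<forall>u \<in> (test_functions (B - {0}) :: (real^'n \<Rightarrow> 'a) set).
            \<forall>q \<in> Lp_cball (real n / 2) B r. \<forall>\<tau> \<in> carleman_exponents n.
              Lp_norm p' B (\<lambda>x. norm x powr (- \<tau>) *\<^sub>R u x)
                \<le> ennreal \<kappa> * Lp_norm p B (\<lambda>x. norm x powr (- \<tau>) *\<^sub>R (laplacian u x + q x * u x)))"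
    and \<sigma>: "\<sigma> = (SUP w \<in> {w :: real^'n \<Rightarrow> 'a. w \<in> sobolev_H10 B \<and>
                          Lp_norm 2 B (weak_grad_length B w) = 1}. Lp_norm p' B w)"
    and r0: "0 < r0" "r0 < rs"
    and \<theta>: "\<theta> > 0" "2 * ennreal \<theta> * \<sigma>\<^sup>2 < 1"
    and Q: "Q = Lp_cball (real n / 2) B (min r0 \<theta>)"
  shows "\<exists>c>0. \<forall>\<rho> \<phi>. 0 < \<rho> \<and> \<rho> < 1 / 2 \<and>
           \<phi> \<in> test_functions B \<and> (\<forall>x \<in> ball 0 (1 / 2). \<phi> x = 1) \<and> (\<forall>x. 0 \<le> \<phi> x \<and> \<phi> x \<le> 1) \<longrightarrow>
         (\<forall>m \<ge> 1. \<forall>\<tau> \<in> carleman_exponents n. \<forall>q \<in> Q. \<forall>u \<in> sobolev 2 p B \<inter> vanishing_space m.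
            \<forall>\<eta>. 0 < \<eta> \<and> \<eta> < \<rho> / 4 \<longrightarrow>
              ennreal c * Lp_norm 2 (ball 0 (\<rho> / 2)) u
                \<le> ennreal (\<eta> powr (- \<tau>)) * Lp_norm p B (\<lambda>x. weak_laplacian B u x + q x * u x)
                  + ennreal (2 powr (- (\<tau> + 1))) *
                      Lp_norm p B (\<lambda>x. weak_laplacian B (\<lambda>y. \<phi> y *\<^sub>R u y) x + q x * (\<phi> x *\<^sub>R u x))
                  + ennreal (3 ^ m * \<eta> powr (real m - (\<tau> + 3))) * vanishing_const m u)"
proof (cases "\<exists>\<phi> :: real^'n \<Rightarrow> real. \<phi> \<in> test_functions B \<and> (\<forall>x \<in> ball 0 (1 / 2). \<phi> x = 1) \<and> (\<forall>x. 0 \<le> \<phi> x \<and> \<phi> x \<le> 1)")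
  case False
  then show ?thesis by (intro exI[of _ 1]) auto
next
  case True
  then obtain \<phi>0 :: "real^'n \<Rightarrow> real" where \<phi>0: "\<phi>0 \<in> test_functions B" "\<And>x. x \<in> ball 0 (1 / 2) \<Longrightarrow> \<phi>0 x = 1" "\<And>x. 0 \<le> \<phi>0 x" "\<And>x. \<phi>0 x \<le> 1"
    by blast
  obtain \<zeta> :: "nat \<Rightarrow> real^'n \<Rightarrow> real" where \<zeta>: "mollifier \<zeta>"
    using mollifier_exists[of \<phi>0] \<phi>0 B by auto
  obtain K where K: "1 \<le> K" "\<And>x. grad_length \<phi>0 x \<le> K" "\<And>x. \<bar>laplacian \<phi>0 x\<bar> \<le> K\<^sup>2"
    by (rule cutoff_bounds[OF \<phi>0(1), where thesis=thesis]) (rule that)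
  obtain \<kappa> where \<kappa>: "\<kappa> > 0" "\<forall>u \<in> (test_functions (B - {0}) :: (real^'n \<Rightarrow> 'a) set).
            \<forall>q \<in> Lp_cball (real n / 2) B r0. \<forall>\<tau> \<in> carleman_exponents n.
              Lp_norm p' B (\<lambda>x. norm x powr (- \<tau>) *\<^sub>R u x)
                \<le> ennreal \<kappa> * Lp_norm p B (\<lambda>x. norm x powr (- \<tau>) *\<^sub>R (laplacian u x + q x * u x))"
    using rs r0 by blast
  have n3: "3 \<le> real n" using n by simp
  have ex: "1 \<le> p" "0 < p'" "1 / p = 1 / (real n / 2) + 1 / p'" "1 / p + 1 / p' = 1" "1 / p = 1 / real n + 1 / 2" "1 / 2 = 1 / real n + 1 / p'"
    using n3 unfolding p p' by (auto simp: field_simps)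
  \<comment> \<open>An infinite Sobolev constant would contradict the smallness condition, as
    \<theta> > 0.\<close>
  have "\<sigma> \<noteq> top"
  proof
    assume "\<sigma> = top"
    then have "2 * ennreal \<theta> * \<sigma>\<^sup>2 = top" using \<theta>(1) by (simp add: power2_eq_square ennreal_mult_top)
    then show False using \<theta>(2) by simp
  qed
  then obtain s where s: "\<sigma> = ennreal s" "0 \<le> s" by (cases \<sigma>) auto
  have \<theta>s: "\<theta> * s\<^sup>2 \<le> 1 / 2"
  proof -
    have "2 * ennreal \<theta> * \<sigma>\<^sup>2 = ennreal (2 * \<theta> * s\<^sup>2)"
      using s \<theta>(1) by (simp add: ennreal_mult ennreal_power)
    then have "ennreal (2 * \<theta> * s\<^sup>2) < ennreal 1" using \<theta>(2) by simp
    then show ?thesis by (subst (asm) ennreal_less_iff) (use \<theta>(1) in auto)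
  qed
  have Bo: "open B" using B by simp
  have sob: "Lp_norm p' B w \<le> ennreal s * Lp_norm 2 B (grad_length w)" if "w \<in> test_functions B" for w :: "real^'n \<Rightarrow> 'a"
    using sobolev_test_functions[OF Bo \<zeta> that ex(2)] unfolding \<sigma>[symmetric] s(1) .
  let ?\<omega> = "ball_const TYPE('n)"
  \<comment> \<open>\<kappa> comes from r0, s from \<sigma>, and K from the auxiliary
    \<open>\<phi>0\<close>. The \<phi> of the statement only enters the approximation of u, so C is
    independent of it.\<close>
  define C where "C = 1 + ?\<omega> * \<kappa> * (3 + 6 * K * ?\<omega> * s + 8 * K\<^sup>2 * ?\<omega>)"
  have C: "0 < C"
    unfolding C_def using \<kappa>(1) s(2) K(1) ball_const_pos[where 'n='n] by (intro add_pos_nonneg) auto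
  have key: "ennreal (1 / C) * Lp_norm 2 (ball 0 (\<rho> / 2)) u
                \<le> ennreal (\<eta> powr (- \<tau>)) * Lp_norm p B (\<lambda>x. weak_laplacian B u x + q x * u x)
                  + ennreal (2 powr (- (\<tau> + 1))) *
                      Lp_norm p B (\<lambda>x. weak_laplacian B (\<lambda>y. \<phi> y *\<^sub>R u y) x + q x * (\<phi> x *\<^sub>R u x))
                  + ennreal (3 ^ m * \<eta> powr (real m - (\<tau> + 3))) * vanishing_const m u"
    if \<rho>: "0 < \<rho>" "\<rho> < 1 / 2" and \<phi>: "\<phi> \<in> test_functions B" "\<And>x. x \<in> ball 0 (1 / 2) \<Longrightarrow> \<phi> x = 1"
      and \<tau>: "\<tau> \<in> carleman_exponents n" and q: "q \<in> Q" and u: "u \<in> sobolev 2 p B" and \<eta>: "0 < \<eta>" "\<eta> < \<rho> / 4"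
    for \<rho> \<tau> \<eta> and \<phi> :: "real^'n \<Rightarrow> real" and m and q u
  proof -
    have \<tau>0: "0 < \<tau>" using \<tau> by (simp add: carleman_exponents_def)
    \<comment> \<open>The radius r0 makes the Carleman inequality applicable, the radius \<theta>
      the Caccioppoli inequality.\<close>
    have qr: "q \<in> Lp_cball (real n / 2) B r0" and q\<theta>: "q \<in> Lp_cball (real n / 2) B \<theta>"
      using q order_trans[OF _ ennreal_leI[of "min r0 \<theta>" r0]] order_trans[OF _ ennreal_leI[of "min r0 \<theta>" \<theta>]]
      unfolding Q Lp_cball_def by auto
    let ?W = "Lp_norm p B (\<lambda>x. weak_laplacian B u x + q x * u x)"
    let ?W' = "Lp_norm p B (\<lambda>x. weak_laplacian B (\<lambda>y. \<phi> y *\<^sub>R u y) x + q x * (\<phi> x *\<^sub>R u x))"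
    have est: "Lp_norm 2 (ball 0 (\<rho> / 2)) V \<le> ennreal C *
     (ennreal (\<eta> powr (- \<tau>)) * Lp_norm p (ball 0 (1 / 2)) (\<lambda>x. laplacian V x + q x * V x)
      + ennreal (2 powr (- (\<tau> + 1))) * Lp_norm p B (\<lambda>x. laplacian V x + q x * V x)
      + ennreal (\<eta> powr (- (\<tau> + 1))) * Lp_norm 2 (ball 0 (2 * \<eta>)) V)" if V: "V \<in> test_functions B" for V
      unfolding C_def B
      by (rule main_estimate[where \<phi>=\<phi>0 and \<theta>=\<theta> and p'=p'])
        (use \<phi>0 K V q\<theta> ex s \<theta> \<theta>s sob \<kappa> \<tau>0 \<eta> \<rho> qr \<tau> n in \<open>auto simp: B\<close>)
    have "Lp_norm 2 (ball 0 (\<rho> / 2)) u \<le> ennreal C * (ennreal (\<eta> powr (- \<tau>)) * ?W + ennreal (2 powr (- (\<tau> + 1))) * ?W'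
        + ennreal (\<eta> powr (- (\<tau> + 1))) * Lp_norm 2 (ball 0 (2 * \<eta>)) u)"
      by (rule sobolev_limit_estimate[OF B n(1)[THEN arg_cong[of _ _ real]] \<zeta> \<phi> u q\<theta> ex(1-4,6) s(2) sob _ _ est])
        (use \<rho> \<eta> in auto)
    also have "\<dots> \<le> ennreal C * (ennreal (\<eta> powr (- \<tau>)) * ?W + ennreal (2 powr (- (\<tau> + 1))) * ?W'
        + ennreal (3 ^ m * \<eta> powr (real m - (\<tau> + 3))) * vanishing_const m u)"
    proof (intro mult_left_mono add_left_mono)
      let ?L = "Lp_norm 2 (ball 0 (2 * \<eta>)) u"
      \<comment> \<open>The supremum is evaluated at radius 2\<eta>, which is below 1.\<close>
      have "ennreal ((2 * \<eta>) powr (- real m)) * ?L \<le> vanishing_const m u"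
        unfolding vanishing_const_def using \<eta> \<rho> by (intro SUP_upper) auto
      then have "ennreal ((2 * \<eta>) powr real m) * (ennreal ((2 * \<eta>) powr (- real m)) * ?L)
          \<le> ennreal ((2 * \<eta>) powr real m) * vanishing_const m u"
        by (rule mult_left_mono) simp
      moreover have "ennreal ((2 * \<eta>) powr real m) * (ennreal ((2 * \<eta>) powr (- real m)) * ?L) = ?L"
      proof -
        have "(2 * \<eta>) powr real m * (2 * \<eta>) powr (- real m) = 1" using \<eta> by (simp flip: powr_add)
        then show ?thesis by (simp add: mult.assoc[symmetric] flip: ennreal_mult)
      qed
      ultimately have L: "?L \<le> ennreal ((2 * \<eta>) powr real m) * vanishing_const m u" by simp
      have "\<eta> powr (- (\<tau> + 1)) * (2 * \<eta>) powr real m = 2 ^ m * \<eta> powr (real m - (\<tau> + 1))"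
      proof -
        have "(2 * \<eta>) powr real m = 2 ^ m * \<eta> powr real m"
          using \<eta> by (simp add: powr_mult powr_realpow)
        moreover have "\<eta> powr (real m - (\<tau> + 1)) = \<eta> powr (- (\<tau> + 1)) * \<eta> powr real m"
          by (simp add: algebra_simps flip: powr_add)
        ultimately show ?thesis by (simp only: mult_ac)
      qed
      \<comment> \<open>Enlarging 2 to 3 and lowering the exponent of \<eta> < 1 by 2 brings the
        factor to the stated form.\<close>
      also have "\<dots> \<le> 3 ^ m * \<eta> powr (real m - (\<tau> + 3))"
        using \<eta> \<rho> by (intro mult_mono power_mono powr_mono') auto
      finally have c: "\<eta> powr (- (\<tau> + 1)) * (2 * \<eta>) powr real m \<le> 3 ^ m * \<eta> powr (real m - (\<tau> + 3))" .
      have "ennreal (\<eta> powr (- (\<tau> + 1))) * ?L \<le> ennreal (\<eta> powr (- (\<tau> + 1))) * (ennreal ((2 * \<eta>) powr real m) * vanishing_const m u)"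
        by (intro mult_left_mono L) auto
      also have "\<dots> = ennreal (\<eta> powr (- (\<tau> + 1)) * (2 * \<eta>) powr real m) * vanishing_const m u"
        by (simp add: ennreal_mult mult.assoc)
      also have "\<dots> \<le> ennreal (3 ^ m * \<eta> powr (real m - (\<tau> + 3))) * vanishing_const m u"
        by (intro mult_right_mono ennreal_leI c) auto
      finally show "ennreal (\<eta> powr (- (\<tau> + 1))) * ?L \<le> ennreal (3 ^ m * \<eta> powr (real m - (\<tau> + 3))) * vanishing_const m u" .
    qed auto
    finally have "ennreal (1 / C) * Lp_norm 2 (ball 0 (\<rho> / 2)) u \<le> ennreal (1 / C) * (ennreal C * (ennreal (\<eta> powr (- \<tau>)) * ?W
        + ennreal (2 powr (- (\<tau> + 1))) * ?W' + ennreal (3 ^ m * \<eta> powr (real m - (\<tau> + 3))) * vanishing_const m u))"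
      by (rule mult_left_mono) simp
    moreover have "ennreal (1 / C) * (ennreal C * z) = z" for z
      using C by (simp add: mult.assoc[symmetric] flip: ennreal_mult)
    ultimately show ?thesis by simp
  qed
  show ?thesis
    using C key by (intro exI[of _ "1 / C"]) auto
qed

end
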